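(* Let $n\ge2$ and let $\mathbf{X}$ be a random vector distributed with density $f_\infty(|\mathbf{x}|)$, $\mathbf{x}\in\mathbb{R}^n$, where the probability density function $f_\infty(|\mathbf{x}|)$ satisfies the differential equation $$\nabla\left[K(|\mathbf{x}|)f_\infty(|\mathbf{x}|)\right]+\mathbf{x}\,f_\infty(|\mathbf{x}|)=0$$ with a positive weight function $K$. Suppose that there exists a real value $R>0$ such that, for any $r\ge R$, the weight function $K(r)$ satisfies the inequality $$(n-1)\frac{K(r)}{r^2}\le\frac12,$$ and suppose moreover that the one-dimensional probability density $f(\rho)=\sigma_n\rho^{n-1}f_\infty(\rho)$ satisfies the one-dimensional Poincaré inequality on $I=(0,+\infty)$ with weight $w(\rho)$. Then there exist a constant $C>0$, not depending on the test function $\phi$, and a positive constant $c(R)$ depending only on $R$ (in the given dimension $n$), such that for any smooth function $\phi$ on $\mathbb{R}^n$ satisfying $$|\phi(\mathbf{x})|+|\nabla\phi(\mathbf{x})|\le C_\phi<\infty\quad\text{for all }\mathbf{x}\in\mathbb{R}^n$$ with some constant $C_\phi>0$ depending on $\phi$, we have $$\int_{\mathbb{R}^n}\phi^2(\mathbf{x})f_\infty(|\mathbf{x}|)\,d\mathbf{x}-\left(\int_{\mathbb{R}^n}\phi(\mathbf{y})f_\infty(|\mathbf{y}|)\,d\mathbf{y}\right)^2\le C\left(\int_{\mathbb{R}^n}W(|\mathbf{x}|)\,|\nabla\phi(\mathbf{x})|^2 f_\infty(|\mathbf{x}|)\,d\mathbf{x}+c(R)\int_{|\mathbf{x}|=R}|\nabla\phi(\mathbf{x})|^2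 f_\infty(|\mathbf{x}|)\,d\sigma(\mathbf{x})\right),$$ where $$W(|\mathbf{x}|)=\max\left(w(|\mathbf{x}|),|\mathbf{x}|^2\right)\chi_{|\mathbf{x}|\le R}+K(|\mathbf{x}|)\,\chi_{|\mathbf{x}|>R}.$$
   Context: Here $\sigma_n=2\pi^{n/2}/\Gamma(n/2)$ is the measure of the unit hyperspherical surface in $\mathbb{R}^n$ ($\Gamma$ is the Euler Gamma function), $d\sigma(\mathbf{x})$ is the surface measure on the sphere $|\mathbf{x}|=R$, and $\chi$ denotes the indicator function. A probability density $g$ on an interval $I\subseteq\mathbb{R}$ is said to satisfy the one-dimensional (weighted) Poincaré inequality on $I$ with weight $w$, where $w$ is a fixed nonnegative Borel measurable function on $I$, if for any bounded smooth scalar function $\varphi$ on $I$ $$\int_I\left(\varphi(x)-\int_I\varphi(y)g(y)\,dy\right)^2 g(x)\,dx\le\int_I w(x)\,(\varphi'(x))^2 g(x)\,dx .$$ All these inequalities are understood in the following sense: if the right-hand side is finite, then the inequality holds. *)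

theory Defs
  imports "HOL-Probability.Probability"
begin

definition gradient :: "('a::euclidean_space \<Rightarrow> real) \<Rightarrow> 'a \<Rightarrow> 'a" where
  "gradient f x = (\<Sum>b\<in>Basis. frechet_derivative f (at x) b *\<^sub>R b)"

lemma GDERIV_gradient:
  assumes "f differentiable (at x)"
  shows "GDERIV f x :> gradient f x"
proof -
  let ?D = "frechet_derivative f (at x)"
  have D: "(f has_derivative ?D) (at x)"
    using assms frechet_derivative_works by blast
  then interpret D: bounded_linear ?D by (rule has_derivative_bounded_linear)
  have "?D h = h \<bullet> gradient f x" for h
  proof -
    have "?D h = ?D (\<Sum>b\<in>Basis. (h \<bullet> b) *\<^sub>R b)"
      by (simp only: euclidean_representation)
    also have "\<dots> = (\<Sum>b\<in>Basis. (h \<bullet> b) * ?D b)"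
      by (simp add: D.sum D.scaleR)
    finally show ?thesis
      by (simp add: gradient_def inner_sum_right mult.commute)
  qed
  then have "?D = (\<lambda>h. h \<bullet> gradient f x)" ..
  with D show ?thesis
    by (simp add: gderiv_def)
qed

text \<open>Classes of continuously differentiable real functions on a set \<open>S\<close>, which is meant to
  be open: derivatives are taken in the ambient space, by iterated partial derivatives.\<close>

primrec Ck_on :: "nat \<Rightarrow> 'a::euclidean_space set \<Rightarrow> ('a \<Rightarrow> real) \<Rightarrow> bool" where
  "Ck_on 0 S f \<longleftrightarrow> continuous_on S f"
| "Ck_on (Suc k) S f \<longleftrightarrow> (\<forall>x\<in>S. f differentiable (at x)) \<and>
     (\<forall>b\<in>Basis. Ck_on k S (\<lambda>x. frechet_derivative f (at x) b))"

definition smooth_on :: "'a::euclidean_space set \<Rightarrow> ('a \<Rightarrow> real) \<Rightarrow> bool" where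
  "smooth_on S f \<longleftrightarrow> (\<forall>k. Ck_on k S f)"

definition unit_sphere_area :: "nat \<Rightarrow> real" where
  "unit_sphere_area n = 2 * pi powr (real n / 2) / Gamma (real n / 2)"

text \<open>Surface measure on the sphere of radius \<open>R > 0\<close> about the origin, as a measure on the
  whole space. The surface measure of a Borel subset \<open>A\<close> of the sphere is \<open>n / R\<close> times
  the Lebesgue measure of the cone of all \<open>t *\<^sub>R a\<close> with \<open>a \<in> A\<close> and \<open>0 < t \<le> 1\<close>; this cone is
  the preimage of \<open>A\<close> under the radial projection of the punctured ball.\<close>

definition sphere_measure :: "real \<Rightarrow> 'a::euclidean_space measure" where
  "sphere_measure R = scale_measure (ennreal (real DIM('a) / R))
     (distr (restrict_space lborel (cball 0 R - {0})) borel (\<lambda>x. (R / norm x) *\<^sub>R x))"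

lemma emeasure_sphere_measure:
  assumes "R > 0"
  shows "emeasure (sphere_measure R :: 'a::euclidean_space measure) (sphere 0 R) =
           ennreal (unit_sphere_area DIM('a) * R ^ (DIM('a) - 1))"
    and "emeasure (sphere_measure R :: 'a measure) (- sphere 0 R) = 0"
proof -
  let ?B = "cball 0 R - {0 :: 'a}"
  let ?p = "\<lambda>x::'a. (R / norm x) *\<^sub>R x"
  have meas: "?p \<in> measurable (restrict_space lborel ?B) borel"
  proof -
    have "?p \<in> borel_measurable lborel" by measurable
    then show ?thesis by (rule measurable_restrict_space1)
  qed
  have sp: "space (restrict_space lborel ?B) = ?B"
    by (simp add: space_restrict_space)
  have proj: "?p x \<in> sphere 0 R" if "x \<in> ?B" for x
    using that assms by simp
  have pre: "?p -` sphere 0 R \<inter> ?B = ?B" and pre': "?p -` (- sphere 0 R) \<inter> ?B = {}"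
    using proj by blast+
  have "emeasure lborel ?B = emeasure lborel (cball 0 R :: 'a set)"
    by (subst emeasure_Diff) (use assms in auto)
  also have "\<dots> = ennreal (unit_ball_vol (real DIM('a)) * R ^ DIM('a))"
    using assms by (simp add: emeasure_cball)
  finally have vol: "emeasure lborel ?B = ennreal (unit_ball_vol (real DIM('a)) * R ^ DIM('a))" .
  have "Gamma (real DIM('a) / 2 + 1) = real DIM('a) / 2 * Gamma (real DIM('a) / 2)"
  proof (rule Gamma_plus1)
    have "0 < real DIM('a) / 2" by simp
    then show "real DIM('a) / 2 \<notin> \<int>\<^sub>\<le>\<^sub>0"
      by (meson nonpos_Ints_nonpos not_le)
  qed
  moreover have "Gamma (real DIM('a) / 2) > 0"
    by (intro Gamma_real_pos) simp
  ultimately have "real DIM('a) * unit_ball_vol (real DIM('a)) = unit_sphere_area DIM('a)"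
    by (simp only: unit_ball_vol_def unit_sphere_area_def) (simp add: divide_simps)
  moreover have "R ^ DIM('a) = R * R ^ (DIM('a) - 1)"
    using power_Suc[of R "DIM('a) - 1"] by simp
  ultimately have "real DIM('a) / R * (unit_ball_vol (real DIM('a)) * R ^ DIM('a)) =
      unit_sphere_area DIM('a) * R ^ (DIM('a) - 1)"
    using assms by (simp add: field_simps)
  then show "emeasure (sphere_measure R :: 'a measure) (sphere 0 R) =
           ennreal (unit_sphere_area DIM('a) * R ^ (DIM('a) - 1))"
    using assms meas
    by (simp add: sphere_measure_def emeasure_distr sp pre emeasure_restrict_space vol
          flip: ennreal_mult)
  show "emeasure (sphere_measure R :: 'a measure) (- sphere 0 R) = 0"
    using meas by (simp add: sphere_measure_def emeasure_distr sp pre')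
qed

text \<open>For an open interval \<open>I\<close>. The integrand on the right-hand side is measurable and
  nonnegative on \<open>I\<close>, so integrability means that its integral is finite.\<close>

definition weighted_poincare :: "real set \<Rightarrow> (real \<Rightarrow> real) \<Rightarrow> (real \<Rightarrow> real) \<Rightarrow> bool" where
  "weighted_poincare I w g \<longleftrightarrow>
     (\<forall>x\<in>I. 0 \<le> g x) \<and> set_integrable lborel I g \<and> (LBINT x:I. g x) = 1 \<and>
     (\<forall>x\<in>I. 0 \<le> w x) \<and> set_borel_measurable borel I w \<and>
     (\<forall>\<phi>. smooth_on I \<phi> \<longrightarrow> bounded (\<phi> ` I) \<longrightarrow>
        set_integrable lborel I (\<lambda>x. w x * (deriv \<phi> x)\<^sup>2 * g x) \<longrightarrow>
        (LBINT x:I. (\<phi> x - (LBINT y:I. \<phi> y * g y))\<^sup>2 * g x)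
          \<le> (LBINT x:I. w x * (deriv \<phi> x)\<^sup>2 * g x))"

end

theory Submission
  imports Defs
begin

text \<open>
The idea is to replace \<open>\<phi>\<close> outside the ball of radius \<open>R\<close> by its radially constant extension
\<open>\<Phi> (r \<omega>) = \<phi> (min r R \<omega>)\<close> and to compare \<open>\<phi>\<close> with a constant through \<open>\<Phi>\<close> and through the truncated
spherical mean \<open>\<psi> (min r R)\<close>, where \<open>\<psi> r\<close> is the average of \<open>\<phi>\<close> over the sphere of radius \<open>r\<close>:
\<open>(\<phi> - m)\<^sup>2 \<le> 2 (\<phi> - \<Phi>)\<^sup>2 + 4 (\<Phi> - \<psi> (min r R))\<^sup>2 + 4 (\<psi> (min r R) - m)\<^sup>2\<close>.
As the variance is at most the mean of \<open>(\<phi> - m)\<^sup>2\<close>, it is enough to bound the three means in polar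
coordinates (\<open>nn_integral_polar\<close>).

The first one lives on \<open>r > R\<close>, where the equation for the density reads \<open>(K f)' = - r f\<close> on every ray.
Integrating \<open>h\<^sup>2 r\<^bsup>n-1\<^esup> f = - h\<^sup>2 r\<^bsup>n-2\<^esup> (K f)'\<close> by parts gives a Hardy inequality
with weight \<open>K\<close> (\<open>tail_hardy\<close>); the growth condition on \<open>K\<close> is what allows the lower order terms to be
absorbed. With \<open>h = 1\<close> the same inequality bounds the mass outside the ball by a multiple of
\<open>R\<^sup>n f R\<close>.

The second one is a Poincare inequality on spheres (\<open>sphere_poincare\<close>). For \<open>r \<le> R\<close> it produces the weight
\<open>r\<^sup>2\<close>. For \<open>r > R\<close> the function \<open>\<Phi>\<close> only sees the sphere of radius \<open>R\<close>, and the bound on the outer mass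
turns the result into \<open>R ^ 3\<close> times the surface integral in the statement.

The third one is the one-dimensional inequality (\<open>truncated_poincare\<close>). The function \<open>\<psi> (min r R)\<close> is not
smooth, so it is approximated by primitives of \<open>\<psi>' \<eta>\<close> with smooth cutoffs \<open>0 \<le> \<eta> \<le> 1\<close> that vanish
beyond \<open>R\<close>. Cutting off the derivative, instead of smoothing the function, keeps the weighted energy below
that of \<open>\<psi>\<close> on \<open>r < R\<close>, whatever the singularities of \<open>w\<close> are.

The argument gives \<open>c R = R ^ 3\<close> and a constant \<open>C\<close> that depends on the dimension only.
\<close>

section \<open>Means and variances\<close>

lemma (in finite_measure) integrable_bounded_measurable:
  fixes f :: "'a \<Rightarrow> real"
  assumes "f \<in> borel_measurable M" "\<And>x. \<bar>f x\<bar> \<le> B"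
  shows "integrable M f"
  by (rule integrable_const_bound[where B = B]) (use assms in auto)

text \<open>Used twice: the radial estimate compares with a constant that is only known to exist, and averaging over
  \<open>c\<close> bounds a variance by a double integral of squared differences.\<close>

lemma (in prob_space) mean_minimizes:
  fixes g :: "'a \<Rightarrow> real"
  assumes [measurable]: "integrable M g" "integrable M (\<lambda>x. (g x)\<^sup>2)"
  shows "(\<integral>\<^sup>+x. ennreal ((g x - expectation g)\<^sup>2) \<partial>M) \<le> (\<integral>\<^sup>+x. ennreal ((g x - c)\<^sup>2) \<partial>M)"
proof -
  have int: "integrable M (\<lambda>x. (g x - c)\<^sup>2)" for c
    using assms by (simp add: power2_diff)
  have eq: "expectation (\<lambda>x. (g x - c)\<^sup>2) = expectation (\<lambda>x. (g x)\<^sup>2) - 2 * c * expectation g + c\<^sup>2" for c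
    using assms by (simp add: power2_diff prob_space mult_ac)
  have "0 \<le> (expectation g - c)\<^sup>2" by simp
  then have "expectation (\<lambda>x. (g x - expectation g)\<^sup>2) \<le> expectation (\<lambda>x. (g x - c)\<^sup>2)"
    unfolding eq by (simp add: power2_diff power2_eq_square algebra_simps)
  then show ?thesis
    by (simp add: nn_integral_eq_integral int ennreal_leI)
qed

lemma (in prob_space) square_expectation_le:
  fixes Y :: "'a \<Rightarrow> real"
  assumes "integrable M Y" "integrable M (\<lambda>x. (Y x)\<^sup>2)"
  shows "(expectation Y)\<^sup>2 \<le> expectation (\<lambda>x. (Y x)\<^sup>2)"
  using variance_eq[OF assms] variance_positive[of Y] by simp


section \<open>The uniform distribution on the sphere and polar coordinates\<close>

lemma borel_measurable_sgn [measurable]: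
  "(sgn :: 'a::euclidean_space \<Rightarrow> 'a) \<in> borel_measurable borel"
  unfolding sgn_div_norm[abs_def] by measurable

text \<open>The radial projection of the uniform distribution on the unit ball. The centre is sent to \<open>0\<close>, which is
  a null event, so the unit sphere carries full measure.\<close>

definition uniform_sphere :: "'a::euclidean_space measure" where
  "uniform_sphere = distr (uniform_measure lborel (ball 0 1)) borel sgn"

lemma emeasure_unit_ball:
  "emeasure lborel (ball (0::'a::euclidean_space) 1) = ennreal (unit_ball_vol DIM('a))"
  by (simp add: emeasure_ball)

lemma measurable_sgn_uniform:
  "sgn \<in> measurable (uniform_measure lborel A) (borel :: 'a::euclidean_space measure)"
  by (subst measurable_cong_sets[of _ borel _ borel]) auto

lemma unit_ball_vol_neq_0: "unit_ball_vol (real n) \<noteq> 0"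
  by (metis less_irrefl of_nat_0_le_iff unit_ball_vol_pos)

lemma sets_uniform_sphere [simp, measurable_cong]: "sets uniform_sphere = sets borel"
  by (simp add: uniform_sphere_def)

lemma space_uniform_sphere [simp]: "space uniform_sphere = UNIV"
  by (simp add: uniform_sphere_def)

lemma prob_space_uniform_sphere: "prob_space (uniform_sphere :: 'a::euclidean_space measure)"
  unfolding uniform_sphere_def
proof (rule prob_space.prob_space_distr)
  show "prob_space (uniform_measure lborel (ball (0::'a) 1))"
    by (intro prob_space_uniform_measure) (simp_all add: emeasure_unit_ball unit_ball_vol_neq_0)
  show "sgn \<in> measurable (uniform_measure lborel (ball 0 1)) (borel :: 'a measure)"
    by (rule measurable_sgn_uniform)
qed

interpretation uniform_sphere: prob_space "uniform_sphere :: 'a::euclidean_space measure"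
  by (rule prob_space_uniform_sphere)

lemma AE_uniform_sphere: "AE \<omega> in (uniform_sphere :: 'a::euclidean_space measure). norm \<omega> = 1"
proof -
  have "AE x in uniform_measure lborel (ball (0::'a) 1). norm (sgn x) = 1"
    by (rule AE_uniform_measureI) (use AE_lborel_singleton[of 0] in \<open>auto simp: norm_sgn\<close>)
  then show ?thesis
    unfolding uniform_sphere_def by (subst AE_distr_iff) (auto intro: measurable_sgn_uniform)
qed

lemma nn_integral_uniform_sphere:
  fixes F :: "'a::euclidean_space \<Rightarrow> ennreal"
  assumes [measurable]: "F \<in> borel_measurable borel"
  shows "(\<integral>\<^sup>+\<omega>. F \<omega> \<partial>uniform_sphere) =
    (\<integral>\<^sup>+x. F (sgn x) * indicator (ball 0 1) x \<partial>lborel) / ennreal (unit_ball_vol DIM('a))"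
  unfolding uniform_sphere_def
  by (subst nn_integral_distr) (auto intro: measurable_sgn_uniform simp: nn_integral_uniform_measure emeasure_unit_ball)

lemma unit_sphere_area_eq:
  assumes "n > 0"
  shows "unit_sphere_area n = real n * unit_ball_vol n"
proof -
  have "Gamma (real n / 2 + 1) = real n / 2 * Gamma (real n / 2)"
    using assms by (intro Gamma_plus1) (auto elim!: nonpos_Ints_cases)
  moreover have "Gamma (real n / 2) > 0"
    using assms by (intro Gamma_real_pos) simp
  ultimately show ?thesis
    using assms by (simp only: unit_ball_vol_def unit_sphere_area_def) (simp add: divide_simps)
qed

lemma unit_sphere_area_pos: "n > 0 \<Longrightarrow> unit_sphere_area n > 0"
  by (simp add: unit_sphere_area_eq)

lemma sgn_scaleR_pos: "r > 0 \<Longrightarrow> sgn (r *\<^sub>R x) = (sgn x :: 'a::real_normed_vector)"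
  by (simp add: sgn_scaleR)

text \<open>The homogeneity of Lebesgue measure; everything about polar coordinates follows from it.\<close>

lemma emeasure_cone:
  assumes r: "r > 0" and B: "B \<in> sets (borel :: 'a::euclidean_space measure)"
  shows "emeasure lborel {x::'a. norm x < r \<and> sgn x \<in> B} =
    ennreal (unit_ball_vol DIM('a) * r ^ DIM('a)) * emeasure uniform_sphere B"
proof -
  note [measurable] = B
  let ?E = "\<lambda>r. {x::'a. norm x < r \<and> sgn x \<in> B}"
  have meas: "?E r \<in> sets borel" for r by measurable
  have "bij_betw (\<lambda>x. r *\<^sub>R x + 0) (?E 1) (?E r)"
    by (rule bij_betwI[where g = "\<lambda>x. (1 / r) *\<^sub>R x"])
       (use r in \<open>auto simp: sgn_scaleR_pos field_simps\<close>)
  then have "?E r = (\<lambda>x. r *\<^sub>R x + 0) ` ?E 1"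
    by (simp add: bij_betw_def)
  then have "emeasure lebesgue (?E r) = \<bar>r\<bar> ^ DIM('a) * emeasure lebesgue (?E 1)"
    by (simp only: emeasure_lebesgue_affine)
  then have 1: "emeasure lborel (?E r) = ennreal (r ^ DIM('a)) * emeasure lborel (?E 1)"
    using r meas by (simp add: ennreal_power)
  have eq: "ball 0 1 \<inter> sgn -` B = ?E 1" by auto
  have "sgn -` B \<in> sets borel" using measurable_sets[OF borel_measurable_sgn B] by simp
  then have "emeasure uniform_sphere B = emeasure lborel (?E 1) / ennreal (unit_ball_vol DIM('a))"
    unfolding uniform_sphere_def
    using B by (subst emeasure_distr) (auto intro!: measurable_sgn_uniform simp: emeasure_unit_ball eq)
  then have "ennreal (unit_ball_vol DIM('a)) * emeasure uniform_sphere B = emeasure lborel (?E 1)"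
    by (simp add: ennreal_times_divide mult.commute[of "ennreal _"] ennreal_mult_divide_eq unit_ball_vol_neq_0)
  then have "ennreal (r ^ DIM('a)) * (ennreal (unit_ball_vol DIM('a)) * emeasure uniform_sphere B) =
      emeasure lborel (?E r)"
    using 1 by simp
  then show ?thesis using r
    by (simp add: ennreal_mult mult_ac)
qed

text \<open>The distribution of the norm under Lebesgue measure in dimension \<open>n\<close>.\<close>

definition radial_measure :: "nat \<Rightarrow> real measure" where
  "radial_measure n =
     density lborel (\<lambda>r. ennreal (unit_sphere_area n * r ^ (n - 1)) * indicator {0<..} r)"

lemma sets_radial_measure [simp, measurable_cong]: "sets (radial_measure n) = sets borel"
  by (simp add: radial_measure_def)

lemma space_radial_measure [simp]: "space (radial_measure n) = UNIV"
  by (simp add: radial_measure_def)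

lemma emeasure_radial_measure:
  assumes "n > 0"
  shows "emeasure (radial_measure n) {..<r} = (if r > 0 then ennreal (unit_ball_vol n * r ^ n) else 0)"
proof (cases "r > 0")
  case False
  then show ?thesis
    by (auto simp: radial_measure_def emeasure_density nn_integral_0_iff_AE split: split_indicator)
next
  case True
  have "emeasure (radial_measure n) {..<r} =
      (\<integral>\<^sup>+x. ennreal (unit_sphere_area n * x ^ (n - 1)) * indicator {0..r} x \<partial>lborel)"
    unfolding radial_measure_def
    by (subst emeasure_density, simp, simp, rule nn_integral_cong_AE)
       (use AE_lborel_singleton[of "0::real"] AE_lborel_singleton[of r] in
         \<open>eventually_elim, auto split: split_indicator\<close>)
  also have "\<dots> = unit_ball_vol n * r ^ n - unit_ball_vol n * 0 ^ n"
  proof (rule nn_integral_FTC_Icc)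
    fix x :: real assume "x \<in> {0..r}"
    then show "0 \<le> unit_sphere_area n * x ^ (n - 1)"
      using unit_sphere_area_pos[OF assms] by simp
    show "((\<lambda>x. unit_ball_vol n * x ^ n) has_field_derivative unit_sphere_area n * x ^ (n - 1)) (at x)"
      by (auto intro!: derivative_eq_intros simp: unit_sphere_area_eq assms)
  qed (use True in auto)
  finally show ?thesis using True assms by simp
qed

text \<open>The norm and the direction behave like independent variables because Lebesgue measure scales. It suffices to compare the two measures on
  products of a half-line and a set of directions, and these products are cones.\<close>

lemma distr_polar:
  "distr lborel (borel \<Otimes>\<^sub>M borel) (\<lambda>x::'a::euclidean_space. (norm x, sgn x)) =
    radial_measure DIM('a) \<Otimes>\<^sub>M uniform_sphere"
proof (rule pair_measure_eqI[symmetric])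
  show "sigma_finite_measure (uniform_sphere :: 'a measure)"
    by (rule prob_space_imp_sigma_finite) (rule prob_space_uniform_sphere)
  have n: "DIM('a) > 0" by simp
  show "sigma_finite_measure (radial_measure DIM('a))"
  proof (rule sigma_finite_measure.intro)
    show "\<exists>A. countable A \<and> A \<subseteq> sets (radial_measure DIM('a)) \<and> \<Union> A = space (radial_measure DIM('a)) \<and>
        (\<forall>a\<in>A. emeasure (radial_measure DIM('a)) a \<noteq> \<infinity>)"
      by (rule exI[of _ "range (\<lambda>i::nat. {..<real i})"])
         (auto simp: emeasure_radial_measure[OF n] reals_Archimedean2)
  qed
  show "sets (radial_measure DIM('a) \<Otimes>\<^sub>M (uniform_sphere :: 'a measure)) =
      sets (distr lborel (borel \<Otimes>\<^sub>M borel) (\<lambda>x::'a. (norm x, sgn x)))"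
    by (simp cong: sets_pair_measure_cong)
  fix A :: "real set" and B :: "'a set"
  assume "A \<in> sets (radial_measure DIM('a))" and "B \<in> sets (uniform_sphere :: 'a measure)"
  then have A [measurable]: "A \<in> sets borel" and B [measurable]: "B \<in> sets borel" by simp_all
  let ?N = "distr (density lborel (indicator (sgn -` B))) borel (norm :: 'a \<Rightarrow> real)"
  let ?M = "scale_measure (emeasure uniform_sphere B) (radial_measure DIM('a))"
  have sB [measurable]: "sgn -` B \<in> sets borel" using measurable_sets[OF borel_measurable_sgn B] by simp
  have N: "emeasure ?N C = emeasure lborel {x::'a. norm x \<in> C \<and> sgn x \<in> B}" if [measurable]: "C \<in> sets borel" for C
  proof -
    have C': "norm -` C \<in> sets (borel :: 'a measure)"
      using measurable_sets[OF borel_measurable_norm that] by simp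
    have "emeasure ?N C = emeasure lborel (sgn -` B \<inter> (norm -` C))"
      using C' by (simp add: emeasure_distr emeasure_density indicator_inter_arith[symmetric])
    then show ?thesis by (simp add: vimage_def Int_def conj_commute)
  qed
  have "?M = ?N"
  proof (rule measure_eqI_generator_eq[where E = "range (\<lambda>a::real. {..<a})" and \<Omega> = UNIV and A = "\<lambda>i. {..<real i}"])
    have "{..<a} \<inter> {..<b} = {..<min a b}" for a b :: real by auto
    then show "Int_stable (range (\<lambda>a::real. {..<a}))"
      by (auto simp: Int_stable_def)
    have "sets (borel :: real measure) = sigma_sets UNIV (range (\<lambda>a::real. {..<a}))"
      by (subst borel_eq_lessThan) (simp add: eucl_lessThan lessThan_def)
    then show "sets ?M = sigma_sets UNIV (range (\<lambda>a::real. {..<a}))"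
      and "sets ?N = sigma_sets UNIV (range (\<lambda>a::real. {..<a}))" by simp_all
    show "(\<Union>i. {..<real i}) = UNIV" by (auto simp: reals_Archimedean2)
    show "emeasure ?M {..<real i} \<noteq> \<infinity>" for i
      by (simp add: emeasure_radial_measure[OF n] ennreal_mult_eq_top_iff)
    fix X assume "X \<in> range (\<lambda>a::real. {..<a})"
    then obtain r where X: "X = {..<r}" by auto
    show "emeasure ?M X = emeasure ?N X"
    proof (cases "r > 0")
      case True
      show ?thesis using emeasure_cone[OF True B]
        by (simp add: X N emeasure_radial_measure[OF n] True mult.commute)
    next
      case False
      then have "{x::'a. norm x < r \<and> sgn x \<in> B} = {}"
        by (auto simp: not_less intro: order_trans[OF _ norm_ge_zero])
      then have "emeasure lborel {x::'a. norm x < r \<and> sgn x \<in> B} = 0" by (simp only: emeasure_empty)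
      then show ?thesis using False by (simp add: X N emeasure_radial_measure[OF n])
    qed
  qed auto
  then have "emeasure ?M A = emeasure ?N A" by simp
  then have "emeasure (radial_measure DIM('a)) A * emeasure uniform_sphere B = emeasure ?N A"
    by (simp add: mult.commute)
  also have "\<dots> = emeasure (distr lborel (borel \<Otimes>\<^sub>M borel) (\<lambda>x::'a. (norm x, sgn x))) (A \<times> B)"
    by (subst emeasure_distr) (auto simp: N[OF A] intro!: arg_cong[where f = "emeasure lborel"])
  finally show "emeasure (radial_measure DIM('a)) A * emeasure uniform_sphere B =
      emeasure (distr lborel (borel \<Otimes>\<^sub>M borel) (\<lambda>x::'a. (norm x, sgn x))) (A \<times> B)" .
qed

lemma norm_scaleR_sgn: "norm x *\<^sub>R sgn x = (x::'a::real_normed_vector)"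
  by (cases "x = 0") (simp_all add: sgn_div_norm)

lemma nn_integral_polar:
  fixes F :: "'a::euclidean_space \<Rightarrow> ennreal"
  assumes [measurable]: "F \<in> borel_measurable borel"
  shows "(\<integral>\<^sup>+x. F x \<partial>lborel) =
    (\<integral>\<^sup>+r. ennreal (unit_sphere_area DIM('a) * r ^ (DIM('a) - 1)) * indicator {0<..} r *
       (\<integral>\<^sup>+\<omega>. F (r *\<^sub>R \<omega>) \<partial>uniform_sphere) \<partial>lborel)"
proof -
  have "(\<integral>\<^sup>+x. F x \<partial>lborel) = (\<integral>\<^sup>+x. (case (norm x, sgn x) of (r, \<omega>) \<Rightarrow> F (r *\<^sub>R \<omega>)) \<partial>lborel)"
    by (simp add: norm_scaleR_sgn)
  also have "\<dots> = (\<integral>\<^sup>+p. (case p of (r, \<omega>) \<Rightarrow> F (r *\<^sub>R \<omega>)) \<partial>(distr lborel (borel \<Otimes>\<^sub>M borel) (\<lambda>x::'a. (norm x, sgn x))))"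
    by (subst nn_integral_distr) simp_all
  also have "\<dots> = (\<integral>\<^sup>+r. (\<integral>\<^sup>+\<omega>. F (r *\<^sub>R \<omega>) \<partial>uniform_sphere) \<partial>radial_measure DIM('a))"
    unfolding distr_polar
    by (subst uniform_sphere.nn_integral_fst[symmetric]) simp_all
  also have "\<dots> = (\<integral>\<^sup>+r. ennreal (unit_sphere_area DIM('a) * r ^ (DIM('a) - 1)) * indicator {0<..} r *
       (\<integral>\<^sup>+\<omega>. F (r *\<^sub>R \<omega>) \<partial>uniform_sphere) \<partial>lborel)"
    unfolding radial_measure_def by (subst nn_integral_density) simp_all
  finally show ?thesis .
qed

text \<open>Both measures count cones, the surface measure inside the ball of radius \<open>R\<close> and the uniform
  distribution inside the unit ball; the scaling of cones compares them.\<close>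

lemma sphere_measure_eq_uniform:
  assumes "R > 0"
  shows "(sphere_measure R :: 'a::euclidean_space measure) =
    scale_measure (ennreal (unit_sphere_area DIM('a) * R ^ (DIM('a) - 1)))
      (distr uniform_sphere borel (\<lambda>\<omega>. R *\<^sub>R \<omega>))"
proof (rule measure_eqI)
  show "sets (sphere_measure R :: 'a measure) = sets (scale_measure (ennreal (unit_sphere_area DIM('a) * R ^ (DIM('a) - 1)))
      (distr uniform_sphere borel (\<lambda>\<omega>. R *\<^sub>R \<omega>)))"
    by (simp add: sphere_measure_def)
  fix A assume "A \<in> sets (sphere_measure R :: 'a measure)"
  then have A [measurable]: "A \<in> sets borel" by (simp add: sphere_measure_def)
  define B where "B = {\<omega>. R *\<^sub>R \<omega> \<in> A}"
  have B [measurable]: "B \<in> sets borel" unfolding B_def by measurable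
  have m: "(\<lambda>x::'a. (R / norm x) *\<^sub>R x) \<in> borel_measurable (restrict_space lborel (cball 0 R - {0}))"
    by (intro measurable_restrict_space1) measurable
  have eq: "(\<lambda>x::'a. (R / norm x) *\<^sub>R x) -` A \<inter> (cball 0 R - {0}) = {x. norm x \<le> R \<and> sgn x \<in> B} - {0}"
    by (auto simp: B_def sgn_div_norm divide_inverse)
  have "emeasure (sphere_measure R :: 'a measure) A =
      ennreal (DIM('a) / R) * emeasure lborel ({x. norm x \<le> R \<and> sgn x \<in> B} - {0})"
    unfolding sphere_measure_def emeasure_scale_measure
    by (subst emeasure_distr[OF m A], simp only: space_restrict_space space_lborel space_borel Int_UNIV_right eq,
        subst emeasure_restrict_space) auto
  also have "emeasure lborel ({x. norm x \<le> R \<and> sgn x \<in> B} - {0}) = emeasure lborel {x. norm x < R \<and> sgn x \<in> B}"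
  proof (rule emeasure_eq_AE)
    have "sphere (0::'a) R \<in> null_sets lebesgue"
      using negligible_sphere[of "0::'a" R] by (simp add: negligible_iff_null_sets)
    then have "sphere (0::'a) R \<in> null_sets lborel"
      by (simp add: null_sets_def)
    then have "AE x in lborel. x \<notin> sphere (0::'a) R" by (rule AE_not_in)
    moreover have "AE x in lborel. x \<noteq> (0::'a)" by (rule AE_lborel_singleton)
    ultimately show "AE x in lborel. x \<in> {x. norm x \<le> R \<and> sgn x \<in> B} - {0} \<longleftrightarrow> x \<in> {x. norm x < R \<and> sgn x \<in> B}"
      by eventually_elim auto
  qed (simp_all add: assms)
  also have "\<dots> = ennreal (unit_ball_vol DIM('a) * R ^ DIM('a)) * emeasure uniform_sphere B"
    by (rule emeasure_cone[OF assms B])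
  also have "ennreal (DIM('a) / R) * \<dots> = ennreal (unit_sphere_area DIM('a) * R ^ (DIM('a) - 1)) * emeasure uniform_sphere B"
  proof -
    have "R ^ DIM('a) = R * R ^ (DIM('a) - 1)" using power_Suc[of R "DIM('a) - 1"] by simp
    then have "(DIM('a) / R) * (unit_ball_vol DIM('a) * R ^ DIM('a)) = unit_sphere_area DIM('a) * R ^ (DIM('a) - 1)"
      using assms by (simp add: unit_sphere_area_eq)
    then show ?thesis using assms by (simp add: mult.assoc[symmetric] ennreal_mult[symmetric])
  qed
  also have "emeasure uniform_sphere B = emeasure (distr uniform_sphere borel (\<lambda>\<omega>. R *\<^sub>R \<omega>)) A"
    by (subst emeasure_distr) (auto simp: B_def vimage_def)
  finally show "emeasure (sphere_measure R :: 'a measure) A =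
    emeasure (scale_measure (ennreal (unit_sphere_area DIM('a) * R ^ (DIM('a) - 1)))
      (distr uniform_sphere borel (\<lambda>\<omega>. R *\<^sub>R \<omega>))) A" by simp
qed

lemma nn_integral_sphere_measure:
  fixes F :: "'a::euclidean_space \<Rightarrow> ennreal"
  assumes "R > 0" and [measurable]: "F \<in> borel_measurable borel"
  shows "(\<integral>\<^sup>+x. F x \<partial>sphere_measure R) =
    ennreal (unit_sphere_area DIM('a) * R ^ (DIM('a) - 1)) * (\<integral>\<^sup>+\<omega>. F (R *\<^sub>R \<omega>) \<partial>uniform_sphere)"
  unfolding sphere_measure_eq_uniform[OF assms(1)]
  by (subst nn_integral_scale_measure) (simp_all add: nn_integral_distr)

text \<open>Polar coordinates for a radial weight that is under control on positive radii only, as its value at the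
  origin concerns a single point.\<close>

lemma nn_integral_radial_weight:
  fixes F :: "'a::euclidean_space \<Rightarrow> ennreal" and v :: "real \<Rightarrow> real"
  assumes v [measurable]: "(\<lambda>r. indicator {0<..} r * v r) \<in> borel_measurable borel"
    and [measurable]: "F \<in> borel_measurable borel"
  shows "(\<integral>\<^sup>+x. ennreal (v (norm x)) * F x \<partial>lborel) =
    (\<integral>\<^sup>+r. ennreal (unit_sphere_area DIM('a) * r ^ (DIM('a) - 1)) * indicator {0<..} r * ennreal (v r) *
       (\<integral>\<^sup>+\<omega>. F (r *\<^sub>R \<omega>) \<partial>uniform_sphere) \<partial>lborel)"
proof -
  define v0 where "v0 r = indicator {0<..} r * v r" for r :: real
  have [measurable]: "v0 \<in> borel_measurable borel" using v by (simp add: v0_def[abs_def])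
  have "(\<integral>\<^sup>+x. ennreal (v (norm x)) * F x \<partial>lborel) = (\<integral>\<^sup>+x. ennreal (v0 (norm x)) * F x \<partial>lborel)"
    by (intro nn_integral_cong_AE, use AE_lborel_singleton[of 0] in eventually_elim) (auto simp: v0_def)
  also have "\<dots> = (\<integral>\<^sup>+r. ennreal (unit_sphere_area DIM('a) * r ^ (DIM('a) - 1)) * indicator {0<..} r *
       (\<integral>\<^sup>+\<omega>. ennreal (v0 (norm (r *\<^sub>R \<omega>))) * F (r *\<^sub>R \<omega>) \<partial>uniform_sphere) \<partial>lborel)"
    by (rule nn_integral_polar) measurable
  also have "\<dots> = (\<integral>\<^sup>+r. ennreal (unit_sphere_area DIM('a) * r ^ (DIM('a) - 1)) * indicator {0<..} r * ennreal (v r) *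
       (\<integral>\<^sup>+\<omega>. F (r *\<^sub>R \<omega>) \<partial>uniform_sphere) \<partial>lborel)"
  proof (intro nn_integral_cong)
    fix r :: real
    have "(\<integral>\<^sup>+\<omega>. ennreal (v0 (norm (r *\<^sub>R \<omega>))) * F (r *\<^sub>R \<omega>) \<partial>uniform_sphere) =
        ennreal (v r) * (\<integral>\<^sup>+\<omega>. F (r *\<^sub>R \<omega>) \<partial>uniform_sphere)" if "0 < r"
    proof -
      have "(\<integral>\<^sup>+\<omega>. ennreal (v0 (norm (r *\<^sub>R \<omega>))) * F (r *\<^sub>R \<omega>) \<partial>uniform_sphere) =
          (\<integral>\<^sup>+\<omega>. ennreal (v r) * F (r *\<^sub>R \<omega>) \<partial>uniform_sphere)"
        by (intro nn_integral_cong_AE, use AE_uniform_sphere in eventually_elim)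
           (use that in \<open>auto simp: v0_def\<close>)
      then show ?thesis by (simp add: nn_integral_cmult)
    qed
    then show "ennreal (unit_sphere_area DIM('a) * r ^ (DIM('a) - 1)) * indicator {0<..} r *
       (\<integral>\<^sup>+\<omega>. ennreal (v0 (norm (r *\<^sub>R \<omega>))) * F (r *\<^sub>R \<omega>) \<partial>uniform_sphere) =
       ennreal (unit_sphere_area DIM('a) * r ^ (DIM('a) - 1)) * indicator {0<..} r * ennreal (v r) *
       (\<integral>\<^sup>+\<omega>. F (r *\<^sub>R \<omega>) \<partial>uniform_sphere)"
      by (cases "0 < r") (simp_all add: mult.assoc)
  qed
  finally show ?thesis .
qed

section \<open>The Poincare inequality on the sphere\<close>

text \<open>The area of the parallelogram spanned by a point of a line and the direction of the line does not depend on
  the point. This constant is the common factor in the speed of the direction and in the angle along a segment.\<close>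

lemma gram_on_line:
  fixes x v :: "'a::real_inner"
  shows "(norm (x + t *\<^sub>R v))\<^sup>2 * (norm v)\<^sup>2 - ((x + t *\<^sub>R v) \<bullet> v)\<^sup>2 =
    (norm x)\<^sup>2 * (norm v)\<^sup>2 - (x \<bullet> v)\<^sup>2"
proof -
  have "(x + t *\<^sub>R v) \<bullet> (x + t *\<^sub>R v) = x \<bullet> x + 2 * t * (x \<bullet> v) + t\<^sup>2 * (v \<bullet> v)"
    by (simp only: inner_add_left inner_add_right inner_commute[of v x] power2_eq_square
        inner_scaleR_left inner_scaleR_right algebra_simps mult_2)
  moreover have "(x + t *\<^sub>R v) \<bullet> v = x \<bullet> v + t * (v \<bullet> v)"
    by (simp add: inner_add_left)
  ultimately show ?thesis
    unfolding power2_norm_eq_inner by (simp add: power2_eq_square inner_commute[of v x] algebra_simps)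
qed

lemma has_vector_derivative_sgn_line:
  fixes x v :: "'a::euclidean_space"
  assumes "x + t *\<^sub>R v \<noteq> 0"
  shows "((\<lambda>t. sgn (x + t *\<^sub>R v)) has_vector_derivative
    (1 / norm (x + t *\<^sub>R v)) *\<^sub>R v -
    (((x + t *\<^sub>R v) \<bullet> v) / norm (x + t *\<^sub>R v) ^ 3) *\<^sub>R (x + t *\<^sub>R v)) (at t)"
proof -
  define z where "z = x + t *\<^sub>R v"
  have z: "z \<noteq> 0" using assms by (simp add: z_def)
  have l: "((\<lambda>t. x + t *\<^sub>R v) has_vector_derivative v) (at t)"
    by (auto intro!: derivative_eq_intros)
  have "((\<lambda>t. norm (x + t *\<^sub>R v)) has_derivative (\<lambda>h. (h *\<^sub>R v) \<bullet> sgn z)) (at t)"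
    by (rule has_derivative_compose[of "\<lambda>t. x + t *\<^sub>R v" _ _ _ norm])
       (use l z in \<open>auto simp: has_vector_derivative_def z_def intro!: has_derivative_norm\<close>)
  then have "((\<lambda>t. norm (x + t *\<^sub>R v)) has_real_derivative (z \<bullet> v) / norm z) (at t)"
    by (rule has_derivative_imp_has_field_derivative) (simp add: sgn_div_norm divide_inverse inner_commute[of v] mult_ac)
  then have "((\<lambda>t. inverse (norm (x + t *\<^sub>R v))) has_real_derivative - ((z \<bullet> v) / norm z ^ 3)) (at t)"
    by (rule DERIV_inverse_fun[THEN DERIV_cong])
       (use z in \<open>auto simp: z_def[symmetric] field_simps power3_eq_cube power2_eq_square\<close>)
  from has_vector_derivative_scaleR[OF this l]
  show ?thesis
    by (simp add: sgn_div_norm[abs_def] z_def[symmetric] divide_inverse algebra_simps)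
qed

text \<open>The speed of the direction \<open>sgn z\<close> for a point \<open>z\<close> that moves with velocity \<open>v\<close>: area over squared
  distance, which is the angular velocity.\<close>

lemma norm_deriv_sgn_line:
  fixes z v :: "'a::euclidean_space"
  assumes "z \<noteq> 0"
  shows "norm ((1 / norm z) *\<^sub>R v - ((z \<bullet> v) / norm z ^ 3) *\<^sub>R z) =
    sqrt ((norm z)\<^sup>2 * (norm v)\<^sup>2 - (z \<bullet> v)\<^sup>2) / (norm z)\<^sup>2"
proof -
  let ?N = "norm z"
  have N: "?N > 0" using assms by simp
  let ?w = "?N ^ 3 *\<^sub>R ((1 / ?N) *\<^sub>R v - ((z \<bullet> v) / ?N ^ 3) *\<^sub>R z)"
  have w: "?w = ?N\<^sup>2 *\<^sub>R v - (z \<bullet> v) *\<^sub>R z"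
    using N by (simp add: scaleR_diff_right power3_eq_cube power2_eq_square)
  have "(norm ?w)\<^sup>2 = ?N\<^sup>2 * (?N\<^sup>2 * (norm v)\<^sup>2 - (z \<bullet> v)\<^sup>2)"
    unfolding w power2_norm_eq_inner
    by (simp add: inner_diff_left inner_diff_right inner_commute power2_eq_square algebra_simps)
  then have "norm ?w = ?N * sqrt (?N\<^sup>2 * (norm v)\<^sup>2 - (z \<bullet> v)\<^sup>2)"
    by (subst real_sqrt_abs2[symmetric, of "norm ?w", simplified abs_norm_cancel, unfolded power2_eq_square[symmetric]])
       (simp only: real_sqrt_mult real_sqrt_abs abs_norm_cancel)
  moreover have "norm ?w = ?N ^ 3 * norm ((1 / ?N) *\<^sub>R v - ((z \<bullet> v) / ?N ^ 3) *\<^sub>R z)"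
    using N by (simp only: norm_scaleR abs_of_pos zero_less_power)
  ultimately have "?N * (?N\<^sup>2 * norm ((1 / ?N) *\<^sub>R v - ((z \<bullet> v) / ?N ^ 3) *\<^sub>R z)) =
      ?N * sqrt (?N\<^sup>2 * (norm v)\<^sup>2 - (z \<bullet> v)\<^sup>2)"
    by (simp only: power3_eq_cube power2_eq_square mult.assoc)
  then have "?N\<^sup>2 * norm ((1 / ?N) *\<^sub>R v - ((z \<bullet> v) / ?N ^ 3) *\<^sub>R z) =
      sqrt (?N\<^sup>2 * (norm v)\<^sup>2 - (z \<bullet> v)\<^sup>2)"
    by (rule mult_left_cancel[THEN iffD1, rotated]) (use N in simp)
  then show ?thesis
    by (rule nonzero_eq_divide_eq[THEN iffD2, rotated, OF trans[OF mult.commute]]) (use N in simp)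
qed

text \<open>The angle swept by the direction has the arctangent as a primitive, so it is at most \<open>\<pi>\<close> however close
  the line comes to the origin.\<close>

lemma angle_along_segment:
  fixes x v :: "'a::euclidean_space"
  defines "D \<equiv> sqrt ((norm x)\<^sup>2 * (norm v)\<^sup>2 - (x \<bullet> v)\<^sup>2)"
  assumes D: "0 < D"
  shows "x + t *\<^sub>R v \<noteq> 0"
    and "((\<lambda>t. arctan (((x + t *\<^sub>R v) \<bullet> v) / D)) has_real_derivative D / (norm (x + t *\<^sub>R v))\<^sup>2) (at t)"
proof -
  let ?z = "x + t *\<^sub>R v"
  have D2: "D\<^sup>2 = (norm ?z)\<^sup>2 * (norm v)\<^sup>2 - (?z \<bullet> v)\<^sup>2"
    using D unfolding gram_on_line D_def by simp
  show z: "?z \<noteq> 0" using D2 D by auto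
  have v: "v \<noteq> 0" using D2 D by auto
  have "((\<lambda>t. arctan (((x + t *\<^sub>R v) \<bullet> v) / D)) has_real_derivative
      inverse (1 + ((?z \<bullet> v) / D)\<^sup>2) * ((v \<bullet> v) / D)) (at t)"
  proof (rule DERIV_chain2[of arctan, OF DERIV_arctan])
    have "(\<lambda>t. ((x + t *\<^sub>R v) \<bullet> v) / D) = (\<lambda>t. (x \<bullet> v + t * (v \<bullet> v)) / D)"
      by (simp add: inner_add_left)
    then show "((\<lambda>t. ((x + t *\<^sub>R v) \<bullet> v) / D) has_real_derivative (v \<bullet> v) / D) (at t)"
      using D by (auto intro!: derivative_eq_intros)
  qed
  moreover have "inverse (1 + ((?z \<bullet> v) / D)\<^sup>2) * ((v \<bullet> v) / D) = D / (norm ?z)\<^sup>2"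
  proof -
    have "1 + ((?z \<bullet> v) / D)\<^sup>2 = (norm ?z)\<^sup>2 * (norm v)\<^sup>2 / D\<^sup>2"
      using D D2 by (simp add: power_divide field_simps)
    then show ?thesis using D z v by (simp add: dot_square_norm field_simps power2_eq_square)
  qed
  ultimately show "((\<lambda>t. arctan (((x + t *\<^sub>R v) \<bullet> v) / D)) has_real_derivative D / (norm (x + t *\<^sub>R v))\<^sup>2) (at t)"
    by simp
qed

text \<open>The 0-homogeneous function \<open>g (sgn x)\<close> has a gradient of size \<open>1 / norm x\<close>, whose square is not integrable
  near \<open>0\<close> in the plane. The Cauchy-Schwarz inequality with respect to the angle \<open>D / (norm z)\<^sup>2 dt\<close>, whose
  total is at most \<open>\<pi>\<close>, loses only one factor \<open>1 / norm z\<close>, since \<open>D \<le> norm z * norm (y - x)\<close>; this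
  is integrable in every dimension from 2 on.\<close>

lemma sgn_difference_bound:
  fixes g :: "'a::euclidean_space \<Rightarrow> real" and G :: "'a \<Rightarrow> 'a"
  assumes g: "\<And>x. (g has_derivative (\<lambda>h. h \<bullet> G x)) (at x)" and G: "continuous_on UNIV G"
    and xy: "(x \<bullet> y)\<^sup>2 \<noteq> (norm x)\<^sup>2 * (norm y)\<^sup>2" and v: "norm (y - x) \<le> 2"
  shows "ennreal ((g (sgn x) - g (sgn y))\<^sup>2) \<le> ennreal (2 * pi) *
    (\<integral>\<^sup>+t. ennreal ((norm (G (sgn (x + t *\<^sub>R (y - x)))))\<^sup>2 / norm (x + t *\<^sub>R (y - x))) * indicator {0..1} t \<partial>lborel)"
proof -
  define v where "v = y - x"
  define z where "z t = x + t *\<^sub>R v" for t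
  define D where "D = sqrt ((norm x)\<^sup>2 * (norm v)\<^sup>2 - (x \<bullet> v)\<^sup>2)"
  define T where "T t = norm (G (sgn (z t)))" for t
  define q where "q t = (1 / norm (z t)) *\<^sub>R v - ((z t \<bullet> v) / norm (z t) ^ 3) *\<^sub>R z t" for t
  have "(norm x)\<^sup>2 * (norm v)\<^sup>2 - (x \<bullet> v)\<^sup>2 = (norm x)\<^sup>2 * (norm y)\<^sup>2 - (x \<bullet> y)\<^sup>2"
    unfolding v_def power2_norm_eq_inner
    by (simp add: inner_diff_left inner_diff_right inner_commute power2_eq_square algebra_simps)
  moreover have "(x \<bullet> y)\<^sup>2 \<le> (norm x)\<^sup>2 * (norm y)\<^sup>2"
    using Cauchy_Schwarz_ineq[of x y] by (simp add: power2_norm_eq_inner)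
  ultimately have D: "0 < D" using xy by (simp add: D_def)
  note ang = angle_along_segment[of x v, folded D_def, OF D, folded z_def]
  have z0: "z t \<noteq> 0" for t using ang(1) .
  have Dz: "sqrt ((norm (z t))\<^sup>2 * (norm v)\<^sup>2 - (z t \<bullet> v)\<^sup>2) = D" for t
    unfolding z_def gram_on_line D_def by simp
  have ds: "((\<lambda>t. sgn (z t)) has_vector_derivative q t) (at t)" for t
    using has_vector_derivative_sgn_line[of x t v] z0[of t] by (simp add: z_def q_def)
  have du: "((\<lambda>t. g (sgn (z t))) has_real_derivative q t \<bullet> G (sgn (z t))) (at t)" for t
  proof -
    have "((\<lambda>t. g (sgn (z t))) has_derivative (\<lambda>h. (h *\<^sub>R q t) \<bullet> G (sgn (z t)))) (at t)"
      by (rule has_derivative_compose[OF ds[unfolded has_vector_derivative_def] g])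
    then show ?thesis
      by (rule has_derivative_imp_has_field_derivative) simp
  qed
  have zc: "continuous_on UNIV z" unfolding z_def by (intro continuous_intros)
  have sc: "continuous_on UNIV (\<lambda>t. sgn (z t))"
    unfolding sgn_div_norm by (intro continuous_intros zc) (simp add: z0)
  have Gc: "continuous_on UNIV (\<lambda>t. G (sgn (z t)))"
    by (rule continuous_on_compose2[OF G sc]) simp
  have qc: "continuous_on UNIV q"
    unfolding q_def by (intro continuous_intros zc) (simp_all add: z0)
  have uc: "isCont (\<lambda>t. q t \<bullet> G (sgn (z t))) t" for t
    using continuous_on_inner[OF qc Gc] by (simp add: continuous_on_eq_continuous_at)
  have Tc: "continuous_on UNIV T" unfolding T_def by (intro continuous_intros Gc)
  have wc: "continuous_on UNIV (\<lambda>t. sqrt D / norm (z t))" by (intro continuous_intros zc) (simp add: z0)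
  note [measurable] = borel_measurable_continuous_onI[OF wc] borel_measurable_continuous_onI[OF Tc]
    borel_measurable_continuous_onI[OF zc]
  have ub: "\<bar>q t \<bullet> G (sgn (z t))\<bar> \<le> T t * (sqrt D / norm (z t)) * (sqrt D / norm (z t))" for t
  proof -
    have "\<bar>q t \<bullet> G (sgn (z t))\<bar> \<le> norm (q t) * T t"
      unfolding T_def by (rule Cauchy_Schwarz_ineq2)
    also have "norm (q t) = D / (norm (z t))\<^sup>2"
      using norm_deriv_sgn_line[OF z0[of t], of v] by (simp add: q_def Dz)
    also have "D = s * s" if "s = sqrt D" for s using that D by simp
    finally have "\<bar>q t \<bullet> G (sgn (z t))\<bar> \<le> s * s / (norm (z t))\<^sup>2 * T t" if "s = sqrt D" for s
      using that by blast
    from this[OF refl] have "\<bar>q t \<bullet> G (sgn (z t))\<bar> \<le> sqrt D * sqrt D / (norm (z t))\<^sup>2 * T t" .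
    moreover have "a * (s / N) * (s / N) = s * s / N\<^sup>2 * a" for a s N :: real
      by (simp add: power2_eq_square)
    ultimately show ?thesis by (simp only:)
  qed
  let ?I = "\<lambda>t. indicator {0..1::real} t :: ennreal"
  have "has_bochner_integral lborel (\<lambda>t. (q t \<bullet> G (sgn (z t))) * indicator {0..1} t) (g (sgn (z 1)) - g (sgn (z 0)))"
    by (rule has_bochner_integral_FTC_Icc_real) (use du uc in auto)
  then have "ennreal \<bar>g (sgn (z 1)) - g (sgn (z 0))\<bar> \<le> (\<integral>\<^sup>+t. ennreal \<bar>(q t \<bullet> G (sgn (z t))) * indicator {0..1} t\<bar> \<partial>lborel)"
    using integral_norm_bound_ennreal[of lborel "\<lambda>t. (q t \<bullet> G (sgn (z t))) * indicator {0..1} t"]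
    by (simp add: has_bochner_integral_iff)
  also have "\<dots> \<le> (\<integral>\<^sup>+t. (ennreal (T t * (sqrt D / norm (z t))) * ?I t) * (ennreal (sqrt D / norm (z t)) * ?I t) \<partial>lborel)"
    using ub D by (intro nn_integral_mono) (auto simp: T_def ennreal_mult[symmetric] intro!: ennreal_leI split: split_indicator)
  finally have "(ennreal \<bar>g (sgn (z 1)) - g (sgn (z 0))\<bar>)\<^sup>2 \<le>
    (\<integral>\<^sup>+t. (ennreal (T t * (sqrt D / norm (z t))) * ?I t) * (ennreal (sqrt D / norm (z t)) * ?I t) \<partial>lborel)\<^sup>2"
    by (rule power_mono) simp
  also have "\<dots> \<le> (\<integral>\<^sup>+t. (ennreal (T t * (sqrt D / norm (z t))) * ?I t)\<^sup>2 \<partial>lborel) *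
      (\<integral>\<^sup>+t. (ennreal (sqrt D / norm (z t)) * ?I t)\<^sup>2 \<partial>lborel)"
    by (rule Cauchy_Schwarz_nn_integral) measurable
  also have "\<dots> \<le> (2 * (\<integral>\<^sup>+t. ennreal ((T t)\<^sup>2 / norm (z t)) * ?I t \<partial>lborel)) * ennreal pi"
  proof (rule mult_mono)
    have "(\<integral>\<^sup>+t. (ennreal (sqrt D / norm (z t)) * ?I t)\<^sup>2 \<partial>lborel) =
        (\<integral>\<^sup>+t. ennreal (D / (norm (z t))\<^sup>2) * ?I t \<partial>lborel)"
      using D by (intro nn_integral_cong) (auto simp: ennreal_power power_divide split: split_indicator)
    also have "\<dots> = arctan (z 1 \<bullet> v / D) - arctan (z 0 \<bullet> v / D)"
      by (rule nn_integral_FTC_Icc) (use ang(2) D in auto)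
    also have "\<dots> \<le> ennreal pi"
      using arctan_bounded[of "z 1 \<bullet> v / D"] arctan_bounded[of "z 0 \<bullet> v / D"] by (intro ennreal_leI) linarith
    finally show "(\<integral>\<^sup>+t. (ennreal (sqrt D / norm (z t)) * ?I t)\<^sup>2 \<partial>lborel) \<le> ennreal pi" .
  next
    have "(\<integral>\<^sup>+t. (ennreal (T t * (sqrt D / norm (z t))) * ?I t)\<^sup>2 \<partial>lborel) \<le>
        (\<integral>\<^sup>+t. 2 * (ennreal ((T t)\<^sup>2 / norm (z t)) * ?I t) \<partial>lborel)"
    proof (rule nn_integral_mono)
      fix t
      have N: "norm (z t) > 0" using z0 by simp
      have "D \<le> sqrt ((norm (z t))\<^sup>2 * (norm v)\<^sup>2)"
        unfolding Dz[of t, symmetric] by (rule real_sqrt_le_mono) simp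
      also have "\<dots> = norm (z t) * norm v" by (simp add: real_sqrt_mult)
      also have "\<dots> \<le> norm (z t) * 2" using assms(4) N by (simp add: v_def)
      finally have "D / (norm (z t))\<^sup>2 \<le> 2 / norm (z t)"
        using N by (simp add: field_simps power2_eq_square)
      then have "(T t)\<^sup>2 * (D / (norm (z t))\<^sup>2) \<le> (T t)\<^sup>2 * (2 / norm (z t))"
        by (rule mult_left_mono) simp
      then have "(T t * (sqrt D / norm (z t)))\<^sup>2 \<le> 2 * ((T t)\<^sup>2 / norm (z t))"
        using D by (simp add: power_mult_distrib power_divide mult_ac)
      then have "ennreal ((T t * (sqrt D / norm (z t)))\<^sup>2) \<le> ennreal 2 * ennreal ((T t)\<^sup>2 / norm (z t))"
        by (subst ennreal_mult[symmetric]) (auto intro!: ennreal_leI)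
      then show "(ennreal (T t * (sqrt D / norm (z t))) * ?I t)\<^sup>2 \<le> 2 * (ennreal ((T t)\<^sup>2 / norm (z t)) * ?I t)"
        using D by (auto simp: ennreal_power T_def split: split_indicator)
    qed
    also have "\<dots> = 2 * (\<integral>\<^sup>+t. ennreal ((T t)\<^sup>2 / norm (z t)) * ?I t \<partial>lborel)"
      by (rule nn_integral_cmult) measurable
    finally show "(\<integral>\<^sup>+t. (ennreal (T t * (sqrt D / norm (z t))) * ?I t)\<^sup>2 \<partial>lborel) \<le>
        2 * (\<integral>\<^sup>+t. ennreal ((T t)\<^sup>2 / norm (z t)) * ?I t \<partial>lborel)" .
  qed simp_all
  finally have "(ennreal \<bar>g (sgn (z 1)) - g (sgn (z 0))\<bar>)\<^sup>2 \<le>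
      2 * (\<integral>\<^sup>+t. ennreal ((T t)\<^sup>2 / norm (z t)) * ?I t \<partial>lborel) * ennreal pi" .
  moreover have "(ennreal \<bar>g (sgn (z 1)) - g (sgn (z 0))\<bar>)\<^sup>2 = ennreal ((g (sgn x) - g (sgn y))\<^sup>2)"
    by (simp add: ennreal_power z_def v_def power2_commute)
  ultimately show ?thesis
    by (simp add: T_def z_def v_def ennreal_mult mult_ac)
qed

text \<open>Equality in the Cauchy-Schwarz inequality confines \<open>y\<close> to the line through \<open>x\<close>, a null set from
  dimension 2 on. For all other \<open>y\<close> the segment from \<open>x\<close> to \<open>y\<close> avoids the origin.\<close>

lemma AE_not_collinear:
  fixes x :: "'a::euclidean_space"
  assumes "2 \<le> DIM('a)" "x \<noteq> 0"
  shows "AE y in lborel. (x \<bullet> y)\<^sup>2 \<noteq> (norm x)\<^sup>2 * (norm y)\<^sup>2"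
proof -
  have "dim (span {x}) \<le> 1"
    using dim_le_card'[of "{x}"] by simp
  then have "negligible (span {x})"
    using assms by (intro negligible_lowdim) simp
  moreover have cl: "closed (span {x})" by (rule closed_span)
  ultimately have "span {x} \<in> null_sets lborel"
    by (simp add: negligible_iff_null_sets null_sets_def)
  then have "AE y in lborel. y \<notin> span {x}" by (rule AE_not_in)
  then show ?thesis
  proof eventually_elim
    case (elim y)
    show ?case
    proof
      assume "(x \<bullet> y)\<^sup>2 = (norm x)\<^sup>2 * (norm y)\<^sup>2"
      then have "\<bar>x \<bullet> y\<bar> = norm x * norm y"
        using power2_eq_iff_nonneg[of "\<bar>x \<bullet> y\<bar>" "norm x * norm y"] by (simp add: power_mult_distrib)
      then have "norm x *\<^sub>R y = norm y *\<^sub>R x \<or> norm x *\<^sub>R y = - norm y *\<^sub>R x"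
        by (simp add: norm_cauchy_schwarz_abs_eq)
      then have "norm x *\<^sub>R y \<in> span {x}"
        by (metis span_mul span_base span_neg singletonI scaleR_minus_left)
      then have "(1 / norm x) *\<^sub>R norm x *\<^sub>R y \<in> span {x}" by (rule span_scale)
      then show False using assms(2) elim by simp
    qed
  qed
qed

lemma ball_in_sets_borel [measurable]: "ball (x::'a::euclidean_space) r \<in> sets borel"
  by simp

text \<open>The homothety with centre \<open>x\<close> and ratio \<open>t\<close> maps the ball into itself and distorts volumes by a factor of
  at most \<open>2 ^ n\<close> when \<open>1 / 2 \<le> t\<close>.\<close>

lemma ball_contraction:
  fixes H :: "'a::euclidean_space \<Rightarrow> ennreal"
  assumes [measurable]: "H \<in> borel_measurable borel" and x: "x \<in> ball 0 1" and t: "1 / 2 \<le> t" "t \<le> 1"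
  shows "(\<integral>\<^sup>+y. indicator (ball 0 1) y * H (x + t *\<^sub>R (y - x)) \<partial>lborel) \<le>
    2 ^ DIM('a) * (\<integral>\<^sup>+z. indicator (ball 0 1) z * H z \<partial>lborel)"
proof -
  have "(\<integral>\<^sup>+y. indicator (ball 0 1) y * H (x + t *\<^sub>R (y - x)) \<partial>lborel) \<le>
      (\<integral>\<^sup>+y. 2 ^ DIM('a) * (ennreal (\<bar>t\<bar> ^ DIM('a)) * (indicator (ball 0 1) ((1 - t) *\<^sub>R x + t *\<^sub>R y) * H ((1 - t) *\<^sub>R x + t *\<^sub>R y))) \<partial>lborel)"
  proof (rule nn_integral_mono)
    fix y :: 'a
    have eq: "x + t *\<^sub>R (y - x) = (1 - t) *\<^sub>R x + t *\<^sub>R y" by (simp add: algebra_simps)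
    have "1 \<le> (2 * t) ^ DIM('a)" using t by (intro one_le_power) simp
    then have "1 \<le> ennreal ((2 * t) ^ DIM('a))" by simp
    then have c: "1 \<le> 2 ^ DIM('a) * ennreal (\<bar>t\<bar> ^ DIM('a))"
      using t by (simp add: power_mult_distrib ennreal_mult ennreal_power[symmetric])
    have "(1 - t) *\<^sub>R x + t *\<^sub>R y \<in> ball 0 1" if "y \<in> ball 0 1"
      using convexD_alt[OF convex_ball x that, of t] t by simp
    moreover have "H z \<le> 2 ^ DIM('a) * ennreal (\<bar>t\<bar> ^ DIM('a)) * H z" for z
      using mult_right_mono[OF c, of "H z"] by simp
    ultimately show "indicator (ball 0 1) y * H (x + t *\<^sub>R (y - x)) \<le>
       2 ^ DIM('a) * (ennreal (\<bar>t\<bar> ^ DIM('a)) * (indicator (ball 0 1) ((1 - t) *\<^sub>R x + t *\<^sub>R y) * H ((1 - t) *\<^sub>R x + t *\<^sub>R y)))"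
      unfolding eq by (auto simp: mult.assoc split: split_indicator)
  qed
  also have "\<dots> = 2 ^ DIM('a) * (\<integral>\<^sup>+y. ennreal (\<bar>t\<bar> ^ DIM('a)) * (indicator (ball 0 1) ((1 - t) *\<^sub>R x + t *\<^sub>R y) * H ((1 - t) *\<^sub>R x + t *\<^sub>R y)) \<partial>lborel)"
    by (rule nn_integral_cmult) measurable
  also have "(\<integral>\<^sup>+y. ennreal (\<bar>t\<bar> ^ DIM('a)) * (indicator (ball 0 1) ((1 - t) *\<^sub>R x + t *\<^sub>R y) * H ((1 - t) *\<^sub>R x + t *\<^sub>R y)) \<partial>lborel) =
      (\<integral>\<^sup>+z. indicator (ball 0 1) z * H z \<partial>density (distr lborel borel (\<lambda>y. (1 - t) *\<^sub>R x + t *\<^sub>R y)) (\<lambda>_. \<bar>t\<bar> ^ DIM('a)))"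
  proof -
    have [measurable]: "(\<lambda>y. (1 - t) *\<^sub>R x + t *\<^sub>R y) \<in> borel_measurable borel"
      by (intro borel_measurable_continuous_onI continuous_intros)
    show ?thesis by (simp add: nn_integral_density nn_integral_distr)
  qed
  also have "density (distr lborel borel (\<lambda>y. (1 - t) *\<^sub>R x + t *\<^sub>R y)) (\<lambda>_. \<bar>t\<bar> ^ DIM('a)) = lborel"
    using t by (intro lborel_affine[symmetric]) simp
  finally show ?thesis .
qed

text \<open>For \<open>t \<ge> 1 / 2\<close> substitute the point of the segment for \<open>y\<close>; for \<open>t < 1 / 2\<close> exchange the roles of the
  two end points.\<close>

lemma ball_segment_average:
  fixes H :: "'a::euclidean_space \<Rightarrow> ennreal"
  assumes [measurable]: "H \<in> borel_measurable borel"
  shows "(\<integral>\<^sup>+x. indicator (ball 0 1) x * (\<integral>\<^sup>+y. indicator (ball 0 1) y *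
      (\<integral>\<^sup>+t. H (x + t *\<^sub>R (y - x)) * indicator {0..1} t \<partial>lborel) \<partial>lborel) \<partial>lborel) \<le>
    ennreal (2 ^ DIM('a) * unit_ball_vol DIM('a)) * (\<integral>\<^sup>+z. indicator (ball 0 1) z * H z \<partial>lborel)"
proof -
  let ?B = "indicator (ball (0::'a) 1) :: 'a \<Rightarrow> ennreal"
  let ?I = "indicator {0..1} :: real \<Rightarrow> ennreal"
  let ?A = "\<integral>\<^sup>+z. ?B z * H z \<partial>lborel"
  let ?c = "ennreal (2 ^ DIM('a) * unit_ball_vol DIM('a)) * ?A"
  have half: "(\<integral>\<^sup>+x. ?B x * (\<integral>\<^sup>+y. ?B y * H (x + t *\<^sub>R (y - x)) \<partial>lborel) \<partial>lborel) \<le> ?c"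
    if "1 / 2 \<le> t" "t \<le> 1" for t
  proof -
    have "(\<integral>\<^sup>+x. ?B x * (\<integral>\<^sup>+y. ?B y * H (x + t *\<^sub>R (y - x)) \<partial>lborel) \<partial>lborel) \<le>
        (\<integral>\<^sup>+x. (2 ^ DIM('a) * ?A) * ?B x \<partial>lborel)"
      using ball_contraction[OF assms _ that] by (intro nn_integral_mono) (auto split: split_indicator)
    also have "\<dots> = (2 ^ DIM('a) * ?A) * ennreal (unit_ball_vol DIM('a))"
      by (subst nn_integral_cmult_indicator) (auto simp: emeasure_unit_ball)
    also have "\<dots> = ?c"
      by (simp add: ennreal_mult ennreal_power[symmetric] mult_ac)
    finally show ?thesis .
  qed
  have full: "(\<integral>\<^sup>+x. ?B x * (\<integral>\<^sup>+y. ?B y * H (x + t *\<^sub>R (y - x)) \<partial>lborel) \<partial>lborel) \<le> ?c"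
    if t: "0 \<le> t" "t \<le> 1" for t
  proof (cases "1 / 2 \<le> t")
    case False
    have "(\<integral>\<^sup>+x. ?B x * (\<integral>\<^sup>+y. ?B y * H (x + t *\<^sub>R (y - x)) \<partial>lborel) \<partial>lborel) =
       (\<integral>\<^sup>+x. (\<integral>\<^sup>+y. ?B x * (?B y * H (x + t *\<^sub>R (y - x))) \<partial>lborel) \<partial>lborel)"
      by (subst nn_integral_cmult) simp_all
    also have "\<dots> = (\<integral>\<^sup>+y. (\<integral>\<^sup>+x. ?B x * (?B y * H (x + t *\<^sub>R (y - x))) \<partial>lborel) \<partial>lborel)"
      by (rule lborel_pair.Fubini') measurable
    also have "\<dots> = (\<integral>\<^sup>+y. ?B y * (\<integral>\<^sup>+x. ?B x * H (y + (1 - t) *\<^sub>R (x - y)) \<partial>lborel) \<partial>lborel)"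
    proof (intro nn_integral_cong)
      fix y :: 'a
      have "x + t *\<^sub>R (y - x) = y + (1 - t) *\<^sub>R (x - y)" for x by (simp add: algebra_simps)
      then show "(\<integral>\<^sup>+x. ?B x * (?B y * H (x + t *\<^sub>R (y - x))) \<partial>lborel) =
          ?B y * (\<integral>\<^sup>+x. ?B x * H (y + (1 - t) *\<^sub>R (x - y)) \<partial>lborel)"
        by (subst nn_integral_cmult[symmetric]) (simp_all add: mult_ac)
    qed
    also have "\<dots> \<le> ?c" by (rule half) (use False t in auto)
    finally show ?thesis .
  qed (use half t in auto)
  have "(\<integral>\<^sup>+x. ?B x * (\<integral>\<^sup>+y. ?B y * (\<integral>\<^sup>+t. H (x + t *\<^sub>R (y - x)) * ?I t \<partial>lborel) \<partial>lborel) \<partial>lborel) =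
      (\<integral>\<^sup>+x. (\<integral>\<^sup>+y. (\<integral>\<^sup>+t. ?I t * (?B x * (?B y * H (x + t *\<^sub>R (y - x)))) \<partial>lborel) \<partial>lborel) \<partial>lborel)"
  proof (rule nn_integral_cong)
    fix x :: 'a
    have "(\<integral>\<^sup>+t. ?I t * (?B x * (?B y * H (x + t *\<^sub>R (y - x)))) \<partial>lborel) =
        ?B x * (?B y * (\<integral>\<^sup>+t. H (x + t *\<^sub>R (y - x)) * ?I t \<partial>lborel))" for y
    proof -
      have "(\<integral>\<^sup>+t. ?I t * (?B x * (?B y * H (x + t *\<^sub>R (y - x)))) \<partial>lborel) =
          (\<integral>\<^sup>+t. (?B x * ?B y) * (H (x + t *\<^sub>R (y - x)) * ?I t) \<partial>lborel)"
        by (intro nn_integral_cong) (simp only: mult_ac)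
      also have "\<dots> = (?B x * ?B y) * (\<integral>\<^sup>+t. H (x + t *\<^sub>R (y - x)) * ?I t \<partial>lborel)"
        by (rule nn_integral_cmult) measurable
      finally show ?thesis by (simp only: mult.assoc)
    qed
    then show "?B x * (\<integral>\<^sup>+y. ?B y * (\<integral>\<^sup>+t. H (x + t *\<^sub>R (y - x)) * ?I t \<partial>lborel) \<partial>lborel) =
       (\<integral>\<^sup>+y. (\<integral>\<^sup>+t. ?I t * (?B x * (?B y * H (x + t *\<^sub>R (y - x)))) \<partial>lborel) \<partial>lborel)"
      by (simp only:) (rule nn_integral_cmult[symmetric], measurable)
  qed
  also have "\<dots> = (\<integral>\<^sup>+x. (\<integral>\<^sup>+t. (\<integral>\<^sup>+y. ?I t * (?B x * (?B y * H (x + t *\<^sub>R (y - x)))) \<partial>lborel) \<partial>lborel) \<partial>lborel)"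
    by (intro nn_integral_cong lborel_pair.Fubini') measurable
  also have "\<dots> = (\<integral>\<^sup>+t. (\<integral>\<^sup>+x. (\<integral>\<^sup>+y. ?I t * (?B x * (?B y * H (x + t *\<^sub>R (y - x)))) \<partial>lborel) \<partial>lborel) \<partial>lborel)"
    by (rule lborel_pair.Fubini') measurable
  also have "\<dots> = (\<integral>\<^sup>+t. ?I t * (\<integral>\<^sup>+x. ?B x * (\<integral>\<^sup>+y. ?B y * H (x + t *\<^sub>R (y - x)) \<partial>lborel) \<partial>lborel) \<partial>lborel)"
    by (simp add: nn_integral_cmult)
  also have "\<dots> \<le> (\<integral>\<^sup>+t. ?c * ?I t \<partial>lborel)"
    using full by (intro nn_integral_mono) (auto split: split_indicator)
  also have "\<dots> = ?c" by (subst nn_integral_cmult_indicator) auto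
  finally show ?thesis .
qed

text \<open>In polar coordinates the radial factor is \<open>r ^ (n - 2)\<close>, which is at most \<open>1\<close> on the unit interval
  because \<open>n \<ge> 2\<close>.\<close>

lemma nn_integral_ball_inverse_norm:
  fixes F :: "'a::euclidean_space \<Rightarrow> real"
  assumes n: "2 \<le> DIM('a)" and [measurable]: "F \<in> borel_measurable borel" and F: "\<And>x. 0 \<le> F x"
  shows "(\<integral>\<^sup>+z. indicator (ball 0 1) z * ennreal (F (sgn z) / norm z) \<partial>lborel) \<le>
    ennreal (unit_sphere_area DIM('a)) * (\<integral>\<^sup>+\<omega>. ennreal (F \<omega>) \<partial>uniform_sphere)"
proof -
  let ?a = "unit_sphere_area DIM('a)"
  have a: "0 < ?a" by (simp add: unit_sphere_area_pos)
  let ?T = "\<integral>\<^sup>+\<omega>. ennreal (F \<omega>) \<partial>uniform_sphere"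
  have "(\<integral>\<^sup>+z. indicator (ball 0 1) z * ennreal (F (sgn z) / norm z) \<partial>lborel) =
     (\<integral>\<^sup>+r. ennreal (?a * r ^ (DIM('a) - 1)) * indicator {0<..} r *
       (\<integral>\<^sup>+\<omega>. indicator (ball 0 1) (r *\<^sub>R \<omega>) * ennreal (F (sgn (r *\<^sub>R \<omega>)) / norm (r *\<^sub>R \<omega>)) \<partial>uniform_sphere) \<partial>lborel)"
    by (rule nn_integral_polar) measurable
  also have "\<dots> \<le> (\<integral>\<^sup>+r. (ennreal ?a * ?T) * indicator {0..1::real} r \<partial>lborel)"
  proof (rule nn_integral_mono)
    fix r :: real
    show "ennreal (?a * r ^ (DIM('a) - 1)) * indicator {0<..} r *
       (\<integral>\<^sup>+\<omega>. indicator (ball 0 1) (r *\<^sub>R \<omega>) * ennreal (F (sgn (r *\<^sub>R \<omega>)) / norm (r *\<^sub>R \<omega>)) \<partial>uniform_sphere)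
       \<le> (ennreal ?a * ?T) * indicator {0..1} r"
    proof (cases "0 < r")
      case r: True
      have "(\<integral>\<^sup>+\<omega>. indicator (ball 0 1) (r *\<^sub>R \<omega>) * ennreal (F (sgn (r *\<^sub>R \<omega>)) / norm (r *\<^sub>R \<omega>)) \<partial>uniform_sphere)
        = (\<integral>\<^sup>+\<omega>. (indicator {..<1} r * ennreal (1 / r)) * ennreal (F \<omega>) \<partial>uniform_sphere)"
      proof (rule nn_integral_cong_AE, use AE_uniform_sphere in eventually_elim)
        fix \<omega> :: 'a assume w: "norm \<omega> = 1"
        then have "sgn (r *\<^sub>R \<omega>) = \<omega>" using r by (simp add: sgn_scaleR_pos sgn_div_norm)
        then show "indicator (ball 0 1) (r *\<^sub>R \<omega>) * ennreal (F (sgn (r *\<^sub>R \<omega>)) / norm (r *\<^sub>R \<omega>)) =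
           (indicator {..<1} r * ennreal (1 / r)) * ennreal (F \<omega>)"
          using r w F[of \<omega>] by (auto simp: ennreal_mult[symmetric] split: split_indicator)
      qed
      also have "\<dots> = (indicator {..<1} r * ennreal (1 / r)) * ?T"
        by (rule nn_integral_cmult) measurable
      finally have eq: "(\<integral>\<^sup>+\<omega>. indicator (ball 0 1) (r *\<^sub>R \<omega>) * ennreal (F (sgn (r *\<^sub>R \<omega>)) / norm (r *\<^sub>R \<omega>)) \<partial>uniform_sphere)
         = (indicator {..<1} r * ennreal (1 / r)) * ?T" .
      show ?thesis
      proof (cases "r < 1")
        case True
        have "r ^ (DIM('a) - 1) \<le> r ^ 1"
          using r True n by (intro power_decreasing) auto
        then have "?a * r ^ (DIM('a) - 1) * (1 / r) \<le> ?a"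
          using r a by (simp add: field_simps)
        then have "ennreal (?a * r ^ (DIM('a) - 1)) * ennreal (1 / r) \<le> ennreal ?a"
          using r a by (subst ennreal_mult[symmetric]) (auto intro!: ennreal_leI)
        from mult_right_mono[OF this, of ?T] show ?thesis
          unfolding eq using r True by (simp add: mult.assoc)
      next
        case False
        then show ?thesis unfolding eq by simp
      qed
    qed simp
  qed
  also have "\<dots> = ennreal ?a * ?T" by (subst nn_integral_cmult_indicator) auto
  finally show ?thesis .
qed

lemma nn_integral_uniform_sphere_ball:
  fixes F :: "'a::euclidean_space \<Rightarrow> ennreal"
  assumes [measurable]: "F \<in> borel_measurable borel"
  shows "(\<integral>\<^sup>+x. indicator (ball 0 1) x * F (sgn x) \<partial>lborel) = ennreal (unit_ball_vol DIM('a)) * (\<integral>\<^sup>+\<omega>. F \<omega> \<partial>uniform_sphere)"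
  unfolding nn_integral_uniform_sphere[OF assms]
  by (simp add: ennreal_times_divide mult.commute[of "ennreal _"] ennreal_mult_divide_eq unit_ball_vol_neq_0 mult.commute[of "indicator _ _"])

text \<open>Extend \<open>g\<close> from the sphere to the ball as a 0-homogeneous function and integrate the bound on differences
  over all pairs of points of the ball.\<close>

theorem sphere_pair_poincare:
  fixes g :: "'a::euclidean_space \<Rightarrow> real" and G :: "'a \<Rightarrow> 'a"
  assumes n: "2 \<le> DIM('a)"
    and g: "\<And>x. (g has_derivative (\<lambda>h. h \<bullet> G x)) (at x)" and G: "continuous_on UNIV G"
  shows "(\<integral>\<^sup>+\<xi>. (\<integral>\<^sup>+\<omega>. ennreal ((g \<omega> - g \<xi>)\<^sup>2) \<partial>uniform_sphere) \<partial>uniform_sphere) \<le>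
    ennreal (2 * pi * 2 ^ DIM('a) * DIM('a)) * (\<integral>\<^sup>+\<omega>. ennreal ((norm (G \<omega>))\<^sup>2) \<partial>uniform_sphere)"
proof -
  let ?B = "indicator (ball (0::'a) 1) :: 'a \<Rightarrow> ennreal"
  let ?V = "unit_ball_vol DIM('a)"
  let ?T = "\<integral>\<^sup>+\<omega>. ennreal ((norm (G \<omega>))\<^sup>2) \<partial>uniform_sphere"
  let ?E = "\<integral>\<^sup>+\<xi>. (\<integral>\<^sup>+\<omega>. ennreal ((g \<omega> - g \<xi>)\<^sup>2) \<partial>uniform_sphere) \<partial>uniform_sphere"
  define H where "H z = ennreal ((norm (G (sgn z)))\<^sup>2 / norm z)" for z
  have "continuous_on UNIV g"
    by (intro continuous_at_imp_continuous_on ballI has_derivative_continuous[OF g])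
  note [measurable] = borel_measurable_continuous_onI[OF this] borel_measurable_continuous_onI[OF G]
  have Hm [measurable]: "H \<in> borel_measurable borel" unfolding H_def by measurable
  have V: "0 < ?V" by simp
  have "ennreal ?V * (ennreal ?V * ?E) =
      (\<integral>\<^sup>+x. ?B x * (ennreal ?V * (\<integral>\<^sup>+\<omega>. ennreal ((g \<omega> - g (sgn x))\<^sup>2) \<partial>uniform_sphere)) \<partial>lborel)"
    by (subst nn_integral_uniform_sphere_ball) (auto simp: nn_integral_cmult)
  also have "\<dots> = (\<integral>\<^sup>+x. ?B x * (\<integral>\<^sup>+y. ?B y * ennreal ((g (sgn y) - g (sgn x))\<^sup>2) \<partial>lborel) \<partial>lborel)"
    by (subst nn_integral_uniform_sphere_ball[symmetric]) auto
  also have "\<dots> \<le> (\<integral>\<^sup>+x. ?B x * (\<integral>\<^sup>+y. ?B y * (ennreal (2 * pi) *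
      (\<integral>\<^sup>+t. H (x + t *\<^sub>R (y - x)) * indicator {0..1} t \<partial>lborel)) \<partial>lborel) \<partial>lborel)"
  proof (rule nn_integral_mono_AE, use AE_lborel_singleton[of 0] in eventually_elim)
    fix x :: 'a assume x: "x \<noteq> 0"
    show "?B x * (\<integral>\<^sup>+y. ?B y * ennreal ((g (sgn y) - g (sgn x))\<^sup>2) \<partial>lborel) \<le>
       ?B x * (\<integral>\<^sup>+y. ?B y * (ennreal (2 * pi) * (\<integral>\<^sup>+t. H (x + t *\<^sub>R (y - x)) * indicator {0..1} t \<partial>lborel)) \<partial>lborel)"
    proof (cases "x \<in> ball 0 1")
      case True
      have "(\<integral>\<^sup>+y. ?B y * ennreal ((g (sgn y) - g (sgn x))\<^sup>2) \<partial>lborel) \<le>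
        (\<integral>\<^sup>+y. ?B y * (ennreal (2 * pi) * (\<integral>\<^sup>+t. H (x + t *\<^sub>R (y - x)) * indicator {0..1} t \<partial>lborel)) \<partial>lborel)"
      proof (rule nn_integral_mono_AE, use AE_not_collinear[OF n x] in eventually_elim)
        fix y :: 'a assume y: "(x \<bullet> y)\<^sup>2 \<noteq> (norm x)\<^sup>2 * (norm y)\<^sup>2"
        show "?B y * ennreal ((g (sgn y) - g (sgn x))\<^sup>2) \<le>
          ?B y * (ennreal (2 * pi) * (\<integral>\<^sup>+t. H (x + t *\<^sub>R (y - x)) * indicator {0..1} t \<partial>lborel))"
        proof (cases "y \<in> ball 0 1")
          case True
          have "norm (y - x) \<le> 2"
            using norm_triangle_ineq4[of y x] True \<open>x \<in> ball 0 1\<close> by simp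
          from sgn_difference_bound[OF g G y this] show ?thesis
            unfolding H_def power2_commute[of "g (sgn y)"] by (rule mult_left_mono) simp
        qed simp
      qed
      then show ?thesis by (rule mult_left_mono) simp
    qed simp
  qed
  also have "\<dots> = ennreal (2 * pi) * (\<integral>\<^sup>+x. ?B x * (\<integral>\<^sup>+y. ?B y *
      (\<integral>\<^sup>+t. H (x + t *\<^sub>R (y - x)) * indicator {0..1} t \<partial>lborel) \<partial>lborel) \<partial>lborel)"
  proof -
    have "(\<integral>\<^sup>+y. ?B y * (ennreal (2 * pi) * (\<integral>\<^sup>+t. H (x + t *\<^sub>R (y - x)) * indicator {0..1} t \<partial>lborel)) \<partial>lborel) =
        ennreal (2 * pi) * (\<integral>\<^sup>+y. ?B y * (\<integral>\<^sup>+t. H (x + t *\<^sub>R (y - x)) * indicator {0..1} t \<partial>lborel) \<partial>lborel)" for x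
      unfolding mult.left_commute[of "?B _" "ennreal (2 * pi)"] by (rule nn_integral_cmult) measurable
    then show ?thesis
      by (simp only: mult.left_commute[of "?B _" "ennreal (2 * pi)"]) (rule nn_integral_cmult, measurable)
  qed
  also have "\<dots> \<le> ennreal (2 * pi) * (ennreal (2 ^ DIM('a) * ?V) * (ennreal (unit_sphere_area DIM('a)) * ?T))"
    unfolding H_def
    by (intro mult_left_mono order_trans[OF ball_segment_average] nn_integral_ball_inverse_norm n) auto
  also have "\<dots> = ennreal ?V * (ennreal ?V * (ennreal (2 * pi * 2 ^ DIM('a) * DIM('a)) * ?T))"
    using V by (simp add: unit_sphere_area_eq ennreal_mult mult_ac)
  finally show ?thesis
    using V by (simp add: ennreal_mult_le_mult_iff)
qed

lemma integrable_uniform_sphere_continuous: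
  fixes g :: "'a::euclidean_space \<Rightarrow> real"
  assumes "continuous_on UNIV g"
  shows "integrable uniform_sphere g"
proof -
  have "compact (g ` sphere 0 1)"
    by (rule compact_continuous_image) (auto intro: continuous_on_subset[OF assms])
  then obtain B where "\<forall>x\<in>sphere 0 1. \<bar>g x\<bar> \<le> B"
    by (auto dest!: compact_imp_bounded simp: bounded_iff)
  then have B: "\<bar>g x\<bar> \<le> B" if "norm x = 1" for x using that by simp
  show ?thesis
    by (rule uniform_sphere.integrable_const_bound[where B = B])
       (use AE_uniform_sphere B borel_measurable_continuous_onI[OF assms] in \<open>auto elim!: eventually_mono\<close>)
qed

theorem sphere_poincare:
  fixes g :: "'a::euclidean_space \<Rightarrow> real" and G :: "'a \<Rightarrow> 'a"
  assumes n: "2 \<le> DIM('a)"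
    and g: "\<And>x. (g has_derivative (\<lambda>h. h \<bullet> G x)) (at x)" and G: "continuous_on UNIV G"
  shows "(\<integral>\<^sup>+\<omega>. ennreal ((g \<omega> - (\<integral>\<xi>. g \<xi> \<partial>uniform_sphere))\<^sup>2) \<partial>uniform_sphere) \<le>
    ennreal (2 * pi * 2 ^ DIM('a) * DIM('a)) * (\<integral>\<^sup>+\<omega>. ennreal ((norm (G \<omega>))\<^sup>2) \<partial>uniform_sphere)"
proof -
  have gc: "continuous_on UNIV g"
    by (intro continuous_at_imp_continuous_on ballI has_derivative_continuous[OF g])
  have "(\<integral>\<^sup>+\<omega>. ennreal ((g \<omega> - (\<integral>\<xi>. g \<xi> \<partial>uniform_sphere))\<^sup>2) \<partial>uniform_sphere) =
      (\<integral>\<^sup>+\<xi>. (\<integral>\<^sup>+\<omega>. ennreal ((g \<omega> - (\<integral>\<xi>. g \<xi> \<partial>uniform_sphere))\<^sup>2) \<partial>uniform_sphere) \<partial>(uniform_sphere :: 'a measure))"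
    by (simp add: uniform_sphere.emeasure_space_1[simplified])
  also have "\<dots> \<le> (\<integral>\<^sup>+\<xi>. (\<integral>\<^sup>+\<omega>. ennreal ((g \<omega> - g \<xi>)\<^sup>2) \<partial>uniform_sphere) \<partial>uniform_sphere)"
    by (intro nn_integral_mono uniform_sphere.mean_minimizes integrable_uniform_sphere_continuous continuous_intros gc)
  also note sphere_pair_poincare[OF n g G]
  finally show ?thesis .
qed

section \<open>A Hardy inequality on the tail\<close>

text \<open>With \<open>G = h\<^sup>2 r ^ (n - 2) K f\<close>, the equation for \<open>K f\<close> and the growth condition give the pointwise
  inequality \<open>h\<^sup>2 r ^ (n - 1) f / 4 \<le> 2 K h'\<^sup>2 r ^ (n - 1) f - G'\<close>. Its integral over \<open>[R, T]\<close> leaves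
  the boundary terms \<open>G R - G T\<close>, which are at most \<open>G R\<close> because \<open>G\<close> is nonnegative.\<close>

lemma tail_hardy:
  fixes f K h h' :: "real \<Rightarrow> real" and n :: nat
  assumes n: "2 \<le> n" and R: "0 < R"
    and f0: "\<And>r. 0 < r \<Longrightarrow> 0 \<le> f r" and K0: "\<And>r. 0 < r \<Longrightarrow> 0 < K r"
    and p: "\<And>r. 0 < r \<Longrightarrow> ((\<lambda>r. K r * f r) has_real_derivative - r * f r) (at r)"
    and KR: "\<And>r. R \<le> r \<Longrightarrow> (real n - 1) * (K r / r\<^sup>2) \<le> 1 / 2"
    and fm: "(\<lambda>r. f r * indicator {0<..} r) \<in> borel_measurable borel"
    and h: "\<And>r. (h has_real_derivative h' r) (at r)" and h': "continuous_on UNIV h'"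
  shows "(\<integral>\<^sup>+r. ennreal ((h r)\<^sup>2 * (r ^ (n - 1) * f r)) * indicator {R..} r \<partial>lborel) \<le>
    8 * (\<integral>\<^sup>+r. ennreal (K r * (h' r)\<^sup>2 * (r ^ (n - 1) * f r)) * indicator {R..} r \<partial>lborel) +
    ennreal (2 * R ^ n * f R * (h R)\<^sup>2)"
proof -
  define m where "m = n - 2"
  have nm: "n = m + 2" "n - 1 = Suc m" using n by (simp_all add: m_def)
  define G where "G r = (h r)\<^sup>2 * (r ^ m * (K r * f r))" for r
  define G' where "G' r = 2 * h r * h' r * (r ^ m * (K r * f r)) +
     (h r)\<^sup>2 * (real m * r ^ (m - 1) * (K r * f r) + r ^ m * (- r * f r))" for r
  define u where "u r = (h r)\<^sup>2 * (r ^ (n - 1) * f r) / 4" for r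
  define v where "v r = 2 * (h' r)\<^sup>2 * (r ^ (n - 1) * (K r * f r))" for r
  have dG: "(G has_real_derivative G' r) (at r)" if "0 < r" for r
    unfolding G_def G'_def
    by (rule derivative_eq_intros h p[OF that] refl)+ (simp add: algebra_simps)
  \<comment> \<open>The growth bound enters twice: in \<open>A\<close> for the derivative of \<open>r ^ m\<close>, and in \<open>B\<close> to turn the
      \<open>K\<^sup>2 h'\<^sup>2\<close> that Young's inequality produces into \<open>K h'\<^sup>2\<close>.\<close>
  have key: "u r \<le> v r - G' r" if "R \<le> r" for r
  proof -
    have r: "0 < r" using R that by simp
    have fr: "0 \<le> f r" and Kr: "0 < K r" using f0 K0 r by auto
    have K1: "(real m + 1) * K r \<le> r\<^sup>2 / 2"
      using KR[OF that] r by (simp add: nm field_simps)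
    have mK: "real m * K r \<le> r\<^sup>2 / 2" and K2: "K r \<le> r\<^sup>2 / 2"
    proof -
      have "0 \<le> real m * K r" using Kr by simp
      moreover have "(real m + 1) * K r = real m * K r + K r" by (simp add: distrib_right)
      ultimately show "real m * K r \<le> r\<^sup>2 / 2" "K r \<le> r\<^sup>2 / 2"
        using K1 Kr by linarith+
    qed
    have A: "real m * r ^ (m - 1) * K r \<le> r ^ Suc m / 2"
    proof (cases "m = 0")
      case False
      then have "r ^ Suc m = r ^ (m - 1) * r\<^sup>2"
        by (simp add: power_add[symmetric] del: power_Suc)
      then show ?thesis
        using mult_left_mono[OF mK, of "r ^ (m - 1)"] r by (simp add: mult_ac)
    qed (use r in simp)
    have B: "2 * h r * h' r * K r * r ^ m \<le> (h r)\<^sup>2 * r ^ Suc m / 4 + 2 * (h' r)\<^sup>2 * K r * r ^ Suc m"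
    proof -
      have "2 * h r * (h' r * K r) * r \<le> (h r * r)\<^sup>2 / 4 + 4 * (h' r * K r)\<^sup>2"
        using zero_le_power2[of "h r * r / 2 - 2 * (h' r * K r)"] by (simp add: power2_eq_square algebra_simps)
      also have "(h' r * K r)\<^sup>2 \<le> (h' r)\<^sup>2 * K r * (r\<^sup>2 / 2)"
        using mult_left_mono[OF K2, of "(h' r)\<^sup>2 * K r"] Kr by (simp add: power2_eq_square mult_ac)
      finally have "2 * h r * (h' r * K r) * r \<le> r * ((h r)\<^sup>2 * r / 4 + 2 * (h' r)\<^sup>2 * K r * r)"
        by (simp add: power2_eq_square algebra_simps)
      then have "2 * h r * (h' r * K r) \<le> (h r)\<^sup>2 * r / 4 + 2 * (h' r)\<^sup>2 * K r * r"
        using r by (simp add: mult.commute[of _ r])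
      then have "2 * h r * (h' r * K r) * r ^ m \<le> ((h r)\<^sup>2 * r / 4 + 2 * (h' r)\<^sup>2 * K r * r) * r ^ m"
        using r by (intro mult_right_mono) auto
      then show ?thesis by (simp add: algebra_simps)
    qed
    have A': "(h r)\<^sup>2 * (real m * r ^ (m - 1) * (K r * f r)) \<le> (h r)\<^sup>2 * (r ^ Suc m / 2 * f r)"
      using mult_right_mono[OF A fr] by (intro mult_left_mono) (auto simp: mult_ac)
    have B': "2 * h r * h' r * (r ^ m * (K r * f r)) \<le>
        ((h r)\<^sup>2 * r ^ Suc m / 4 + 2 * (h' r)\<^sup>2 * K r * r ^ Suc m) * f r"
      using mult_right_mono[OF B fr] by (simp add: mult_ac)
    show ?thesis using A' B' unfolding u_def v_def G'_def nm
      by (simp add: algebra_simps)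
  qed
  have pcont: "continuous_on {0<..} (\<lambda>r. K r * f r)"
    by (rule continuous_at_imp_continuous_on) (use p DERIV_isCont in auto)
  \<comment> \<open>A primitive of \<open>v\<close> on a neighbourhood of \<open>[R, \<infinity>)\<close>, inside the positive axis where \<open>K f\<close> is continuous.\<close>
  obtain V where V: "\<And>r. R / 2 < r \<Longrightarrow> (V has_real_derivative v r) (at r)"
  proof -
    have "isCont v x" if "ereal (R / 2) < ereal x" for x
    proof -
      have x: "0 < x" using that R by simp
      have "isCont h' x" using h' by (simp add: continuous_on_eq_continuous_at)
      with DERIV_isCont[OF p[OF x]] show ?thesis unfolding v_def
        by (intro isCont_mult[OF isCont_mult[OF continuous_const isCont_power]]
              isCont_mult[OF isCont_power[OF continuous_ident]])
    qed
    then have "\<exists>F. \<forall>x. ereal (R / 2) < ereal x \<longrightarrow> ereal x < \<infinity> \<longrightarrow> (F has_vector_derivative v x) (at x)"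
      by (intro einterval_antiderivative) auto
    then show ?thesis using that by (auto simp: has_real_derivative_iff_has_vector_derivative)
  qed
  have u0: "0 \<le> u r" if "R \<le> r" for r using f0[of r] R that by (simp add: u_def)
  have v0: "0 \<le> v r" if "R \<le> r" for r using f0[of r] K0[of r] R that by (simp add: v_def)
  have G0: "0 \<le> G r" if "R \<le> r" for r using f0[of r] K0[of r] R that by (simp add: G_def)
  define b where "b r = indicator {0<..} r * (v r - G' r)" for r
  have hc: "continuous_on UNIV h"
    by (rule continuous_at_imp_continuous_on) (use h DERIV_isCont in auto)
  have [measurable]: "h \<in> borel_measurable borel" "h' \<in> borel_measurable borel"
    using hc h' by (auto intro: borel_measurable_continuous_onI)
  have [measurable]: "(\<lambda>r. indicator {0<..} r * (K r * f r)) \<in> borel_measurable borel"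
    using borel_measurable_continuous_on_indicator[OF _ pcont] by simp
  note fm [measurable]
  have vb: "(\<lambda>r. indicator {0<..} r * v r) \<in> borel_measurable borel"
  proof -
    have "(\<lambda>r. indicator {0<..} r * v r) =
        (\<lambda>r. 2 * (h' r)\<^sup>2 * (r ^ (n - 1) * (indicator {0<..} r * (K r * f r))))"
      by (auto simp: v_def fun_eq_iff)
    then show ?thesis by (simp only:) measurable
  qed
  have bb: "b \<in> borel_measurable borel"
  proof -
    have "b = (\<lambda>r. indicator {0<..} r * v r -
      (2 * h r * h' r * (r ^ m * (indicator {0<..} r * (K r * f r))) +
     (h r)\<^sup>2 * (real m * r ^ (m - 1) * (indicator {0<..} r * (K r * f r)) + r ^ m * (- r * (f r * indicator {0<..} r)))))"
      by (auto simp: b_def G'_def fun_eq_iff split: split_indicator)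
    moreover note vb [measurable]
    have "(\<lambda>r. indicator {0<..} r * v r - w r) \<in> borel_measurable borel"
      if [measurable]: "w \<in> borel_measurable borel" for w :: "real \<Rightarrow> real" by measurable
    moreover have "(\<lambda>r. 2 * h r * h' r * (r ^ m * (indicator {0<..} r * (K r * f r))) +
       (h r)\<^sup>2 * (real m * r ^ (m - 1) * (indicator {0<..} r * (K r * f r)) + r ^ m * (- r * (f r * indicator {0<..} r))))
       \<in> borel_measurable borel" by measurable
    ultimately show ?thesis by simp
  qed
  have fin: "(\<integral>\<^sup>+r. ennreal (u r) * indicator {R..R + real k} r \<partial>lborel) \<le>
      (\<integral>\<^sup>+r. ennreal (v r) * indicator {R..} r \<partial>lborel) + ennreal (G R)" for k
  proof -
    let ?T = "R + real k"
    have "(\<integral>\<^sup>+r. ennreal (u r) * indicator {R..?T} r \<partial>lborel) \<le>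
        (\<integral>\<^sup>+r. ennreal (b r) * indicator {R..?T} r \<partial>lborel)"
      using key R by (intro nn_integral_mono) (auto simp: b_def split: split_indicator intro!: ennreal_leI)
    also have "\<dots> = (V ?T - G ?T) - (V R - G R)"
    proof (rule nn_integral_FTC_Icc[OF bb])
      fix x assume x: "x \<in> {R..?T}"
      then have "R / 2 < x" "0 < x" using R by auto
      then show "((\<lambda>r. V r - G r) has_real_derivative b x) (at x)"
        using V dG by (auto intro!: derivative_eq_intros simp: b_def)
      show "0 \<le> b x" using key[of x] u0[of x] x \<open>0 < x\<close> by (simp add: b_def)
    qed simp
    also have "\<dots> \<le> ennreal ((V ?T - V R) + G R)"
      using G0[of ?T] by (intro ennreal_leI) simp
    also have "\<dots> = ennreal (V ?T - V R) + ennreal (G R)"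
    proof (rule ennreal_plus)
      have "V R \<le> V ?T"
        by (rule DERIV_nonneg_imp_nondecreasing) (use V v0 R in \<open>auto intro!: exI[of _ "v _"]\<close>)
      then show "0 \<le> V ?T - V R" by simp
    qed (rule G0, simp)
    also have "ennreal (V ?T - V R) = (\<integral>\<^sup>+r. ennreal (indicator {0<..} r * v r) * indicator {R..?T} r \<partial>lborel)"
      by (rule nn_integral_FTC_Icc[OF vb, symmetric]) (use R V v0 in auto)
    also have "\<dots> \<le> (\<integral>\<^sup>+r. ennreal (v r) * indicator {R..} r \<partial>lborel)"
      using R by (intro nn_integral_mono) (auto split: split_indicator)
    finally show ?thesis by (simp add: add_right_mono)
  qed
  have um: "(\<lambda>r. ennreal (u r) * indicator A r) \<in> borel_measurable lborel"
    if [measurable]: "A \<in> sets borel" and "A \<subseteq> {R..}" for A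
  proof -
    have "(\<lambda>r. ennreal (u r) * indicator A r) =
        (\<lambda>r. ennreal ((h r)\<^sup>2 * (r ^ (n - 1) * (f r * indicator {0<..} r)) / 4) * indicator A r)"
      using R that by (fastforce simp: u_def fun_eq_iff split: split_indicator)
    then show ?thesis by simp
  qed
  have vm: "(\<lambda>r. ennreal (v r) * indicator {R..} r) \<in> borel_measurable lborel"
  proof -
    have "(\<lambda>r. ennreal (v r) * indicator {R..} r) =
        (\<lambda>r. ennreal (indicator {0<..} r * v r) * indicator {R..} r)"
      using R by (auto simp: fun_eq_iff split: split_indicator)
    then show ?thesis using vb by simp
  qed
  have "(\<integral>\<^sup>+r. ennreal (u r) * indicator {R..} r \<partial>lborel) \<le>
      (\<integral>\<^sup>+r. ennreal (v r) * indicator {R..} r \<partial>lborel) + ennreal (G R)"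
  proof -
    have "(SUP k. ennreal (u r) * indicator {R..R + real k} r) = ennreal (u r) * indicator {R..} r" for r
    proof (cases "R \<le> r")
      case True
      obtain k where k: "r - R \<le> real k" using real_arch_simple by blast
      show ?thesis
      proof (rule antisym)
        have "ennreal (u r) * indicator {R..R + real k} r \<le> (SUP k. ennreal (u r) * indicator {R..R + real k} r)"
          by (rule SUP_upper) simp
        then show "ennreal (u r) * indicator {R..} r \<le> (SUP k. ennreal (u r) * indicator {R..R + real k} r)"
          using True k by simp
      qed (auto intro!: SUP_least split: split_indicator)
    qed simp
    then have "(\<integral>\<^sup>+r. ennreal (u r) * indicator {R..} r \<partial>lborel) =
        (\<integral>\<^sup>+r. (SUP k. ennreal (u r) * indicator {R..R + real k} r) \<partial>lborel)" by simp
    also have "\<dots> = (SUP k. \<integral>\<^sup>+r. ennreal (u r) * indicator {R..R + real k} r \<partial>lborel)"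
      by (rule nn_integral_monotone_convergence_SUP[OF _ um])
         (auto simp: incseq_def le_fun_def split: split_indicator)
    also have "\<dots> \<le> (\<integral>\<^sup>+r. ennreal (v r) * indicator {R..} r \<partial>lborel) + ennreal (G R)"
      by (rule SUP_least) (rule fin)
    finally show ?thesis .
  qed
  then have "4 * (\<integral>\<^sup>+r. ennreal (u r) * indicator {R..} r \<partial>lborel) \<le>
      4 * ((\<integral>\<^sup>+r. ennreal (v r) * indicator {R..} r \<partial>lborel) + ennreal (G R))"
    by (rule mult_left_mono) simp
  moreover have "4 * (\<integral>\<^sup>+r. ennreal (u r) * indicator {R..} r \<partial>lborel) =
      (\<integral>\<^sup>+r. ennreal ((h r)\<^sup>2 * (r ^ (n - 1) * f r)) * indicator {R..} r \<partial>lborel)"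
    by (subst nn_integral_cmult[symmetric, OF um])
       (use u0 in \<open>auto intro!: nn_integral_cong simp: u_def ennreal_mult'[symmetric] ennreal_numeral[symmetric]
          simp del: ennreal_numeral split: split_indicator\<close>)
  moreover have "4 * (\<integral>\<^sup>+r. ennreal (v r) * indicator {R..} r \<partial>lborel) =
     8 * (\<integral>\<^sup>+r. ennreal (K r * (h' r)\<^sup>2 * (r ^ (n - 1) * f r)) * indicator {R..} r \<partial>lborel)"
  proof -
    have eq: "ennreal (v r) * indicator {R..} r =
        2 * (ennreal (K r * (h' r)\<^sup>2 * (r ^ (n - 1) * f r)) * indicator {R..} r)" for r
      using f0[of r] K0[of r] R
      by (auto simp: v_def ennreal_mult'[symmetric] ennreal_numeral[symmetric] mult_ac
          simp del: ennreal_numeral split: split_indicator)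
    have "(\<lambda>r. ennreal (K r * (h' r)\<^sup>2 * (r ^ (n - 1) * f r)) * indicator {R..} r) =
       (\<lambda>r. ennreal (1 / 2) * (ennreal (v r) * indicator {R..} r))"
    proof -
      have "ennreal (1 / 2) * ennreal 2 = 1" by (subst ennreal_mult'[symmetric]) simp_all
      then have "ennreal (1 / 2) * 2 = 1" by (simp only: ennreal_numeral)
      then show ?thesis unfolding eq mult.assoc[symmetric] by simp
    qed
    then have "(\<lambda>r. ennreal (K r * (h' r)\<^sup>2 * (r ^ (n - 1) * f r)) * indicator {R..} r) \<in> borel_measurable lborel"
      using vm by simp
    then show ?thesis unfolding eq by (subst nn_integral_cmult) (simp_all add: mult.assoc[symmetric])
  qed
  moreover have "4 * ennreal (G R) \<le> ennreal (2 * R ^ n * f R * (h R)\<^sup>2)"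
  proof -
    have "K R \<le> (real n - 1) * K R" using n K0[OF R] by simp
    then have "K R \<le> R\<^sup>2 / 2" using KR[of R] R by (simp add: field_simps)
    then have "(h R)\<^sup>2 * R ^ m * f R * K R \<le> (h R)\<^sup>2 * R ^ m * f R * (R\<^sup>2 / 2)"
      using f0[OF R] R by (intro mult_left_mono) auto
    then have "4 * G R \<le> 2 * R ^ n * f R * (h R)\<^sup>2"
      by (simp add: G_def nm power_add power2_eq_square mult_ac)
    then show ?thesis
      by (simp add: ennreal_mult'[symmetric] ennreal_numeral[symmetric] ennreal_leI del: ennreal_numeral)
  qed
  ultimately show ?thesis
    by (simp add: distrib_left) (meson add_left_mono order_trans)
qed

section \<open>Smooth functions of one variable\<close>

lemma Ck_on_subset: "Ck_on k T f \<Longrightarrow> S \<subseteq> T \<Longrightarrow> Ck_on k S f"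
  by (induction k arbitrary: f) (auto intro: continuous_on_subset)

lemma frechet_derivative_real:
  "(f has_real_derivative D) (at x) \<Longrightarrow> frechet_derivative f (at x) 1 = D"
  by (metis has_field_derivative_def frechet_derivative_at mult.right_neutral)

lemma Ck_on_Suc_realI:
  assumes "\<And>x. (f has_real_derivative f' x) (at x)" "Ck_on k UNIV f'"
  shows "Ck_on (Suc k) UNIV f"
  using assms frechet_derivative_real[OF assms(1)]
  by (auto simp: real_differentiable_def)

lemma Ck_on_Suc_realE:
  fixes f :: "real \<Rightarrow> real"
  assumes "Ck_on (Suc k) UNIV f"
  obtains f' where "\<And>x. (f has_real_derivative f' x) (at x)" "Ck_on k UNIV f'"
proof -
  from assms obtain f' where f': "\<And>x. (f has_real_derivative f' x) (at x)"
    by (auto simp: real_differentiable_def) metis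
  moreover have "Ck_on k UNIV f'"
    using assms frechet_derivative_real[OF f'] by simp
  ultimately show ?thesis using that by blast
qed

lemma Ck_on_SucD: "Ck_on (Suc k) UNIV f \<Longrightarrow> Ck_on k UNIV f" for f :: "real \<Rightarrow> real"
proof (induction k arbitrary: f)
  case 0
  then show ?case
    by (auto intro!: continuous_at_imp_continuous_on differentiable_imp_continuous_within)
next
  case (Suc k)
  from Ck_on_Suc_realE[OF Suc.prems] obtain f'
    where "\<And>x. (f has_real_derivative f' x) (at x)" "Ck_on (Suc k) UNIV f'" by blast
  then show ?case using Suc.IH by (blast intro: Ck_on_Suc_realI)
qed

lemma Ck_on_add: "Ck_on k UNIV f \<Longrightarrow> Ck_on k UNIV g \<Longrightarrow> Ck_on k UNIV (\<lambda>x. f x + g x)"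
  for f g :: "real \<Rightarrow> real"
proof (induction k arbitrary: f g)
  case (Suc k)
  from Suc.prems obtain f' g' where "\<And>x. (f has_real_derivative f' x) (at x)" "Ck_on k UNIV f'"
    "\<And>x. (g has_real_derivative g' x) (at x)" "Ck_on k UNIV g'" by (metis Ck_on_Suc_realE)
  then show ?case
    using Suc.IH by (intro Ck_on_Suc_realI[of _ "\<lambda>x. f' x + g' x"]) (auto intro!: derivative_intros)
qed (auto intro: continuous_intros)

lemma Ck_on_mult: "Ck_on k UNIV f \<Longrightarrow> Ck_on k UNIV g \<Longrightarrow> Ck_on k UNIV (\<lambda>x. f x * g x)"
  for f g :: "real \<Rightarrow> real"
proof (induction k arbitrary: f g)
  case (Suc k)
  from Suc.prems obtain f' g' where d: "\<And>x. (f has_real_derivative f' x) (at x)" "Ck_on k UNIV f'"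
    "\<And>x. (g has_real_derivative g' x) (at x)" "Ck_on k UNIV g'" by (metis Ck_on_Suc_realE)
  moreover have "Ck_on k UNIV f" "Ck_on k UNIV g" using Suc.prems by (blast intro: Ck_on_SucD)+
  ultimately have "Ck_on k UNIV (\<lambda>x. f' x * g x + g' x * f x)"
    by (intro Ck_on_add Suc.IH)
  then show ?case
    by (rule Ck_on_Suc_realI[rotated]) (intro DERIV_mult d)
qed (auto intro: continuous_intros)

lemma Ck_on_affine: "Ck_on k UNIV f \<Longrightarrow> Ck_on k UNIV (\<lambda>x. c * f (a * x + b))"
  for f :: "real \<Rightarrow> real"
proof (induction k arbitrary: f c)
  case 0
  then have "continuous_on UNIV f" by simp
  then show ?case
    by (auto intro!: continuous_intros continuous_on_compose2[of UNIV f])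
next
  case (Suc k)
  from Suc.prems obtain f' where d: "\<And>x. (f has_real_derivative f' x) (at x)" "Ck_on k UNIV f'"
    by (metis Ck_on_Suc_realE)
  have "((\<lambda>x. c * f (a * x + b)) has_real_derivative c * (f' (a * x + b) * a)) (at x)" for x
    by (intro DERIV_cmult DERIV_chain2[OF d(1)]) (auto intro!: derivative_eq_intros)
  then show ?case
    using Suc.IH[OF d(2), of "c * a"] by (intro Ck_on_Suc_realI[of _ "\<lambda>x. (c * a) * f' (a * x + b)"]) (auto simp: mult_ac)
qed

section \<open>Smooth cutoffs and the truncated one-dimensional inequality\<close>

text \<open>Products of a polynomial in \<open>1 / x\<close> with \<open>exp (- 1 / x)\<close>, extended by \<open>0\<close>: a class that contains the usual
  flat function and is closed under differentiation, so that one induction yields smoothness.\<close>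

definition flat :: "real poly \<Rightarrow> real \<Rightarrow> real" where
  "flat p x = (if 0 < x then poly p (1 / x) * exp (- (1 / x)) else 0)"

lemma poly_exp_tendsto_0: "((\<lambda>x. poly p x * exp (- x)) \<longlongrightarrow> 0) at_top" for p :: "real poly"
proof -
  have "((\<lambda>x. \<Sum>i\<le>degree p. coeff p i * (x ^ i / exp x)) \<longlongrightarrow> (\<Sum>i\<le>degree p. coeff p i * 0)) at_top"
    by (intro tendsto_intros tendsto_power_div_exp_0)
  then show ?thesis
    by (simp add: poly_altdef sum_distrib_right exp_minus divide_inverse mult.assoc)
qed

lemma flat_tendsto_0: "(flat p \<longlongrightarrow> 0) (at 0)"
proof (rule filterlim_split_at)
  have "((\<lambda>x. poly p (inverse x) * exp (- inverse x)) \<longlongrightarrow> 0) (at_right 0)"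
    by (rule filterlim_compose[OF poly_exp_tendsto_0 filterlim_inverse_at_top_right])
  moreover have "\<forall>\<^sub>F x in at_right 0. poly p (inverse x) * exp (- inverse x) = flat p x"
    by (auto simp: eventually_at_filter flat_def divide_inverse)
  ultimately show "(flat p \<longlongrightarrow> 0) (at_right 0)"
    by (simp cong: tendsto_cong add: tendsto_cong)
  have "\<forall>\<^sub>F x in at_left 0. flat p x = 0"
    by (auto simp: eventually_at_filter flat_def)
  then show "(flat p \<longlongrightarrow> 0) (at_left 0)" by (rule tendsto_eventually)
qed

lemma has_derivative_flat:
  "(flat p has_real_derivative flat ([:0, 0, 1:] * (p - pderiv p)) x) (at x)"
proof -
  consider "0 < x" | "x < 0" | "x = 0" by linarith
  then show ?thesis
  proof cases
    case 1
    have "((\<lambda>x. poly p (1 / x) * exp (- (1 / x))) has_real_derivative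
      (poly (pderiv p) (1 / x) * (- (1 / x\<^sup>2))) * exp (- (1 / x)) + poly p (1 / x) * (exp (- (1 / x)) * (1 / x\<^sup>2))) (at x)"
      using 1 by (auto intro!: derivative_eq_intros DERIV_chain2[OF poly_DERIV] simp: power2_eq_square field_simps)
    moreover have "(poly (pderiv p) (1 / x) * (- (1 / x\<^sup>2))) * exp (- (1 / x)) + poly p (1 / x) * (exp (- (1 / x)) * (1 / x\<^sup>2)) =
       flat ([:0, 0, 1:] * (p - pderiv p)) x"
      using 1 by (simp add: flat_def power2_eq_square algebra_simps)
    ultimately have "((\<lambda>x. poly p (1 / x) * exp (- (1 / x))) has_real_derivative flat ([:0, 0, 1:] * (p - pderiv p)) x) (at x)"
      by simp
    then show ?thesis
      by (rule has_field_derivative_transform_within_open[where S = "{0<..}"]) (use 1 in \<open>auto simp: flat_def\<close>)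
  next
    case 2
    have "((\<lambda>x. 0) has_real_derivative 0) (at x)" by simp
    then have "(flat p has_real_derivative 0) (at x)"
      by (rule has_field_derivative_transform_within_open[where S = "{..<0}"]) (use 2 in \<open>auto simp: flat_def\<close>)
    then show ?thesis using 2 by (simp add: flat_def)
  next
    case 3
    have "((\<lambda>h. flat p h / h) \<longlongrightarrow> 0) (at 0)"
    proof (rule Lim_transform_eventually[OF flat_tendsto_0[of "[:0, 1:] * p"]])
      show "\<forall>\<^sub>F h in at 0. flat ([:0, 1:] * p) h = flat p h / h"
        by (auto simp: flat_def)
    qed
    then show ?thesis using 3 by (simp add: has_field_derivative_iff flat_def)
  qed
qed

lemma Ck_on_flat: "Ck_on k UNIV (flat p)"
proof (induction k arbitrary: p)
  case 0
  show ?case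
    by (auto intro!: continuous_at_imp_continuous_on DERIV_isCont[OF has_derivative_flat])
next
  case (Suc k)
  show ?case by (rule Ck_on_Suc_realI[OF has_derivative_flat Suc])
qed

text \<open>Smooth approximations from below of the indicator of \<open>r < R\<close>.\<close>

definition cutoff :: "real \<Rightarrow> nat \<Rightarrow> real \<Rightarrow> real" where
  "cutoff R j r = flat 1 (real (Suc j) * (R - r))"

lemma cutoff_bounds: "0 \<le> cutoff R j r" "cutoff R j r \<le> 1"
  by (auto simp: cutoff_def flat_def)

lemma cutoff_eq_0: "R \<le> r \<Longrightarrow> cutoff R j r = 0"
  using mult_nonneg_nonpos[of "real (Suc j)" "R - r"] by (simp add: cutoff_def flat_def not_less del: of_nat_Suc)

lemma cutoff_tendsto_1:
  assumes "r < R"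
  shows "(\<lambda>j. cutoff R j r) \<longlonglongrightarrow> 1"
proof -
  have "(\<lambda>j. exp (- (inverse (real (Suc j)) * (1 / (R - r))))) \<longlonglongrightarrow> exp (- (0 * (1 / (R - r))))"
    by (intro tendsto_intros LIMSEQ_inverse_real_of_nat)
  then show ?thesis
    using assms by (simp add: cutoff_def flat_def divide_inverse mult_ac del: of_nat_Suc)
qed

lemma Ck_on_cutoff: "Ck_on k UNIV (cutoff R j)"
proof -
  have "cutoff R j = (\<lambda>r. 1 * flat 1 (- real (Suc j) * r + real (Suc j) * R))"
    by (simp add: cutoff_def fun_eq_iff algebra_simps)
  then show ?thesis using Ck_on_affine[OF Ck_on_flat] by metis
qed

text \<open>The approximants \<open>F j\<close> are primitives of \<open>\<psi>' * cutoff R j\<close>. They are smooth and bounded, and their weighted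
  energy is at most that of \<open>\<psi>\<close> on \<open>r < R\<close>, so the hypothesis applies to them even if \<open>w\<close> is not locally
  integrable against \<open>g\<close>. Only the variances have to pass to the limit, by dominated convergence.\<close>

theorem truncated_poincare:
  fixes w g \<psi> \<psi>' :: "real \<Rightarrow> real"
  assumes wp: "weighted_poincare {0<..} w g" and R: "0 < R"
    and \<psi>: "\<And>x. (\<psi> has_real_derivative \<psi>' x) (at x)" and Ck: "\<And>k. Ck_on k UNIV \<psi>'"
    and B: "\<And>x. \<bar>\<psi>' x\<bar> \<le> B"
  shows "\<exists>m. (\<integral>\<^sup>+r. ennreal ((\<psi> (min r R) - m)\<^sup>2 * g r) * indicator {0<..} r \<partial>lborel) \<le>
    (\<integral>\<^sup>+r. ennreal (w r * (\<psi>' r)\<^sup>2 * g r) * indicator {0<..<R} r \<partial>lborel)" (is "\<exists>m. ?L m \<le> ?D")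
proof (cases "?D = \<infinity>")
  case False
  define d where "d = enn2real ?D"
  have d: "?D = ennreal d" using False by (simp add: d_def less_top)
  define g0 where "g0 r = indicator {0<..} r * g r" for r
  define w0 where "w0 r = indicator {0<..} r * w r" for r
  have g_nn: "\<And>x. 0 < x \<Longrightarrow> 0 \<le> g x" and w_nn: "\<And>x. 0 < x \<Longrightarrow> 0 \<le> w x"
    and gi: "integrable lborel g0" and [measurable]: "w0 \<in> borel_measurable borel"
    and P: "\<And>\<phi>. smooth_on {0<..} \<phi> \<Longrightarrow> bounded (\<phi> ` {0<..}) \<Longrightarrow>
        set_integrable lborel {0<..} (\<lambda>x. w x * (deriv \<phi> x)\<^sup>2 * g x) \<Longrightarrow>
        (LBINT x:{0<..}. (\<phi> x - (LBINT y:{0<..}. \<phi> y * g y))\<^sup>2 * g x)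
          \<le> (LBINT x:{0<..}. w x * (deriv \<phi> x)\<^sup>2 * g x)"
    using wp unfolding weighted_poincare_def
    by (auto simp: set_integrable_def set_borel_measurable_def g0_def[abs_def] w0_def[abs_def])
  have [measurable]: "g0 \<in> borel_measurable borel" using borel_measurable_integrable[OF gi] by simp
  have g0_nn: "0 \<le> g0 r" for r using g_nn by (auto simp: g0_def split: split_indicator)
  have si: "(LBINT x:{0<..}. F x * g x) = (\<integral>x. F x * g0 x \<partial>lborel)" for F
    unfolding set_lebesgue_integral_def g0_def by (intro Bochner_Integration.integral_cong) auto
  have \<psi>'c: "continuous_on UNIV \<psi>'" using Ck[of 0] by simp
  have \<eta>c: "continuous_on UNIV (cutoff R j)" for j using Ck_on_cutoff[of 0] by simp
  have "isCont (\<lambda>r. \<psi>' r * cutoff R j r) x" for x j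
    using \<psi>'c \<eta>c[of j] by (auto intro!: continuous_intros simp: continuous_on_eq_continuous_at)
  then have "\<exists>F. \<forall>x. (-\<infinity>::ereal) < ereal x \<longrightarrow> ereal x < \<infinity> \<longrightarrow>
      (F has_vector_derivative \<psi>' x * cutoff R j x) (at x)" for j
    by (intro einterval_antiderivative) auto
  then have "\<exists>F. \<forall>x. (F has_real_derivative \<psi>' x * cutoff R j x) (at x)" for j
    by (auto simp: has_real_derivative_iff_has_vector_derivative)
  then obtain F0 where F0: "\<And>j x. (F0 j has_real_derivative \<psi>' x * cutoff R j x) (at x)" by metis
  define F where "F j r = F0 j r - F0 j 0" for j r
  have F: "(F j has_real_derivative \<psi>' x * cutoff R j x) (at x)" for j x
    unfolding F_def using F0 by (auto intro!: derivative_eq_intros)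
  define \<xi> where "\<xi> r = \<psi> (min r R) - \<psi> 0" for r
  have B0: "0 \<le> B" using B[of 0] by linarith
  note [measurable] = borel_measurable_continuous_onI[OF \<psi>'c] borel_measurable_continuous_onI[OF \<eta>c]
  have bnd: "\<bar>\<psi>' x * cutoff R j x * indicator {0..r} x\<bar> \<le> B * indicator {0..R} x" for j r x
  proof (cases "x \<le> R")
    case True
    have "\<bar>\<psi>' x\<bar> * cutoff R j x \<le> B * 1"
      using B cutoff_bounds B0 by (intro mult_mono) auto
    then show ?thesis using True cutoff_bounds[of R j x] B0
      by (auto simp: abs_mult split: split_indicator)
  qed (simp add: cutoff_eq_0)
  have "integrable lborel (indicator {0..R} :: real \<Rightarrow> real)"
    by (rule integrable_real_indicator) (use R in auto)
  then have iB: "integrable lborel (\<lambda>x. B * indicator {0..R} x)"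
    by (rule integrable_mult_right)
  have Fint: "(\<integral>x. \<psi>' x * cutoff R j x * indicator {0..r} x \<partial>lborel) = F j r" if "0 < r" for j r
  proof -
    have "(\<integral>x. \<psi>' x * cutoff R j x * indicator {0..r} x \<partial>lborel) = F j r - F j 0"
      by (rule integral_FTC_Icc_real)
         (use that F \<psi>'c \<eta>c[of j] in \<open>auto intro!: continuous_intros simp: continuous_on_eq_continuous_at\<close>)
    then show ?thesis by (simp add: F_def)
  qed
  have Fb: "\<bar>F j r\<bar> \<le> B * R" if "0 < r" for j r
  proof -
    have "integrable lborel (\<lambda>x. \<psi>' x * cutoff R j x * indicator {0..r} x)"
      by (rule Bochner_Integration.integrable_bound[OF iB], measurable)
         (rule AE_I2, unfold real_norm_def, rule order_trans[OF bnd abs_ge_self])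
    then have "norm (\<integral>x. \<psi>' x * cutoff R j x * indicator {0..r} x \<partial>lborel) \<le> (\<integral>x. B * indicator {0..R} x \<partial>lborel)"
      by (rule Bochner_Integration.integral_norm_bound_integral[OF _ iB]) (use bnd in \<open>simp only: real_norm_def\<close>)
    then have "\<bar>F j r\<bar> \<le> (\<integral>x. B * indicator {0..R} x \<partial>lborel)"
      unfolding Fint[OF that] by simp
    then show ?thesis using R by simp
  qed
  have Flim: "(\<lambda>j. F j r) \<longlonglongrightarrow> \<xi> r" if r: "0 < r" for r
  proof -
    have "(\<lambda>j. \<integral>x. \<psi>' x * cutoff R j x * indicator {0..r} x \<partial>lborel) \<longlonglongrightarrow> (\<integral>x. \<psi>' x * indicator {0..min r R} x \<partial>lborel)"
    proof (rule integral_dominated_convergence[where w = "\<lambda>x. B * indicator {0..R} x"])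
      show "AE x in lborel. (\<lambda>j. \<psi>' x * cutoff R j x * indicator {0..r} x) \<longlonglongrightarrow> \<psi>' x * indicator {0..min r R} x"
        using AE_lborel_singleton[of R]
      proof eventually_elim
        case (elim x)
        show ?case
        proof (cases "x < R")
          case True
          have "(\<lambda>j. \<psi>' x * cutoff R j x * indicator {0..r} x) \<longlonglongrightarrow> \<psi>' x * 1 * indicator {0..r} x"
            by (intro tendsto_intros cutoff_tendsto_1 True)
          then show ?thesis using True by (auto split: split_indicator)
        qed (use elim in \<open>auto simp: cutoff_eq_0\<close>)
      qed
    qed (use bnd iB in auto)
    moreover have "(\<integral>x. \<psi>' x * indicator {0..min r R} x \<partial>lborel) = \<psi> (min r R) - \<psi> 0"
      by (rule integral_FTC_Icc_real)
         (use r R \<psi> \<psi>'c in \<open>auto simp: continuous_on_eq_continuous_at\<close>)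
    ultimately show ?thesis by (simp add: Fint[OF r] \<xi>_def)
  qed
  have sm: "smooth_on {0<..} (F j)" for j
    unfolding smooth_on_def
  proof
    fix k
    have "Ck_on (Suc k) UNIV (F j)"
      by (rule Ck_on_Suc_realI[OF F Ck_on_mult[OF Ck Ck_on_cutoff]])
    then show "Ck_on k {0<..} (F j)" by (blast intro: Ck_on_SucD Ck_on_subset)
  qed
  have bd: "bounded (F j ` {0<..})" for j
    unfolding bounded_iff using Fb by (intro exI[of _ "B * R"]) auto
  have dF: "deriv (F j) x = \<psi>' x * cutoff R j x" for j x by (rule DERIV_imp_deriv[OF F])
  define E where "E j x = w0 x * (\<psi>' x * cutoff R j x)\<^sup>2 * g0 x" for j x
  have E_nn: "0 \<le> E j x" for j x
    using w_nn g0_nn[of x] by (auto simp: E_def w0_def split: split_indicator)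
  have [measurable]: "E j \<in> borel_measurable borel" for j unfolding E_def[abs_def] by measurable
  have ED: "(\<integral>\<^sup>+x. ennreal (E j x) \<partial>lborel) \<le> ?D" for j
  proof (rule nn_integral_mono)
    fix x :: real
    show "ennreal (E j x) \<le> ennreal (w x * (\<psi>' x)\<^sup>2 * g x) * indicator {0<..<R} x"
    proof (cases "0 < x \<and> x < R")
      case True
      have "(cutoff R j x)\<^sup>2 \<le> 1" using cutoff_bounds by (simp add: abs_square_le_1)
      then have "(w x * (\<psi>' x)\<^sup>2 * g x) * (cutoff R j x)\<^sup>2 \<le> (w x * (\<psi>' x)\<^sup>2 * g x) * 1"
        using w_nn g_nn True by (intro mult_left_mono) auto
      then show ?thesis using True by (auto simp: E_def w0_def g0_def power_mult_distrib mult_ac intro!: ennreal_leI)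
    next
      case False
      then have "E j x = 0" by (auto simp: E_def w0_def cutoff_eq_0)
      then show ?thesis by simp
    qed
  qed
  have Ei: "integrable lborel (E j)" for j
  proof (rule integrableI_nonneg)
    show "(\<integral>\<^sup>+x. ennreal (E j x) \<partial>lborel) < \<infinity>"
      using le_less_trans[OF ED[of j]] False by (simp add: less_top)
  qed (simp_all add: E_nn)
  have EI: "(\<integral>x. E j x \<partial>lborel) \<le> d" for j
  proof -
    have "ennreal (\<integral>x. E j x \<partial>lborel) \<le> ennreal d"
      using ED[of j] d nn_integral_eq_integral[OF Ei[of j]] by (simp add: E_nn)
    then show ?thesis by (simp add: d_def)
  qed
  define m where "m j = (\<integral>x. F j x * g0 x \<partial>lborel)" for j
  have main: "(\<integral>x. (F j x - m j)\<^sup>2 * g0 x \<partial>lborel) \<le> d" for j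
  proof -
    have eq: "(\<lambda>x. indicator {0<..} x *\<^sub>R (w x * (deriv (F j) x)\<^sup>2 * g x)) = E j"
      by (auto simp: E_def dF w0_def g0_def fun_eq_iff split: split_indicator)
    have eq2: "(\<lambda>x. w x * (deriv (F j) x)\<^sup>2 * g0 x) = E j"
      by (auto simp: E_def dF w0_def g0_def fun_eq_iff split: split_indicator)
    have "set_integrable lborel {0<..} (\<lambda>x. w x * (deriv (F j) x)\<^sup>2 * g x)"
      unfolding set_integrable_def eq by (rule Ei)
    from P[OF sm bd this] have "(\<integral>x. (F j x - m j)\<^sup>2 * g0 x \<partial>lborel) \<le> (\<integral>x. E j x \<partial>lborel)"
      unfolding si m_def[symmetric] eq2 .
    with EI[of j] show ?thesis by linarith
  qed
  have Fm [measurable]: "F j \<in> borel_measurable borel" for j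
    by (intro borel_measurable_continuous_onI continuous_at_imp_continuous_on) (auto intro: DERIV_isCont[OF F])
  have [measurable]: "\<psi> \<in> borel_measurable borel"
    by (intro borel_measurable_continuous_onI continuous_at_imp_continuous_on) (auto intro: DERIV_isCont[OF \<psi>])
  have [measurable]: "\<xi> \<in> borel_measurable borel" unfolding \<xi>_def[abs_def] by measurable
  define \<mu> where "\<mu> = (\<integral>x. \<xi> x * g0 x \<partial>lborel)"
  have mlim: "m \<longlonglongrightarrow> \<mu>"
    unfolding m_def[abs_def] \<mu>_def
  proof (rule integral_dominated_convergence[where w = "\<lambda>x. B * R * g0 x"])
    show "AE x in lborel. (\<lambda>j. F j x * g0 x) \<longlonglongrightarrow> \<xi> x * g0 x"
      using Flim by (intro AE_I2) (auto simp: g0_def intro!: tendsto_intros split: split_indicator)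
    show "AE x in lborel. norm (F j x * g0 x) \<le> B * R * g0 x" for j
    proof (rule AE_I2)
      fix x show "norm (F j x * g0 x) \<le> B * R * g0 x"
        using Fb[of x j] g0_nn[of x] by (cases "0 < x") (auto simp: abs_mult mult_right_mono g0_def)
    qed
  qed (use gi in auto)
  obtain C where C: "\<And>j. \<bar>m j\<bar> \<le> C"
    using convergent_imp_Bseq[OF convergentI[OF mlim]] by (auto simp: Bseq_def)
  have lim: "(\<lambda>j. \<integral>x. (F j x - m j)\<^sup>2 * g0 x \<partial>lborel) \<longlonglongrightarrow> (\<integral>x. (\<xi> x - \<mu>)\<^sup>2 * g0 x \<partial>lborel)"
    and int: "integrable lborel (\<lambda>x. (\<xi> x - \<mu>)\<^sup>2 * g0 x)"
  proof -
    have 1: "AE x in lborel. (\<lambda>j. (F j x - m j)\<^sup>2 * g0 x) \<longlonglongrightarrow> (\<xi> x - \<mu>)\<^sup>2 * g0 x"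
      using Flim mlim by (intro AE_I2) (auto simp: g0_def intro!: tendsto_intros split: split_indicator)
    have 2: "AE x in lborel. norm ((F j x - m j)\<^sup>2 * g0 x) \<le> (B * R + C)\<^sup>2 * g0 x" for j
    proof (rule AE_I2)
      fix x show "norm ((F j x - m j)\<^sup>2 * g0 x) \<le> (B * R + C)\<^sup>2 * g0 x"
      proof (cases "0 < x")
        case True
        have "\<bar>F j x - m j\<bar> \<le> B * R + C" using Fb[OF True, of j] C[of j] by linarith
        from power_mono[OF this abs_ge_zero, of 2] have "(F j x - m j)\<^sup>2 \<le> (B * R + C)\<^sup>2" by simp
        then show ?thesis using g0_nn[of x] by (simp add: abs_mult mult_right_mono)
      qed (simp add: g0_def)
    qed
    have 3: "integrable lborel (\<lambda>x. (B * R + C)\<^sup>2 * g0 x)" using gi by simp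
    show "(\<lambda>j. \<integral>x. (F j x - m j)\<^sup>2 * g0 x \<partial>lborel) \<longlonglongrightarrow> (\<integral>x. (\<xi> x - \<mu>)\<^sup>2 * g0 x \<partial>lborel)"
      by (rule integral_dominated_convergence[OF _ _ 3 1 2]) measurable
    show "integrable lborel (\<lambda>x. (\<xi> x - \<mu>)\<^sup>2 * g0 x)"
      by (rule integrable_dominated_convergence[OF _ _ 3 1 2]) measurable
  qed
  have "(\<integral>x. (\<xi> x - \<mu>)\<^sup>2 * g0 x \<partial>lborel) \<le> d"
    by (rule LIMSEQ_le_const2[OF lim]) (use main in auto)
  then have "(\<integral>\<^sup>+x. ennreal ((\<xi> x - \<mu>)\<^sup>2 * g0 x) \<partial>lborel) \<le> ?D"
    unfolding d by (subst nn_integral_eq_integral[OF int]) (auto simp: g0_nn ennreal_leI)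
  moreover have "?L (\<mu> + \<psi> 0) = (\<integral>\<^sup>+x. ennreal ((\<xi> x - \<mu>)\<^sup>2 * g0 x) \<partial>lborel)"
    by (intro nn_integral_cong) (auto simp: \<xi>_def g0_def algebra_simps split: split_indicator)
  ultimately show ?thesis by (intro exI[of _ "\<mu> + \<psi> 0"]) simp
qed simp

section \<open>Smoothness of spherical means\<close>

lemma Ck_on_imp_continuous_on: "Ck_on k UNIV f \<Longrightarrow> continuous_on UNIV f"
  by (cases k) (auto intro!: continuous_at_imp_continuous_on differentiable_imp_continuous_within)

lemma has_derivative_gradient:
  assumes "Ck_on 1 UNIV g"
  shows "(g has_derivative (\<lambda>h. h \<bullet> gradient g x)) (at x)" and "continuous_on UNIV (gradient g)"
proof -
  show "(g has_derivative (\<lambda>h. h \<bullet> gradient g x)) (at x)"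
    using GDERIV_gradient[of g x] assms by (simp add: gderiv_def)
  show "continuous_on UNIV (gradient g)"
    unfolding gradient_def[abs_def] using assms by (intro continuous_intros) simp
qed

lemma continuous_on_ray:
  fixes g :: "'a::real_normed_vector \<Rightarrow> 'b::topological_space"
  assumes "continuous_on UNIV g"
  shows "continuous_on S (\<lambda>\<omega>. g (r *\<^sub>R \<omega>))"
  by (rule continuous_on_compose2[OF assms continuous_on_scaleR[OF continuous_on_const continuous_on_id]]) simp

lemma continuous_bounded_on_cball:
  fixes g :: "'a::euclidean_space \<Rightarrow> 'b::real_normed_vector"
  assumes "continuous_on UNIV g"
  shows "\<exists>B\<ge>0. \<forall>x. norm x \<le> \<rho> \<longrightarrow> norm (g x) \<le> B"
proof -
  have "compact (g ` cball 0 \<rho>)"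
    by (rule compact_continuous_image) (auto intro: continuous_on_subset[OF assms])
  then obtain B where B: "\<forall>x\<in>cball 0 \<rho>. norm (g x) \<le> B"
    by (auto dest!: compact_imp_bounded simp: bounded_iff)
  show ?thesis
    by (rule exI[of _ "max 0 B"]) (use B in \<open>simp add: le_max_iff_disj\<close>)
qed

lemma continuous_spherical_mean:
  fixes g P :: "'a::euclidean_space \<Rightarrow> real"
  assumes g: "continuous_on UNIV g" and P: "continuous_on UNIV P"
  shows "continuous_on UNIV (\<lambda>r. \<integral>\<omega>. P \<omega> * g (r *\<^sub>R \<omega>) \<partial>uniform_sphere)"
proof (rule continuous_at_imp_continuous_on, rule ballI)
  fix r :: real
  note [measurable] = borel_measurable_continuous_onI[OF g] borel_measurable_continuous_onI[OF P]
  show "isCont (\<lambda>r. \<integral>\<omega>. P \<omega> * g (r *\<^sub>R \<omega>) \<partial>uniform_sphere) r"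
    unfolding continuous_at_sequentially comp_def
  proof (intro allI impI)
    fix X assume X: "X \<longlonglongrightarrow> r"
    obtain M where M: "\<And>i. \<bar>X i\<bar> \<le> M"
      using convergent_imp_Bseq[OF convergentI[OF X]] by (auto simp: Bseq_def)
    obtain B where B: "0 \<le> B" "\<And>x. norm x \<le> M \<Longrightarrow> norm (g x) \<le> B"
      using continuous_bounded_on_cball[OF g, of M] by auto
    obtain B' where B': "0 \<le> B'" "\<And>x. norm x \<le> 1 \<Longrightarrow> norm (P x) \<le> B'"
      using continuous_bounded_on_cball[OF P, of 1] by auto
    show "(\<lambda>i. \<integral>\<omega>. P \<omega> * g (X i *\<^sub>R \<omega>) \<partial>uniform_sphere) \<longlonglongrightarrow> (\<integral>\<omega>. P \<omega> * g (r *\<^sub>R \<omega>) \<partial>uniform_sphere)"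
    proof (rule integral_dominated_convergence[where w = "\<lambda>_. B' * B"])
      show "AE \<omega> in uniform_sphere. (\<lambda>i. P \<omega> * g (X i *\<^sub>R \<omega>)) \<longlonglongrightarrow> P \<omega> * g (r *\<^sub>R \<omega>)"
        by (intro AE_I2 tendsto_mult tendsto_const continuous_on_tendsto_compose[OF g] tendsto_scaleR X) auto
      show "AE \<omega> in uniform_sphere. norm (P \<omega> * g (X i *\<^sub>R \<omega>)) \<le> B' * B" for i
        using AE_uniform_sphere
      proof eventually_elim
        case (elim \<omega>)
        then show ?case
          using B(2)[of "X i *\<^sub>R \<omega>"] B'(2)[of \<omega>] B(1) B'(1) M[of i] by (simp add: abs_mult mult_mono)
      qed
    qed simp_all
  qed
qed

text \<open>Differentiation under the integral sign. The factor \<open>P\<close> is there for the iteration: each derivative brings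
  down a coordinate of \<open>\<omega>\<close>.\<close>

lemma has_derivative_spherical_mean:
  fixes g P :: "'a::euclidean_space \<Rightarrow> real"
  assumes g: "\<And>x. (g has_derivative (\<lambda>h. h \<bullet> G x)) (at x)" and G: "continuous_on UNIV G"
    and P: "continuous_on UNIV P"
  shows "((\<lambda>r. \<integral>\<omega>. P \<omega> * g (r *\<^sub>R \<omega>) \<partial>uniform_sphere) has_real_derivative
    (\<integral>\<omega>. P \<omega> * (\<omega> \<bullet> G (r *\<^sub>R \<omega>)) \<partial>uniform_sphere)) (at r)"
proof -
  have gc: "continuous_on UNIV g"
    by (intro continuous_at_imp_continuous_on ballI has_derivative_continuous[OF g])
  note [measurable] = borel_measurable_continuous_onI[OF gc] borel_measurable_continuous_onI[OF P]
    borel_measurable_continuous_onI[OF G]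
  have int: "integrable uniform_sphere (\<lambda>\<omega>. P \<omega> * g (s *\<^sub>R \<omega>))" for s
    by (intro integrable_uniform_sphere_continuous continuous_on_mult P continuous_on_ray[OF gc])
  have ray: "((\<lambda>t. g (t *\<^sub>R \<omega>)) has_real_derivative \<omega> \<bullet> G (t *\<^sub>R \<omega>)) (at t)" for t \<omega>
  proof -
    have "((\<lambda>t. g (t *\<^sub>R \<omega>)) has_derivative (\<lambda>h. (h *\<^sub>R \<omega>) \<bullet> G (t *\<^sub>R \<omega>))) (at t)"
      by (rule has_derivative_compose[OF _ g]) (auto intro!: derivative_eq_intros)
    then show ?thesis by (rule has_derivative_imp_has_field_derivative) simp
  qed
  show ?thesis
    unfolding DERIV_def tendsto_at_iff_sequentially comp_def
  proof (intro allI impI)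
    fix X :: "nat \<Rightarrow> real" assume X0: "\<forall>i. X i \<in> UNIV - {0}" and X: "X \<longlonglongrightarrow> 0"
    have X0: "X i \<noteq> 0" for i using X0 by auto
    obtain M where M: "\<And>i. \<bar>X i\<bar> \<le> M"
      using convergent_imp_Bseq[OF convergentI[OF X]] by (auto simp: Bseq_def)
    obtain B where B: "0 \<le> B" "\<And>x. norm x \<le> \<bar>r\<bar> + M \<Longrightarrow> norm (G x) \<le> B"
      using continuous_bounded_on_cball[OF G, of "\<bar>r\<bar> + M"] by auto
    obtain B' where B': "0 \<le> B'" "\<And>x. norm x \<le> 1 \<Longrightarrow> norm (P x) \<le> B'"
      using continuous_bounded_on_cball[OF P, of 1] by auto
    let ?q = "\<lambda>i \<omega>. P \<omega> * ((g ((r + X i) *\<^sub>R \<omega>) - g (r *\<^sub>R \<omega>)) / X i)"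
    have "(\<lambda>i. \<integral>\<omega>. ?q i \<omega> \<partial>uniform_sphere) \<longlonglongrightarrow> (\<integral>\<omega>. P \<omega> * (\<omega> \<bullet> G (r *\<^sub>R \<omega>)) \<partial>uniform_sphere)"
    proof (rule integral_dominated_convergence[where w = "\<lambda>_. B' * B"])
      show "AE \<omega> in uniform_sphere. (\<lambda>i. ?q i \<omega>) \<longlonglongrightarrow> P \<omega> * (\<omega> \<bullet> G (r *\<^sub>R \<omega>))"
      proof (intro AE_I2 tendsto_mult tendsto_const)
        fix \<omega> :: 'a
        show "(\<lambda>i. (g ((r + X i) *\<^sub>R \<omega>) - g (r *\<^sub>R \<omega>)) / X i) \<longlonglongrightarrow> \<omega> \<bullet> G (r *\<^sub>R \<omega>)"
          using ray[of \<omega> r] X0 X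
          unfolding DERIV_def tendsto_at_iff_sequentially comp_def by auto
      qed
      show "AE \<omega> in uniform_sphere. norm (?q i \<omega>) \<le> B' * B" for i
        using AE_uniform_sphere
      proof eventually_elim
        case (elim \<omega>)
        have "norm (g ((r + X i) *\<^sub>R \<omega>) - g (r *\<^sub>R \<omega>)) \<le> B * norm ((r + X i) - r)"
        proof (rule field_differentiable_bound[where S = "{- (\<bar>r\<bar> + M)..\<bar>r\<bar> + M}"])
          fix t assume t: "t \<in> {- (\<bar>r\<bar> + M)..\<bar>r\<bar> + M}"
          show "((\<lambda>t. g (t *\<^sub>R \<omega>)) has_real_derivative \<omega> \<bullet> G (t *\<^sub>R \<omega>)) (at t within {- (\<bar>r\<bar> + M)..\<bar>r\<bar> + M})"
            using ray by (rule has_field_derivative_at_within)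
          have "\<bar>\<omega> \<bullet> G (t *\<^sub>R \<omega>)\<bar> \<le> norm \<omega> * norm (G (t *\<^sub>R \<omega>))" by (rule Cauchy_Schwarz_ineq2)
          also have "\<dots> \<le> B" using B(2)[of "t *\<^sub>R \<omega>"] t elim by (simp add: abs_le_iff)
          finally show "norm (\<omega> \<bullet> G (t *\<^sub>R \<omega>)) \<le> B" by simp
        next
          show "r + X i \<in> {- (\<bar>r\<bar> + M)..\<bar>r\<bar> + M}" using M[of i] by auto
          show "r \<in> {- (\<bar>r\<bar> + M)..\<bar>r\<bar> + M}" using order_trans[OF abs_ge_zero M] by auto
        qed simp
        then have "\<bar>(g ((r + X i) *\<^sub>R \<omega>) - g (r *\<^sub>R \<omega>)) / X i\<bar> \<le> B"
          using X0[of i] by (simp add: abs_divide divide_le_eq)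
        then have "\<bar>P \<omega>\<bar> * \<bar>(g ((r + X i) *\<^sub>R \<omega>) - g (r *\<^sub>R \<omega>)) / X i\<bar> \<le> B' * B"
          using B' elim by (intro mult_mono) auto
        then show ?case by (simp add: abs_mult)
      qed
    qed simp_all
    moreover have "(\<integral>\<omega>. ?q i \<omega> \<partial>uniform_sphere) =
       ((\<integral>\<omega>. P \<omega> * g ((r + X i) *\<^sub>R \<omega>) \<partial>uniform_sphere) - (\<integral>\<omega>. P \<omega> * g (r *\<^sub>R \<omega>) \<partial>uniform_sphere)) / X i" for i
    proof -
      have "(\<integral>\<omega>. ?q i \<omega> \<partial>uniform_sphere) = (\<integral>\<omega>. (P \<omega> * g ((r + X i) *\<^sub>R \<omega>) - P \<omega> * g (r *\<^sub>R \<omega>)) / X i \<partial>uniform_sphere)"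
        by (intro Bochner_Integration.integral_cong) (simp_all add: right_diff_distrib)
      also have "\<dots> = ((\<integral>\<omega>. P \<omega> * g ((r + X i) *\<^sub>R \<omega>) \<partial>uniform_sphere) - (\<integral>\<omega>. P \<omega> * g (r *\<^sub>R \<omega>) \<partial>uniform_sphere)) / X i"
        using int by simp
      finally show ?thesis .
    qed
    ultimately show "(\<lambda>i. ((\<integral>\<omega>. P \<omega> * g ((r + X i) *\<^sub>R \<omega>) \<partial>uniform_sphere) -
       (\<integral>\<omega>. P \<omega> * g (r *\<^sub>R \<omega>) \<partial>uniform_sphere)) / X i)
       \<longlonglongrightarrow> (\<integral>\<omega>. P \<omega> * (\<omega> \<bullet> G (r *\<^sub>R \<omega>)) \<partial>uniform_sphere)" by (simp only:)
  qed
qed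

lemma Ck_on_sum:
  fixes f :: "'b \<Rightarrow> real \<Rightarrow> real"
  assumes "finite A" "A \<noteq> {}" "\<And>b. b \<in> A \<Longrightarrow> Ck_on k UNIV (f b)"
  shows "Ck_on k UNIV (\<lambda>x. \<Sum>b\<in>A. f b x)"
  using assms by (induction rule: finite_ne_induct) (auto intro: Ck_on_add)

lemma Ck_on_spherical_mean:
  fixes g P :: "'a::euclidean_space \<Rightarrow> real"
  assumes "Ck_on k UNIV g" "continuous_on UNIV P"
  shows "Ck_on k UNIV (\<lambda>r. \<integral>\<omega>. P \<omega> * g (r *\<^sub>R \<omega>) \<partial>uniform_sphere)"
  using assms
proof (induction k arbitrary: g P)
  case 0
  then show ?case by (simp add: continuous_spherical_mean)
next
  case (Suc k)
  let ?D = "\<lambda>b x. frechet_derivative g (at x) b"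
  have Dk: "Ck_on k UNIV (?D b)" if "b \<in> Basis" for b using Suc.prems that by simp
  have Dc: "continuous_on UNIV (?D b)" if "b \<in> Basis" for b
    by (rule Ck_on_imp_continuous_on[OF Dk[OF that]])
  have g: "(g has_derivative (\<lambda>h. h \<bullet> gradient g x)) (at x)" for x
    using GDERIV_gradient[of g x] Suc.prems by (simp add: gderiv_def)
  have G: "continuous_on UNIV (gradient g)"
    unfolding gradient_def[abs_def] by (intro continuous_intros Dc)
  have "(\<integral>\<omega>. P \<omega> * (\<omega> \<bullet> gradient g (r *\<^sub>R \<omega>)) \<partial>uniform_sphere) =
      (\<Sum>b\<in>Basis. \<integral>\<omega>. (P \<omega> * (\<omega> \<bullet> b)) * ?D b (r *\<^sub>R \<omega>) \<partial>uniform_sphere)" for r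
  proof -
    have "integrable uniform_sphere (\<lambda>\<omega>. (P \<omega> * (\<omega> \<bullet> b)) * ?D b (r *\<^sub>R \<omega>))" if "b \<in> Basis" for b
      by (intro integrable_uniform_sphere_continuous continuous_on_mult continuous_on_inner
          continuous_on_id continuous_on_const Suc.prems(2) continuous_on_ray[OF Dc[OF that]])
    then show ?thesis
      by (subst Bochner_Integration.integral_sum[symmetric])
         (auto simp: gradient_def inner_sum_right sum_distrib_left mult_ac intro!: Bochner_Integration.integral_cong)
  qed
  with has_derivative_spherical_mean[OF g G Suc.prems(2)]
  have "((\<lambda>r. \<integral>\<omega>. P \<omega> * g (r *\<^sub>R \<omega>) \<partial>uniform_sphere) has_real_derivative
     (\<Sum>b\<in>Basis. \<integral>\<omega>. (P \<omega> * (\<omega> \<bullet> b)) * ?D b (r *\<^sub>R \<omega>) \<partial>uniform_sphere)) (at r)" for r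
    by simp
  then show ?case
  proof (rule Ck_on_Suc_realI)
    show "Ck_on k UNIV (\<lambda>r. \<Sum>b\<in>Basis. \<integral>\<omega>. (P \<omega> * (\<omega> \<bullet> b)) * ?D b (r *\<^sub>R \<omega>) \<partial>uniform_sphere)"
      by (intro Ck_on_sum Suc.IH Dk continuous_on_mult continuous_on_inner continuous_on_id
          continuous_on_const Suc.prems(2)) auto
  qed
qed

section \<open>The inequality for radial densities\<close>

text \<open>The three parts of the decomposition are \<open>X\<close> (difference to the radially constant extension), \<open>Y\<close> (angular
  oscillation of that extension) and \<open>Z m\<close> (oscillation of the truncated spherical mean). All integrals are
  nonnegative extended ones, so every step makes sense before integrability is known.\<close>

theorem radial_poincare:
  fixes \<phi> :: "'a::euclidean_space \<Rightarrow> real" and f K w :: "real \<Rightarrow> real" and R B :: real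
  defines "n \<equiv> DIM('a)"
  defines "a \<equiv> unit_sphere_area n"
  defines "W \<equiv> \<lambda>r. max (w r) (r\<^sup>2) * indicator {..R} r + K r * indicator {R<..} r"
  defines "G \<equiv> gradient \<phi>"
  defines "CP \<equiv> 2 * pi * 2 ^ n * real n"
  assumes n: "2 \<le> n" and R: "0 < R"
    and f0: "\<And>r. 0 < r \<Longrightarrow> 0 \<le> f r" and K0: "\<And>r. 0 < r \<Longrightarrow> 0 < K r"
    and p: "\<And>r. 0 < r \<Longrightarrow> ((\<lambda>r. K r * f r) has_real_derivative - r * f r) (at r)"
    and KR: "\<And>r. R \<le> r \<Longrightarrow> (real n - 1) * (K r / r\<^sup>2) \<le> 1 / 2"
    and wp: "weighted_poincare {0<..} w (\<lambda>\<rho>. a * \<rho> ^ (n - 1) * f \<rho>)"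
    and sm: "smooth_on UNIV \<phi>" and bG: "\<And>x. norm (G x) \<le> B"
  shows "\<exists>m. (\<integral>\<^sup>+x. ennreal (f (norm x)) * ennreal ((\<phi> x - m)\<^sup>2) \<partial>lborel) \<le>
    ennreal (20 + 8 * CP) * ((\<integral>\<^sup>+x. ennreal (W (norm x) * f (norm x)) * ennreal ((norm (G x))\<^sup>2) \<partial>lborel) +
      ennreal (R ^ 3 * (a * R ^ (n - 1) * f R)) * (\<integral>\<^sup>+\<omega>. ennreal ((norm (G (R *\<^sub>R \<omega>)))\<^sup>2) \<partial>uniform_sphere))"
proof -
  define A where "A r = ennreal (a * r ^ (n - 1)) * indicator {0<..} r" for r :: real
  define \<gamma> where "\<gamma> r = (\<integral>\<^sup>+\<omega>. ennreal ((norm (G (r *\<^sub>R \<omega>)))\<^sup>2) \<partial>uniform_sphere)" for r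
  define S where "S v = (\<integral>\<^sup>+r. A r * ennreal (v r) * \<gamma> r \<partial>lborel)" for v :: "real \<Rightarrow> real"
  define \<psi> where "\<psi> r = (\<integral>\<omega>. \<phi> (r *\<^sub>R \<omega>) \<partial>(uniform_sphere :: 'a measure))" for r
  define \<psi>' where "\<psi>' r = (\<integral>\<omega>. \<omega> \<bullet> G (r *\<^sub>R \<omega>) \<partial>uniform_sphere)" for r
  have a: "0 < a" unfolding a_def using n by (intro unit_sphere_area_pos) simp
  have CP: "0 \<le> CP" by (simp add: CP_def)
  have Ck: "Ck_on k UNIV \<phi>" for k using sm by (simp add: smooth_on_def)
  have \<phi>: "(\<phi> has_derivative (\<lambda>h. h \<bullet> G x)) (at x)" for x
    unfolding G_def by (rule has_derivative_gradient(1)[OF Ck])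
  have Gc: "continuous_on UNIV G"
    unfolding G_def by (rule has_derivative_gradient(2)[OF Ck])
  have \<phi>c: "continuous_on UNIV \<phi>" using Ck[of 0] by simp
  have d\<psi>: "(\<psi> has_real_derivative \<psi>' r) (at r)" for r
    using has_derivative_spherical_mean[OF \<phi> Gc continuous_on_const[of UNIV 1]]
    by (simp add: \<psi>_def[abs_def] \<psi>'_def)
  have Ck\<psi>: "Ck_on k UNIV \<psi>" for k
    using Ck_on_spherical_mean[OF Ck[of k] continuous_on_const[of UNIV 1]] by (simp add: \<psi>_def[abs_def])
  have Ck\<psi>': "Ck_on k UNIV \<psi>'" for k
    using Ck\<psi>[of "Suc k"] frechet_derivative_real[OF d\<psi>] by simp
  have \<psi>c: "continuous_on UNIV \<psi>" using Ck\<psi>[of 0] by simp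
  have rad_le: "\<bar>\<omega> \<bullet> G x\<bar> \<le> norm (G x)" if "norm \<omega> = 1" for \<omega> x
    using Cauchy_Schwarz_ineq2[of \<omega> "G x"] that by simp
  have irad: "integrable uniform_sphere (\<lambda>\<omega>. \<omega> \<bullet> G (r *\<^sub>R \<omega>))"
    "integrable uniform_sphere (\<lambda>\<omega>. (\<omega> \<bullet> G (r *\<^sub>R \<omega>))\<^sup>2)"
    "integrable uniform_sphere (\<lambda>\<omega>. (norm (G (r *\<^sub>R \<omega>)))\<^sup>2)" for r
    by (intro integrable_uniform_sphere_continuous continuous_on_power continuous_on_norm continuous_on_inner
        continuous_on_id continuous_on_ray[OF Gc])+
  have B\<psi>': "\<bar>\<psi>' r\<bar> \<le> B" for r
  proof -
    have "\<bar>\<psi>' r\<bar> \<le> (\<integral>\<omega>. \<bar>\<omega> \<bullet> G (r *\<^sub>R \<omega>)\<bar> \<partial>uniform_sphere)"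
      unfolding \<psi>'_def by (rule integral_abs_bound)
    also have "\<dots> \<le> (\<integral>\<omega>. B \<partial>(uniform_sphere :: 'a measure))"
      by (rule integral_mono_AE, use irad(1) in simp, simp, use AE_uniform_sphere in eventually_elim)
         (use rad_le bG order_trans in blast)
    also have "\<dots> = B" using uniform_sphere.prob_space[where 'a = 'a] by simp
    finally show ?thesis .
  qed
  have \<psi>'\<gamma>: "ennreal ((\<psi>' r)\<^sup>2) \<le> \<gamma> r" for r
  proof -
    have "(\<psi>' r)\<^sup>2 \<le> (\<integral>\<omega>. (\<omega> \<bullet> G (r *\<^sub>R \<omega>))\<^sup>2 \<partial>uniform_sphere)"
      unfolding \<psi>'_def by (rule uniform_sphere.square_expectation_le) (rule irad)+
    also have "\<dots> \<le> (\<integral>\<omega>. (norm (G (r *\<^sub>R \<omega>)))\<^sup>2 \<partial>uniform_sphere)"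
    proof (rule integral_mono_AE[OF irad(2,3)], use AE_uniform_sphere in eventually_elim)
      fix \<omega> :: 'a assume "norm \<omega> = 1"
      from power_mono[OF rad_le[OF this] abs_ge_zero, of "r *\<^sub>R \<omega>" 2]
      show "(\<omega> \<bullet> G (r *\<^sub>R \<omega>))\<^sup>2 \<le> (norm (G (r *\<^sub>R \<omega>)))\<^sup>2" by simp
    qed
    finally show ?thesis
      unfolding \<gamma>_def by (subst nn_integral_eq_integral[OF irad(3)]) (auto intro: ennreal_leI)
  qed
  note [measurable] = borel_measurable_continuous_onI[OF \<phi>c] borel_measurable_continuous_onI[OF Gc]
    borel_measurable_continuous_onI[OF \<psi>c]
  have [measurable]: "A \<in> borel_measurable borel" unfolding A_def[abs_def] by measurable
  have [measurable]: "\<gamma> \<in> borel_measurable borel" unfolding \<gamma>_def[abs_def] by measurable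
  \<comment> \<open>\<open>w\<close>, \<open>f\<close> and \<open>K f\<close> are known to be Borel on the positive axis only; cut off at \<open>0\<close> they are Borel everywhere.\<close>
  define fz where "fz r = indicator {0<..} r * f r" for r :: real
  define wz where "wz r = indicator {0<..} r * w r" for r :: real
  define kz where "kz r = indicator {0<..} r * (K r * f r)" for r :: real
  have w0: "0 \<le> w r" if "0 < r" for r using wp that by (simp add: weighted_poincare_def)
  have wzm [measurable]: "wz \<in> borel_measurable borel"
    using wp by (simp add: weighted_poincare_def set_borel_measurable_def wz_def[abs_def])
  have fzm [measurable]: "fz \<in> borel_measurable borel"
  proof -
    have "(\<lambda>r. indicator {0<..} r * (a * r ^ (n - 1) * f r)) \<in> borel_measurable borel"
      using wp by (auto simp: weighted_poincare_def set_integrable_def dest: borel_measurable_integrable)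
    then have "(\<lambda>r. (indicator {0<..} r * (a * r ^ (n - 1) * f r)) / (a * r ^ (n - 1))) \<in> borel_measurable borel"
      by measurable
    moreover have "(\<lambda>r. (indicator {0<..} r * (a * r ^ (n - 1) * f r)) / (a * r ^ (n - 1))) = fz"
      using a by (auto simp: fz_def fun_eq_iff split: split_indicator)
    ultimately show ?thesis by simp
  qed
  have kzm [measurable]: "kz \<in> borel_measurable borel"
  proof -
    have "continuous_on {0<..} (\<lambda>r. K r * f r)"
      by (rule continuous_at_imp_continuous_on) (use p DERIV_isCont in auto)
    from borel_measurable_continuous_on_indicator[OF _ this] show ?thesis
      by (simp add: kz_def[abs_def])
  qed
  have Afz: "A r * ennreal (f r) = A r * ennreal (fz r)" for r
    by (auto simp: A_def fz_def split: split_indicator)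
  \<comment> \<open>\<open>K\<close> alone need not be measurable, but \<open>K * f\<close> is continuous on the positive axis.\<close>
  have Wm: "(\<lambda>r. indicator {0<..} r * (W r * f r)) \<in> borel_measurable borel"
  proof -
    have "(\<lambda>r. indicator {0<..} r * (W r * f r)) =
        (\<lambda>r. max (wz r) (r\<^sup>2) * indicator {..R} r * fz r + kz r * indicator {R<..} r)"
      by (auto simp: W_def wz_def fz_def kz_def fun_eq_iff split: split_indicator)
    then show ?thesis by simp
  qed
  define D where "D = (\<integral>\<^sup>+x. ennreal (W (norm x) * f (norm x)) * ennreal ((norm (G x))\<^sup>2) \<partial>lborel)"
  have DS: "D = S (\<lambda>r. W r * f r)"
    unfolding D_def S_def A_def \<gamma>_def a_def n_def
    by (rule nn_integral_radial_weight[of "\<lambda>r. W r * f r"]) (use Wm in measurable)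
  have S_le_D: "S v \<le> D" if "\<And>r. 0 < r \<Longrightarrow> r \<noteq> R \<Longrightarrow> v r \<le> W r * f r" for v
    unfolding DS S_def
    by (rule nn_integral_mono_AE, use AE_lborel_singleton[of R] in eventually_elim)
       (use that in \<open>auto simp: A_def intro!: mult_right_mono mult_left_mono ennreal_leI split: split_indicator\<close>)
  define J where "J = ennreal (R ^ 3 * (a * R ^ (n - 1) * f R)) * \<gamma> R"
  let ?t = "\<lambda>r. min r R"
  define X where "X = (\<integral>\<^sup>+r. A r * ennreal (f r) * (\<integral>\<^sup>+\<omega>. ennreal ((\<phi> (r *\<^sub>R \<omega>) - \<phi> (?t r *\<^sub>R \<omega>))\<^sup>2) \<partial>uniform_sphere) \<partial>lborel)"
  define V where "V s = (\<integral>\<^sup>+\<omega>. ennreal ((\<phi> (s *\<^sub>R \<omega>) - \<psi> s)\<^sup>2) \<partial>(uniform_sphere :: 'a measure))" for s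
  define Y where "Y = (\<integral>\<^sup>+r. A r * ennreal (f r) * V (?t r) \<partial>lborel)"
  define Z where "Z m = (\<integral>\<^sup>+r. A r * ennreal (f r) * ennreal ((\<psi> (?t r) - m)\<^sup>2) \<partial>lborel)" for m
  have [measurable]: "V \<in> borel_measurable borel" unfolding V_def[abs_def] by measurable
  \<comment> \<open>The Hardy inequality on one ray, with the constant \<open>a\<close> moved into the radial density \<open>A\<close>.\<close>
  have hardy: "(\<integral>\<^sup>+r. A r * ennreal (f r * (h r)\<^sup>2) * indicator {R..} r \<partial>lborel) \<le>
      8 * (\<integral>\<^sup>+r. A r * ennreal (K r * f r * (h' r)\<^sup>2) * indicator {R..} r \<partial>lborel) +
      ennreal (2 * R * (a * R ^ (n - 1) * f R) * (h R)\<^sup>2)"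
    if h: "\<And>r. (h has_real_derivative h' r) (at r)" and h': "continuous_on UNIV h'" for h h'
  proof -
    have hc: "continuous_on UNIV h"
      by (rule continuous_at_imp_continuous_on) (use h DERIV_isCont in auto)
    note [measurable] = borel_measurable_continuous_onI[OF hc] borel_measurable_continuous_onI[OF h']
    have pull: "(\<integral>\<^sup>+r. A r * ennreal (u r) * indicator {R..} r \<partial>lborel) =
        ennreal a * (\<integral>\<^sup>+r. ennreal (u r * r ^ (n - 1)) * indicator {R..} r \<partial>lborel)"
      if u: "(\<lambda>r. indicator {0<..} r * u r) \<in> borel_measurable borel" "\<And>r. 0 < r \<Longrightarrow> 0 \<le> u r" for u
    proof -
      have eq: "ennreal (u r * r ^ (n - 1)) * indicator {R..} r =
          ennreal ((indicator {0<..} r * u r) * r ^ (n - 1)) * indicator {R..} r" for r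
        using R by (auto split: split_indicator)
      show ?thesis unfolding eq
        by (subst nn_integral_cmult[symmetric], use u(1) in measurable)
           (use R a u(2) in \<open>auto simp: A_def ennreal_mult'[symmetric] ennreal_mult''[symmetric] mult_ac intro!: nn_integral_cong split: split_indicator\<close>)
    qed
    have 1: "(\<lambda>r. indicator {0<..} r * (f r * (h r)\<^sup>2)) \<in> borel_measurable borel"
      using fzm unfolding fz_def[abs_def] mult.assoc[symmetric] by measurable
    have 2: "(\<lambda>r. indicator {0<..} r * (K r * f r * (h' r)\<^sup>2)) \<in> borel_measurable borel"
    proof -
      have "(\<lambda>r. kz r * (h' r)\<^sup>2) \<in> borel_measurable borel" by measurable
      then show ?thesis by (simp add: kz_def mult.assoc)
    qed
    have fm: "(\<lambda>r. f r * indicator {0<..} r) \<in> borel_measurable borel"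
      using fzm by (simp add: fz_def[abs_def] mult.commute)
    have Rn: "R ^ n = R * R ^ (n - 1)" using n by (simp add: power_eq_if)
    have "ennreal a * (\<integral>\<^sup>+r. ennreal ((h r)\<^sup>2 * (r ^ (n - 1) * f r)) * indicator {R..} r \<partial>lborel) \<le>
       ennreal a * (8 * (\<integral>\<^sup>+r. ennreal (K r * (h' r)\<^sup>2 * (r ^ (n - 1) * f r)) * indicator {R..} r \<partial>lborel) +
         ennreal (2 * R ^ n * f R * (h R)\<^sup>2))"
      by (intro mult_left_mono tail_hardy[OF n R f0 K0 p KR fm h h']) simp_all
    also have "\<dots> = 8 * (ennreal a * (\<integral>\<^sup>+r. ennreal (K r * (h' r)\<^sup>2 * (r ^ (n - 1) * f r)) * indicator {R..} r \<partial>lborel)) +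
         ennreal (2 * R * (a * R ^ (n - 1) * f R) * (h R)\<^sup>2)"
      using a by (simp add: distrib_left ennreal_mult'[symmetric] Rn mult_ac)
    finally have "ennreal a * (\<integral>\<^sup>+r. ennreal (f r * (h r)\<^sup>2 * r ^ (n - 1)) * indicator {R..} r \<partial>lborel) \<le>
       8 * (ennreal a * (\<integral>\<^sup>+r. ennreal (K r * f r * (h' r)\<^sup>2 * r ^ (n - 1)) * indicator {R..} r \<partial>lborel)) +
         ennreal (2 * R * (a * R ^ (n - 1) * f R) * (h R)\<^sup>2)"
      by (simp only: mult_ac)
    moreover note pull[OF 1] pull[OF 2]
    ultimately show ?thesis using f0 K0 less_imp_le[OF K0] by simp
  qed
  have X_le: "X \<le> 8 * D"
  proof -
    interpret PU: pair_sigma_finite "lborel :: real measure" "uniform_sphere :: 'a measure" ..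
    have "X = (\<integral>\<^sup>+r. (\<integral>\<^sup>+\<omega>. A r * ennreal (fz r) * ennreal ((\<phi> (r *\<^sub>R \<omega>) - \<phi> (?t r *\<^sub>R \<omega>))\<^sup>2) \<partial>uniform_sphere) \<partial>lborel)"
      unfolding X_def Afz by (simp add: nn_integral_cmult)
    also have "\<dots> = (\<integral>\<^sup>+\<omega>. (\<integral>\<^sup>+r. A r * ennreal (fz r) * ennreal ((\<phi> (r *\<^sub>R \<omega>) - \<phi> (?t r *\<^sub>R \<omega>))\<^sup>2) \<partial>lborel) \<partial>uniform_sphere)"
      by (rule PU.Fubini'[symmetric]) measurable
    also have "\<dots> \<le> (\<integral>\<^sup>+\<omega>. 8 * (\<integral>\<^sup>+r. A r * ennreal (kz r * indicator {R..} r) * ennreal ((norm (G (r *\<^sub>R \<omega>)))\<^sup>2) \<partial>lborel) \<partial>uniform_sphere)"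
    proof (rule nn_integral_mono_AE, use AE_uniform_sphere in eventually_elim)
      fix \<omega> :: 'a assume w: "norm \<omega> = 1"
      let ?h = "\<lambda>r. \<phi> (r *\<^sub>R \<omega>) - \<phi> (R *\<^sub>R \<omega>)" and ?h' = "\<lambda>r. \<omega> \<bullet> G (r *\<^sub>R \<omega>)"
      have dh: "(?h has_real_derivative ?h' r) (at r)" for r
      proof -
        have "((\<lambda>t. \<phi> (t *\<^sub>R \<omega>)) has_derivative (\<lambda>h. (h *\<^sub>R \<omega>) \<bullet> G (r *\<^sub>R \<omega>))) (at r)"
          by (rule has_derivative_compose[OF _ \<phi>]) (auto intro!: derivative_eq_intros)
        then have "((\<lambda>t. \<phi> (t *\<^sub>R \<omega>)) has_real_derivative ?h' r) (at r)"
          by (rule has_derivative_imp_has_field_derivative) simp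
        then show ?thesis by (auto intro!: derivative_eq_intros)
      qed
      have h'c: "continuous_on UNIV ?h'"
        by (intro continuous_on_inner continuous_on_const continuous_on_compose2[OF Gc]) (auto intro!: continuous_intros)
      have "(\<integral>\<^sup>+r. A r * ennreal (fz r) * ennreal ((\<phi> (r *\<^sub>R \<omega>) - \<phi> (?t r *\<^sub>R \<omega>))\<^sup>2) \<partial>lborel) =
          (\<integral>\<^sup>+r. A r * ennreal (f r * (?h r)\<^sup>2) * indicator {R..} r \<partial>lborel)"
        using f0 R by (intro nn_integral_cong)
          (auto simp: A_def fz_def min_def ennreal_mult mult_ac split: split_indicator)
      also have "\<dots> \<le> 8 * (\<integral>\<^sup>+r. A r * ennreal (K r * f r * (?h' r)\<^sup>2) * indicator {R..} r \<partial>lborel)"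
        using hardy[OF dh h'c] by simp
      also have "\<dots> \<le> 8 * (\<integral>\<^sup>+r. A r * ennreal (kz r * indicator {R..} r) * ennreal ((norm (G (r *\<^sub>R \<omega>)))\<^sup>2) \<partial>lborel)"
      proof (intro mult_left_mono nn_integral_mono)
        fix r :: real
        have le: "(?h' r)\<^sup>2 \<le> (norm (G (r *\<^sub>R \<omega>)))\<^sup>2"
          using power_mono[OF rad_le[OF w] abs_ge_zero, of "r *\<^sub>R \<omega>" 2] by simp
        show "A r * ennreal (K r * f r * (?h' r)\<^sup>2) * indicator {R..} r \<le>
            A r * ennreal (kz r * indicator {R..} r) * ennreal ((norm (G (r *\<^sub>R \<omega>)))\<^sup>2)"
          using f0[of r] K0[of r] le
          by (auto simp: A_def kz_def mult.assoc ennreal_mult''[symmetric] intro!: mult_left_mono ennreal_leI split: split_indicator)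
      qed simp
      finally show "(\<integral>\<^sup>+r. A r * ennreal (fz r) * ennreal ((\<phi> (r *\<^sub>R \<omega>) - \<phi> (?t r *\<^sub>R \<omega>))\<^sup>2) \<partial>lborel) \<le>
          8 * (\<integral>\<^sup>+r. A r * ennreal (kz r * indicator {R..} r) * ennreal ((norm (G (r *\<^sub>R \<omega>)))\<^sup>2) \<partial>lborel)" .
    qed
    also have "\<dots> = 8 * (\<integral>\<^sup>+\<omega>. (\<integral>\<^sup>+r. A r * ennreal (kz r * indicator {R..} r) * ennreal ((norm (G (r *\<^sub>R \<omega>)))\<^sup>2) \<partial>lborel) \<partial>uniform_sphere)"
      by (rule nn_integral_cmult) measurable
    also have "(\<integral>\<^sup>+\<omega>. (\<integral>\<^sup>+r. A r * ennreal (kz r * indicator {R..} r) * ennreal ((norm (G (r *\<^sub>R \<omega>)))\<^sup>2) \<partial>lborel) \<partial>uniform_sphere) =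
        (\<integral>\<^sup>+r. (\<integral>\<^sup>+\<omega>. A r * ennreal (kz r * indicator {R..} r) * ennreal ((norm (G (r *\<^sub>R \<omega>)))\<^sup>2) \<partial>uniform_sphere) \<partial>lborel)"
      by (rule PU.Fubini') measurable
    also have "\<dots> = S (\<lambda>r. kz r * indicator {R..} r)"
      unfolding S_def \<gamma>_def by (simp add: nn_integral_cmult)
    also have "\<dots> \<le> D"
      using f0 by (intro S_le_D) (auto simp: kz_def W_def le_max_iff_disj intro!: mult_nonneg_nonneg split: split_indicator)
    finally show ?thesis by (simp add: mult_left_mono)
  qed
  have V_le: "V s \<le> ennreal (CP * s\<^sup>2) * \<gamma> s" for s
  proof -
    have d: "((\<lambda>x. \<phi> (s *\<^sub>R x)) has_derivative (\<lambda>h. h \<bullet> (s *\<^sub>R G (s *\<^sub>R x)))) (at x)" for x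
    proof -
      have "((\<lambda>x. \<phi> (s *\<^sub>R x)) has_derivative (\<lambda>h. (s *\<^sub>R h) \<bullet> G (s *\<^sub>R x))) (at x)"
        by (rule has_derivative_compose[OF _ \<phi>]) (auto intro!: derivative_eq_intros)
      then show ?thesis by simp
    qed
    have c: "continuous_on UNIV (\<lambda>x. s *\<^sub>R G (s *\<^sub>R x))"
      by (intro continuous_on_scaleR continuous_on_const continuous_on_ray[OF Gc])
    have "V s \<le> ennreal CP * (\<integral>\<^sup>+\<omega>. ennreal ((norm (s *\<^sub>R G (s *\<^sub>R \<omega>)))\<^sup>2) \<partial>uniform_sphere)"
      unfolding V_def \<psi>_def CP_def n_def
      by (rule sphere_poincare[OF _ d c]) (use n in \<open>simp add: n_def\<close>)
    also have "(\<integral>\<^sup>+\<omega>. ennreal ((norm (s *\<^sub>R G (s *\<^sub>R \<omega>)))\<^sup>2) \<partial>uniform_sphere) = ennreal (s\<^sup>2) * \<gamma> s"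
      unfolding \<gamma>_def by (subst nn_integral_cmult[symmetric]) (auto simp: power_mult_distrib ennreal_mult)
    finally show ?thesis using CP by (simp add: ennreal_mult mult.assoc)
  qed
  have mass: "(\<integral>\<^sup>+r. A r * ennreal (f r) * indicator {R..} r \<partial>lborel) \<le> ennreal (2 * R * (a * R ^ (n - 1) * f R))"
    using hardy[of "\<lambda>_. 1" "\<lambda>_. 0"] by simp
  have Y_le: "Y \<le> ennreal CP * D + ennreal (2 * CP) * J"
  proof -
    have "Y \<le> (\<integral>\<^sup>+r. ennreal CP * (A r * ennreal (fz r * r\<^sup>2 * indicator {..<R} r) * \<gamma> r) +
        (ennreal (CP * R\<^sup>2) * \<gamma> R) * (A r * ennreal (fz r) * indicator {R..} r) \<partial>lborel)"
      unfolding Y_def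
    proof (rule nn_integral_mono)
      fix r :: real
      show "A r * ennreal (f r) * V (?t r) \<le> ennreal CP * (A r * ennreal (fz r * r\<^sup>2 * indicator {..<R} r) * \<gamma> r) +
        (ennreal (CP * R\<^sup>2) * \<gamma> R) * (A r * ennreal (fz r) * indicator {R..} r)"
      proof (cases "0 < r")
        case True
        show ?thesis
        proof (cases "r < R")
          case r: True
          have "A r * ennreal (f r) * V (?t r) \<le> A r * ennreal (f r) * (ennreal (CP * r\<^sup>2) * \<gamma> r)"
            using r V_le[of r] by (intro mult_left_mono) auto
          also have "\<dots> = ennreal CP * (A r * ennreal (fz r * r\<^sup>2 * indicator {..<R} r) * \<gamma> r)"
            using r True f0[OF True] CP by (simp add: fz_def ennreal_mult mult_ac)
          finally show ?thesis using r by simp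
        next
          case r: False
          have "A r * ennreal (f r) * V (?t r) \<le> A r * ennreal (f r) * (ennreal (CP * R\<^sup>2) * \<gamma> R)"
            using r V_le[of R] by (intro mult_left_mono) auto
          then show ?thesis using r True by (simp add: fz_def mult_ac)
        qed
      qed (simp add: A_def)
    qed
    also have "\<dots> = ennreal CP * S (\<lambda>r. fz r * r\<^sup>2 * indicator {..<R} r) +
        (ennreal (CP * R\<^sup>2) * \<gamma> R) * (\<integral>\<^sup>+r. A r * ennreal (fz r) * indicator {R..} r \<partial>lborel)"
      unfolding S_def by (subst nn_integral_add) (simp_all add: nn_integral_cmult)
    also have "\<dots> \<le> ennreal CP * D + (ennreal (CP * R\<^sup>2) * \<gamma> R) * ennreal (2 * R * (a * R ^ (n - 1) * f R))"
    proof (intro add_mono mult_left_mono S_le_D)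
      fix r :: real assume "0 < r" "r \<noteq> R"
      then show "fz r * r\<^sup>2 * indicator {..<R} r \<le> W r * f r"
        using f0[of r] K0[of r] w0[of r] by (auto simp: fz_def W_def mult.commute[of "f r"] intro!: mult_right_mono split: split_indicator)
    qed (use mass in \<open>simp_all add: Afz\<close>)
    also have "(ennreal (CP * R\<^sup>2) * \<gamma> R) * ennreal (2 * R * (a * R ^ (n - 1) * f R)) = ennreal (2 * CP) * J"
    proof -
      have "ennreal (CP * R\<^sup>2) * ennreal (2 * R * (a * R ^ (n - 1) * f R)) =
          ennreal (2 * CP) * ennreal (R ^ 3 * (a * R ^ (n - 1) * f R))"
        using CP R a f0[OF R] by (subst (1 2) ennreal_mult[symmetric]) (auto simp: power2_eq_square power3_eq_cube mult_ac)
      then show ?thesis unfolding J_def by (metis mult.assoc mult.commute)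
    qed
    finally show ?thesis .
  qed
  have "\<exists>m. Z m \<le> D"
  proof -
    obtain m where m: "(\<integral>\<^sup>+r. ennreal ((\<psi> (?t r) - m)\<^sup>2 * (a * r ^ (n - 1) * f r)) * indicator {0<..} r \<partial>lborel) \<le>
       (\<integral>\<^sup>+r. ennreal (w r * (\<psi>' r)\<^sup>2 * (a * r ^ (n - 1) * f r)) * indicator {0<..<R} r \<partial>lborel)"
      using truncated_poincare[OF wp R d\<psi> Ck\<psi>' B\<psi>'] by blast
    have "Z m = (\<integral>\<^sup>+r. ennreal ((\<psi> (?t r) - m)\<^sup>2 * (a * r ^ (n - 1) * f r)) * indicator {0<..} r \<partial>lborel)"
      unfolding Z_def using f0 a
      by (intro nn_integral_cong) (auto simp: A_def ennreal_mult mult_ac split: split_indicator)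
    also note m
    also have "(\<integral>\<^sup>+r. ennreal (w r * (\<psi>' r)\<^sup>2 * (a * r ^ (n - 1) * f r)) * indicator {0<..<R} r \<partial>lborel) \<le>
        S (\<lambda>r. w r * f r * indicator {..<R} r)"
      unfolding S_def
    proof (rule nn_integral_mono)
      fix r :: real
      show "ennreal (w r * (\<psi>' r)\<^sup>2 * (a * r ^ (n - 1) * f r)) * indicator {0<..<R} r \<le>
        A r * ennreal (w r * f r * indicator {..<R} r) * \<gamma> r"
      proof (cases "0 < r \<and> r < R")
        case True
        then have "ennreal (w r * (\<psi>' r)\<^sup>2 * (a * r ^ (n - 1) * f r)) * indicator {0<..<R} r =
           A r * ennreal (w r * f r * indicator {..<R} r) * ennreal ((\<psi>' r)\<^sup>2)"
          using f0[of r] w0[of r] a by (simp add: A_def ennreal_mult mult_ac)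
        also have "\<dots> \<le> A r * ennreal (w r * f r * indicator {..<R} r) * \<gamma> r"
          by (intro mult_left_mono \<psi>'\<gamma>) simp
        finally show ?thesis .
      qed auto
    qed
    also have "\<dots> \<le> D"
      using f0 K0 w0 by (intro S_le_D) (auto simp: W_def intro!: mult_right_mono mult_nonneg_nonneg less_imp_le[OF K0] split: split_indicator)
    finally show ?thesis by blast
  qed
  then obtain m where Z_le: "Z m \<le> D" by blast
  have "(\<integral>\<^sup>+x. ennreal (f (norm x)) * ennreal ((\<phi> x - m)\<^sup>2) \<partial>lborel) =
      (\<integral>\<^sup>+r. A r * ennreal (f r) * (\<integral>\<^sup>+\<omega>. ennreal ((\<phi> (r *\<^sub>R \<omega>) - m)\<^sup>2) \<partial>uniform_sphere) \<partial>lborel)"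
    unfolding A_def a_def n_def
    by (rule nn_integral_radial_weight) (use fzm in \<open>simp_all add: fz_def[abs_def]\<close>)
  also have "\<dots> \<le> (\<integral>\<^sup>+r. 2 * (A r * ennreal (f r) * (\<integral>\<^sup>+\<omega>. ennreal ((\<phi> (r *\<^sub>R \<omega>) - \<phi> (?t r *\<^sub>R \<omega>))\<^sup>2) \<partial>uniform_sphere)) +
      (4 * (A r * ennreal (f r) * V (?t r)) + 4 * (A r * ennreal (f r) * ennreal ((\<psi> (?t r) - m)\<^sup>2))) \<partial>lborel)"
  proof (rule nn_integral_mono)
    fix r :: real
    have "(\<integral>\<^sup>+\<omega>. ennreal ((\<phi> (r *\<^sub>R \<omega>) - m)\<^sup>2) \<partial>uniform_sphere) \<le>
       (\<integral>\<^sup>+\<omega>. 2 * ennreal ((\<phi> (r *\<^sub>R \<omega>) - \<phi> (?t r *\<^sub>R \<omega>))\<^sup>2) +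
         (4 * ennreal ((\<phi> (?t r *\<^sub>R \<omega>) - \<psi> (?t r))\<^sup>2) + 4 * ennreal ((\<psi> (?t r) - m)\<^sup>2)) \<partial>(uniform_sphere :: 'a measure))"
    proof (rule nn_integral_mono)
      fix \<omega> :: 'a
      have sq: "(x + y + z)\<^sup>2 \<le> 2 * x\<^sup>2 + (4 * y\<^sup>2 + 4 * z\<^sup>2)" for x y z :: real
        using zero_le_power2[of "x - (y + z)"] zero_le_power2[of "y - z"]
        by (simp add: power2_eq_square algebra_simps)
      have "(\<phi> (r *\<^sub>R \<omega>) - m)\<^sup>2 \<le> 2 * (\<phi> (r *\<^sub>R \<omega>) - \<phi> (?t r *\<^sub>R \<omega>))\<^sup>2 +
          (4 * (\<phi> (?t r *\<^sub>R \<omega>) - \<psi> (?t r))\<^sup>2 + 4 * (\<psi> (?t r) - m)\<^sup>2)"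
        using sq[of "\<phi> (r *\<^sub>R \<omega>) - \<phi> (?t r *\<^sub>R \<omega>)" "\<phi> (?t r *\<^sub>R \<omega>) - \<psi> (?t r)" "\<psi> (?t r) - m"] by simp
      from ennreal_leI[OF this]
      show "ennreal ((\<phi> (r *\<^sub>R \<omega>) - m)\<^sup>2) \<le> 2 * ennreal ((\<phi> (r *\<^sub>R \<omega>) - \<phi> (?t r *\<^sub>R \<omega>))\<^sup>2) +
         (4 * ennreal ((\<phi> (?t r *\<^sub>R \<omega>) - \<psi> (?t r))\<^sup>2) + 4 * ennreal ((\<psi> (?t r) - m)\<^sup>2))"
        by (simp add: ennreal_plus ennreal_mult)
    qed
    also have "\<dots> = 2 * (\<integral>\<^sup>+\<omega>. ennreal ((\<phi> (r *\<^sub>R \<omega>) - \<phi> (?t r *\<^sub>R \<omega>))\<^sup>2) \<partial>uniform_sphere) +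
        (4 * V (?t r) + 4 * ennreal ((\<psi> (?t r) - m)\<^sup>2))"
      unfolding V_def
      by (simp add: nn_integral_add nn_integral_cmult uniform_sphere.emeasure_space_1[simplified])
    finally have le: "(\<integral>\<^sup>+\<omega>. ennreal ((\<phi> (r *\<^sub>R \<omega>) - m)\<^sup>2) \<partial>uniform_sphere) \<le> \<dots>" .
    show "A r * ennreal (f r) * (\<integral>\<^sup>+\<omega>. ennreal ((\<phi> (r *\<^sub>R \<omega>) - m)\<^sup>2) \<partial>uniform_sphere) \<le>
      2 * (A r * ennreal (f r) * (\<integral>\<^sup>+\<omega>. ennreal ((\<phi> (r *\<^sub>R \<omega>) - \<phi> (?t r *\<^sub>R \<omega>))\<^sup>2) \<partial>uniform_sphere)) +
      (4 * (A r * ennreal (f r) * V (?t r)) + 4 * (A r * ennreal (f r) * ennreal ((\<psi> (?t r) - m)\<^sup>2)))"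
      using mult_left_mono[OF le, of "A r * ennreal (f r)"] by (simp add: distrib_left mult_ac)
  qed
  also have "\<dots> = 2 * X + (4 * Y + 4 * Z m)"
    unfolding X_def Y_def Z_def Afz
    by (simp add: nn_integral_add nn_integral_cmult)
  also have "\<dots> \<le> 2 * (8 * D) + (4 * (ennreal CP * D + ennreal (2 * CP) * J) + 4 * D)"
    by (intro add_mono mult_left_mono X_le Y_le Z_le) simp_all
  also have "\<dots> = ennreal (20 + 4 * CP) * D + ennreal (8 * CP) * J"
  proof -
    have "ennreal (20 + 4 * CP) = 2 * 8 + 4 * ennreal CP + 4"
      using CP by (simp add: ennreal_plus ennreal_mult)
    moreover have "ennreal (8 * CP) = 4 * ennreal (2 * CP)"
      using CP by (simp add: ennreal_mult mult.assoc[symmetric])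
    moreover have "2 * (8 * D) + (4 * (c * D + e * J) + 4 * D) = (2 * 8 + 4 * c + 4) * D + (4 * e) * J" for c e
      by (simp only: distrib_left distrib_right mult.assoc add_ac)
    ultimately show ?thesis by (simp only:)
  qed
  also have "\<dots> \<le> ennreal (20 + 8 * CP) * D + ennreal (20 + 8 * CP) * J"
    using CP by (intro add_mono mult_right_mono ennreal_leI) auto
  finally show ?thesis
    unfolding D_def J_def \<gamma>_def by (auto simp: distrib_left)
qed

text \<open>Restrict the equation to the ray through a unit vector.\<close>

lemma radial_equation_to_ode:
  fixes f K :: "real \<Rightarrow> real"
  assumes "\<And>x :: 'a::euclidean_space. x \<noteq> 0 \<Longrightarrow>
     (\<lambda>y :: 'a. K (norm y) * f (norm y)) differentiable (at x) \<and>
     gradient (\<lambda>y :: 'a. K (norm y) * f (norm y)) x + f (norm x) *\<^sub>R x = 0"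
    and r: "0 < r"
  shows "((\<lambda>r. K r * f r) has_real_derivative - r * f r) (at r)"
proof -
  let ?F = "\<lambda>y :: 'a. K (norm y) * f (norm y)"
  obtain e :: 'a where e: "e \<in> Basis" using nonempty_Basis by blast
  then have ne: "norm e = 1" by simp
  have "r *\<^sub>R e \<noteq> 0" using r ne by auto
  from assms(1)[OF this] have d: "?F differentiable (at (r *\<^sub>R e))"
    and "gradient ?F (r *\<^sub>R e) + f (norm (r *\<^sub>R e)) *\<^sub>R (r *\<^sub>R e) = 0" by blast+
  then have g: "gradient ?F (r *\<^sub>R e) = - (f r *\<^sub>R (r *\<^sub>R e))"
    using r ne by (simp add: eq_neg_iff_add_eq_0)
  have "((\<lambda>t. ?F (t *\<^sub>R e)) has_derivative (\<lambda>h. (h *\<^sub>R e) \<bullet> gradient ?F (r *\<^sub>R e))) (at r)"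
    using GDERIV_gradient[OF d, unfolded gderiv_def]
    by (intro has_derivative_compose[of "\<lambda>t. t *\<^sub>R e" "\<lambda>h. h *\<^sub>R e" r UNIV ?F])
       (auto intro!: derivative_eq_intros)
  then have "((\<lambda>t. ?F (t *\<^sub>R e)) has_real_derivative - r * f r) (at r)"
    by (rule has_derivative_imp_has_field_derivative)
       (use ne in \<open>simp add: g dot_square_norm\<close>)
  then show ?thesis
    by (rule has_field_derivative_transform_within_open[where S = "{0<..}"]) (use r ne in auto)
qed

text \<open>The passage from nonnegative extended integrals to real ones. The density is only constrained on positive
  radii, so its value at the origin has to be discarded as a null event throughout.\<close>

theorem radial_density_poincare:
  fixes X :: "'m \<Rightarrow> 'a::euclidean_space" and f K w :: "real \<Rightarrow> real" and \<phi> :: "'a \<Rightarrow> real"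
  defines "W \<equiv> \<lambda>R r. max (w r) (r\<^sup>2) * indicator {..R} r + K r * indicator {R<..} r"
  assumes n: "2 \<le> DIM('a)" and M: "prob_space M"
    and f0: "\<And>r. 0 < r \<Longrightarrow> 0 \<le> f r"
    and X: "distributed M lborel X (\<lambda>x. ennreal (f (norm x)))"
    and K0: "\<And>r. 0 < r \<Longrightarrow> 0 < K r"
    and eq: "\<And>x :: 'a. x \<noteq> 0 \<Longrightarrow> (\<lambda>y :: 'a. K (norm y) * f (norm y)) differentiable (at x) \<and>
         gradient (\<lambda>y :: 'a. K (norm y) * f (norm y)) x + f (norm x) *\<^sub>R x = 0"
    and R: "0 < R" and KR: "\<And>r. R \<le> r \<Longrightarrow> (real DIM('a) - 1) * (K r / r\<^sup>2) \<le> 1 / 2"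
    and wp: "weighted_poincare {0<..} w (\<lambda>\<rho>. unit_sphere_area DIM('a) * \<rho> ^ (DIM('a) - 1) * f \<rho>)"
    and sm: "smooth_on UNIV \<phi>" and bd: "\<And>x. \<bar>\<phi> x\<bar> + norm (gradient \<phi> x) \<le> B"
    and int: "integrable lborel (\<lambda>x. W R (norm x) * (norm (gradient \<phi> x))\<^sup>2 * f (norm x))"
  shows "(\<integral>x. (\<phi> x)\<^sup>2 * f (norm x) \<partial>lborel) - (\<integral>y. \<phi> y * f (norm y) \<partial>lborel)\<^sup>2 \<le>
    (20 + 16 * pi * 2 ^ DIM('a) * DIM('a)) *
      ((\<integral>x. W R (norm x) * (norm (gradient \<phi> x))\<^sup>2 * f (norm x) \<partial>lborel)
        + R ^ 3 * (\<integral>x. (norm (gradient \<phi> x))\<^sup>2 * f (norm x) \<partial>sphere_measure R))"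
proof -
  define G where "G = gradient \<phi>"
  define n where "n = DIM('a)"
  define a where "a = unit_sphere_area n"
  define C where "C = 20 + 16 * pi * 2 ^ n * real n"
  define D where "D x = W R (norm x) * (norm (G x))\<^sup>2 * f (norm x)" for x
  define P where "P = density lborel (\<lambda>x::'a. ennreal (f (norm x)))"
  have a: "0 < a" unfolding a_def n_def by (rule unit_sphere_area_pos) simp
  have C: "0 \<le> C" by (simp add: C_def)
  have Ck: "Ck_on k UNIV \<phi>" for k using sm by (simp add: smooth_on_def)
  have \<phi>c: "continuous_on UNIV \<phi>" using Ck[of 0] by simp
  have Gc: "continuous_on UNIV G" unfolding G_def by (rule has_derivative_gradient(2)[OF Ck])
  note [measurable] = borel_measurable_continuous_onI[OF \<phi>c] borel_measurable_continuous_onI[OF Gc]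
  have \<phi>B: "\<bar>\<phi> x\<bar> \<le> B" and GB: "norm (G x) \<le> B" for x
    using bd[of x] norm_ge_zero[of "gradient \<phi> x"] unfolding G_def by linarith+
  have w0: "0 \<le> w r" if "0 < r" for r using wp that by (simp add: weighted_poincare_def)
  have AE0: "AE x in lborel. x \<noteq> (0::'a)" by (rule AE_lborel_singleton)
  have D0: "0 \<le> D x" if "x \<noteq> 0" for x
    using that f0[of "norm x"] K0[of "norm x"] w0[of "norm x"]
    by (auto simp: D_def W_def le_max_iff_disj intro!: mult_nonneg_nonneg split: split_indicator)
  have fm: "(\<lambda>x::'a. f (norm x)) \<in> borel_measurable borel"
  proof -
    have [measurable]: "(\<lambda>x::'a. ennreal (f (norm x))) \<in> borel_measurable borel"
      using distributed_borel_measurable[OF X] by simp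
    have "(\<lambda>x::'a. f (norm x)) = (\<lambda>x. if x = 0 then f 0 else enn2real (ennreal (f (norm x))))"
      using f0 by (auto simp: fun_eq_iff)
    also have "\<dots> \<in> borel_measurable borel" by measurable
    finally show ?thesis .
  qed
  note [measurable] = fm
  have "prob_space P"
    using prob_space.prob_space_distr[OF M distributed_measurable[OF X]]
    by (simp add: P_def distributed_distr_eq_density[OF X])
  then interpret P: prob_space P .
  have PI: "(\<integral>x. u x \<partial>P) = (\<integral>x. u x * f (norm x) \<partial>lborel)"
    if [measurable]: "u \<in> borel_measurable borel" for u :: "'a \<Rightarrow> real"
    unfolding P_def
    by (subst integral_density) (use AE0 f0 in \<open>auto simp: mult.commute elim!: eventually_mono\<close>)
  have sP: "sets P = sets borel" by (simp add: P_def)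
  have mP: "borel_measurable P = borel_measurable borel" by (rule measurable_cong_sets) (simp_all add: sP)
  have i1: "integrable P \<phi>"
    by (rule P.integrable_bounded_measurable[where B = B]) (use \<phi>B in \<open>auto simp: mP\<close>)
  have i2: "integrable P (\<lambda>x. (\<phi> x)\<^sup>2)"
    by (rule P.integrable_bounded_measurable[where B = "B\<^sup>2"])
       (use power_mono[OF \<phi>B abs_ge_zero, of _ 2] in \<open>simp_all add: mP\<close>)
  obtain m where m: "(\<integral>\<^sup>+x. ennreal (f (norm x)) * ennreal ((\<phi> x - m)\<^sup>2) \<partial>lborel) \<le>
    ennreal C * ((\<integral>\<^sup>+x. ennreal (W R (norm x) * f (norm x)) * ennreal ((norm (G x))\<^sup>2) \<partial>lborel) +
      ennreal (R ^ 3 * (a * R ^ (n - 1) * f R)) * (\<integral>\<^sup>+\<omega>. ennreal ((norm (G (R *\<^sub>R \<omega>)))\<^sup>2) \<partial>uniform_sphere))"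
    using radial_poincare[OF n R f0 K0 radial_equation_to_ode[OF eq] KR wp sm GB[unfolded G_def]]
    unfolding G_def a_def n_def W_def C_def by (auto simp: mult_ac)
  have 1: "(\<integral>\<^sup>+x. ennreal (W R (norm x) * f (norm x)) * ennreal ((norm (G x))\<^sup>2) \<partial>lborel) = ennreal (\<integral>x. D x \<partial>lborel)"
  proof -
    have "(\<integral>\<^sup>+x. ennreal (W R (norm x) * f (norm x)) * ennreal ((norm (G x))\<^sup>2) \<partial>lborel) = (\<integral>\<^sup>+x. ennreal (D x) \<partial>lborel)"
      by (intro nn_integral_cong, subst ennreal_mult''[symmetric]) (simp_all add: D_def mult_ac)
    also have "\<dots> = ennreal (\<integral>x. D x \<partial>lborel)"
      using int AE0 D0 by (intro nn_integral_eq_integral) (auto simp: D_def G_def elim!: eventually_mono)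
    finally show ?thesis .
  qed
  have 2: "ennreal (a * R ^ (n - 1) * f R) * (\<integral>\<^sup>+\<omega>. ennreal ((norm (G (R *\<^sub>R \<omega>)))\<^sup>2) \<partial>uniform_sphere) =
     ennreal (\<integral>x. (norm (G x))\<^sup>2 * f (norm x) \<partial>sphere_measure R)"
  proof -
    have sS [measurable_cong]: "sets (sphere_measure R :: 'a measure) = sets borel" by (simp add: sphere_measure_def)
    have uS: "space (sphere_measure R :: 'a measure) = UNIV" using sets_eq_imp_space_eq[OF sS] by simp
    have AES: "AE x in (sphere_measure R :: 'a measure). norm x = R"
      by (rule AE_I[where N = "- sphere 0 R"]) (use emeasure_sphere_measure(2)[OF R] sS in auto)
    have "emeasure (sphere_measure R :: 'a measure) UNIV \<le> emeasure (sphere_measure R) (sphere (0::'a) R) + emeasure (sphere_measure R) (- sphere (0::'a) R)"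
      by (subst Compl_partition[of "sphere (0::'a) R", symmetric]) (rule emeasure_subadditive, auto simp: sS)
    then have fin: "finite_measure (sphere_measure R :: 'a measure)"
      by (intro finite_measureI) (auto simp: uS emeasure_sphere_measure[OF R] top_unique)
    have "integrable (sphere_measure R) (\<lambda>x. (norm (G x))\<^sup>2 * f (norm x))"
    proof (rule finite_measure.integrable_const_bound[OF fin, where B = "B\<^sup>2 * f R"])
      show "AE x in sphere_measure R. norm ((norm (G x))\<^sup>2 * f (norm x)) \<le> B\<^sup>2 * f R"
        using AES
      proof eventually_elim
        case (elim x)
        then show ?case using f0[OF R] power_mono[OF GB norm_ge_zero, of x 2]
          by (simp add: abs_mult mult_right_mono)
      qed
    qed measurable
    moreover have "AE x in sphere_measure R. 0 \<le> (norm (G x))\<^sup>2 * f (norm x)"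
      using AES by eventually_elim (use f0[OF R] in simp)
    ultimately have "ennreal (\<integral>x. (norm (G x))\<^sup>2 * f (norm x) \<partial>sphere_measure R) =
        (\<integral>\<^sup>+x. ennreal ((norm (G x))\<^sup>2 * f (norm x)) \<partial>sphere_measure R)"
      by (rule nn_integral_eq_integral[symmetric])
    also have "\<dots> = (\<integral>\<^sup>+x. ennreal (f R) * ennreal ((norm (G x))\<^sup>2) \<partial>sphere_measure R)"
      by (rule nn_integral_cong_AE, use AES in eventually_elim)
         (use f0[OF R] in \<open>simp add: ennreal_mult mult.commute\<close>)
    also have "\<dots> = ennreal (f R) * (\<integral>\<^sup>+x. ennreal ((norm (G x))\<^sup>2) \<partial>sphere_measure R)"
      by (rule nn_integral_cmult) measurable
    also have "(\<integral>\<^sup>+x. ennreal ((norm (G x))\<^sup>2) \<partial>sphere_measure R) =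
       ennreal (a * R ^ (n - 1)) * (\<integral>\<^sup>+\<omega>. ennreal ((norm (G (R *\<^sub>R \<omega>)))\<^sup>2) \<partial>uniform_sphere)"
      unfolding a_def n_def by (rule nn_integral_sphere_measure[OF R]) measurable
    finally show ?thesis
      using a R f0[OF R] by (simp add: ennreal_mult mult_ac)
  qed
  let ?I = "\<integral>x. D x \<partial>lborel" and ?J = "\<integral>x. (norm (G x))\<^sup>2 * f (norm x) \<partial>sphere_measure R"
  have I0: "0 \<le> ?I" by (rule integral_nonneg_AE) (use AE0 D0 in \<open>auto elim!: eventually_mono\<close>)
  have J0: "0 \<le> ?J"
  proof (rule integral_nonneg_AE)
    show "AE x in sphere_measure R. 0 \<le> (norm (G x))\<^sup>2 * f (norm x)"
      by (rule AE_I[where N = "- sphere 0 R"])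
         (use emeasure_sphere_measure(2)[OF R, where 'a = 'a] f0[OF R] in \<open>auto simp: sphere_measure_def\<close>)
  qed
  have "ennreal (P.expectation (\<lambda>x. (\<phi> x - P.expectation \<phi>)\<^sup>2)) = (\<integral>\<^sup>+x. ennreal ((\<phi> x - P.expectation \<phi>)\<^sup>2) \<partial>P)"
  proof (rule nn_integral_eq_integral[symmetric])
    show "integrable P (\<lambda>x. (\<phi> x - P.expectation \<phi>)\<^sup>2)"
      using i1 i2 by (simp add: power2_diff)
  qed simp
  also have "\<dots> \<le> (\<integral>\<^sup>+x. ennreal ((\<phi> x - m)\<^sup>2) \<partial>P)"
    by (rule P.mean_minimizes[OF i1 i2])
  also have "\<dots> = (\<integral>\<^sup>+x. ennreal (f (norm x)) * ennreal ((\<phi> x - m)\<^sup>2) \<partial>lborel)"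
    unfolding P_def by (rule nn_integral_density) measurable
  also note m
  also have "ennreal C * ((\<integral>\<^sup>+x. ennreal (W R (norm x) * f (norm x)) * ennreal ((norm (G x))\<^sup>2) \<partial>lborel) +
      ennreal (R ^ 3 * (a * R ^ (n - 1) * f R)) * (\<integral>\<^sup>+\<omega>. ennreal ((norm (G (R *\<^sub>R \<omega>)))\<^sup>2) \<partial>uniform_sphere)) =
      ennreal (C * (?I + R ^ 3 * ?J))"
  proof -
    have "ennreal (R ^ 3 * (a * R ^ (n - 1) * f R)) = ennreal (R ^ 3) * ennreal (a * R ^ (n - 1) * f R)"
      using R a f0[OF R] by (intro ennreal_mult) auto
    then show ?thesis
      unfolding 1 mult.assoc[of "ennreal (R ^ 3)"] 2 using C I0 J0 R
      by (simp only: mult.assoc[of "ennreal (R ^ 3)"] 2) (simp add: ennreal_mult ennreal_plus)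
  qed
  finally have "P.variance \<phi> \<le> C * (?I + R ^ 3 * ?J)"
    using C I0 J0 R by (subst (asm) ennreal_le_iff) auto
  then show ?thesis
    unfolding P.variance_eq[OF i1 i2] by (simp add: PI C_def n_def D_def G_def)
qed

theorem theorem19:
  assumes "2 \<le> CARD('n::finite)"
  shows "\<exists>c :: real \<Rightarrow> real. (\<forall>R>0. 0 < c R) \<and>
    (\<forall>(M :: 'm measure) (X :: 'm \<Rightarrow> real ^ 'n) (f_inf :: real \<Rightarrow> real) (K :: real \<Rightarrow> real)
        (w :: real \<Rightarrow> real) (R :: real).
      prob_space M \<longrightarrow>
      (\<forall>r>0. 0 \<le> f_inf r) \<longrightarrow>
      distributed M lborel X (\<lambda>x. ennreal (f_inf (norm x))) \<longrightarrow>
      (\<forall>r>0. 0 < K r) \<longrightarrow>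
      (\<forall>x :: real ^ 'n. x \<noteq> 0 \<longrightarrow>
         (\<lambda>y :: real ^ 'n. K (norm y) * f_inf (norm y)) differentiable (at x) \<and>
         gradient (\<lambda>y :: real ^ 'n. K (norm y) * f_inf (norm y)) x + f_inf (norm x) *\<^sub>R x = 0) \<longrightarrow>
      0 < R \<longrightarrow>
      (\<forall>r\<ge>R. (real CARD('n) - 1) * (K r / r\<^sup>2) \<le> 1 / 2) \<longrightarrow>
      weighted_poincare {0<..} w
        (\<lambda>\<rho>. unit_sphere_area CARD('n) * \<rho> ^ (CARD('n) - 1) * f_inf \<rho>) \<longrightarrow>
      (\<exists>C>0. \<forall>\<phi> :: real ^ 'n \<Rightarrow> real.
         let W = (\<lambda>r. max (w r) (r\<^sup>2) * indicator {..R} r + K r * indicator {R<..} r) in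
         smooth_on UNIV \<phi> \<longrightarrow>
         (\<exists>C\<^sub>\<phi>>0. \<forall>x. \<bar>\<phi> x\<bar> + norm (gradient \<phi> x) \<le> C\<^sub>\<phi>) \<longrightarrow>
         integrable lborel (\<lambda>x. W (norm x) * (norm (gradient \<phi> x))\<^sup>2 * f_inf (norm x)) \<longrightarrow>
         (\<integral>x. (\<phi> x)\<^sup>2 * f_inf (norm x) \<partial>lborel) - (\<integral>y. \<phi> y * f_inf (norm y) \<partial>lborel)\<^sup>2
           \<le> C * ((\<integral>x. W (norm x) * (norm (gradient \<phi> x))\<^sup>2 * f_inf (norm x) \<partial>lborel)
                + c R * (\<integral>x. (norm (gradient \<phi> x))\<^sup>2 * f_inf (norm x) \<partial>sphere_measure R))))"
proof (intro exI[of _ "\<lambda>R. R ^ 3"] conjI allI impI)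
  fix R :: real assume "0 < R"
  then show "0 < R ^ 3" by simp
next
  fix M :: "'m measure" and X :: "'m \<Rightarrow> real ^ 'n" and f_inf K w :: "real \<Rightarrow> real" and R :: real
  assume *: "prob_space M" "\<forall>r>0. 0 \<le> f_inf r"
    "distributed M lborel X (\<lambda>x. ennreal (f_inf (norm x)))" "\<forall>r>0. 0 < K r"
    "\<forall>x :: real ^ 'n. x \<noteq> 0 \<longrightarrow>
         (\<lambda>y :: real ^ 'n. K (norm y) * f_inf (norm y)) differentiable (at x) \<and>
         gradient (\<lambda>y :: real ^ 'n. K (norm y) * f_inf (norm y)) x + f_inf (norm x) *\<^sub>R x = 0"
    "0 < R" "\<forall>r\<ge>R. (real CARD('n) - 1) * (K r / r\<^sup>2) \<le> 1 / 2"
    "weighted_poincare {0<..} w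
        (\<lambda>\<rho>. unit_sphere_area CARD('n) * \<rho> ^ (CARD('n) - 1) * f_inf \<rho>)"
  let ?C = "20 + 16 * pi * 2 ^ CARD('n) * real CARD('n)"
  have "0 < ?C" by (intro add_pos_nonneg) simp_all
  moreover have dim: "DIM(real ^ 'n) = CARD('n)" by simp
  note * = *[folded dim]
  note main = radial_density_poincare[OF assms[folded dim] *(1) *(2)[rule_format] *(3) *(4)[rule_format]
      *(5)[rule_format] *(6) *(7)[rule_format] *(8), unfolded dim]
  ultimately show "\<exists>C>0. \<forall>\<phi> :: real ^ 'n \<Rightarrow> real.
         let W = (\<lambda>r. max (w r) (r\<^sup>2) * indicator {..R} r + K r * indicator {R<..} r) in
         smooth_on UNIV \<phi> \<longrightarrow>
         (\<exists>C\<^sub>\<phi>>0. \<forall>x. \<bar>\<phi> x\<bar> + norm (gradient \<phi> x) \<le> C\<^sub>\<phi>) \<longrightarrow>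
         integrable lborel (\<lambda>x. W (norm x) * (norm (gradient \<phi> x))\<^sup>2 * f_inf (norm x)) \<longrightarrow>
         (\<integral>x. (\<phi> x)\<^sup>2 * f_inf (norm x) \<partial>lborel) - (\<integral>y. \<phi> y * f_inf (norm y) \<partial>lborel)\<^sup>2
           \<le> C * ((\<integral>x. W (norm x) * (norm (gradient \<phi> x))\<^sup>2 * f_inf (norm x) \<partial>lborel)
                + R ^ 3 * (\<integral>x. (norm (gradient \<phi> x))\<^sup>2 * f_inf (norm x) \<partial>sphere_measure R))"
    unfolding Let_def by (intro exI[of _ ?C] conjI allI impI) (assumption, elim exE conjE, rule main, blast+)
qed

end
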